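(* Let $\omega_1,\omega_2$ be nonzero real numbers with $\omega_1\neq\omega_2$ and $|\omega_1|\le|\omega_2|$, and let $\lambda\in\mathbb{C}$ with $\mathrm{Re}\,\lambda\neq0$. Consider the holomorphic system $$\dot x=i\omega_1x+f,\quad \dot y=i\omega_2y+g,\quad \dot z=\lambda z+h,$$ where $f,g,h$ are holomorphic functions of $(x,y,z)$ near $0\in\mathbb{C}^3$ vanishing to order at least $2$. Then: 1) The system has a $y$-invariant holomorphic center manifold at the origin which contains an isochronous center family of period $2\pi/|\omega_2|$. 2) If $\omega_2/\omega_1\notin\mathbb{N}$, it has an $x$-invariant holomorphic center manifold at the origin which contains an isochronous center family of period $2\pi/|\omega_1|$. 3) Suppose $\omega_2/\omega_1=k\in\mathbb{N}$, so $k\ge2$. Apply $k-2$ reduction steps to the Briot–Bouquet system in the $x$-direction. The resulting linear matrix has first diagonal entry $1$; let $\bar p$ be the first component of the resulting constant vector. 3.1) If $\bar p=0$, the system has infinitely many $x$-invariant holomorphic center manifolds at the origin, each containing an isochronous center family of period $2\pi/|\omega_1|$. 3.2) If $\bar p\neq0$, the system has no $x$-invariant holomorphic center manifold at the origin.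
   Context: A (two-dimensional) Briot–Bouquet system is a system $x\,w'(x)=x\,a+Mw+F(x,w)$ for $w=(u,v)$. Here $a\in\mathbb{C}^2$ is called its constant vector, $M$ is a complex $2\times2$ matrix called its linear matrix, and $F$ is holomorphic near $0\in\mathbb{C}^3$ with $F(0)=0$ and $DF(0)=0$. Reduction step: take such a system and a vector $c\in\mathbb{C}^2$ with $(I-M)c=a$. The substitution $w=x(\tilde w+c)$ transforms the system into the Briot–Bouquet system $x\tilde w'=x\tilde a+(M-I)\tilde w+\tilde F(x,\tilde w)$. Here $\tilde a=F_2(1,c)$, where $F_2$ is the homogeneous quadratic part of $F$, and $\tilde F(x,\tilde w)=x^{-1}F(x,x(\tilde w+c))-x\tilde a$. If $1$ is not an eigenvalue of $M$, then $c=(I-M)^{-1}a$ is unique and this is called the reduction step. "Applying $k$ reduction steps" means iterating it $k$ times; zero steps leaves the system unchanged. For a system $\dot x=P$, $\dot y=Q$, $\dot z=R$, the Briot–Bouquet system in the $x$-direction is $$x u'=\frac{Q(x,xu,xv)}{P(x,xu,xv)}-u,\qquad x v'=\frac{R(x,xu,xv)}{P(x,xu,xv)}-v,$$ with unknowns $u=y/x$ and $v=z/x$. Its right-hand side is holomorphic near the origin and vanishes there. An $x$-invariant (resp. $y$-invariant) holomorphic center manifold at the origin is a germ at $0$ of a one-dimensional complex submanifold of $\mathbb{C}^3$ through $0$ that is invariant under the system and tangent at $0$ to the $x$-axis (resp. $y$-axis). Such a manifold $S$ contains an isochronous center family of period $T$ if every real-time trajectory of the system starting at a point of $S\setminus\{0\}$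 sufficiently close to $0$ is periodic of period $T$. $\mathbb{N}=\{1,2,3,\dots\}$. *)

theory Defs
  imports "HOL-Analysis.Analysis"
begin

type_synonym c3 = "complex \<times> complex \<times> complex"

definition cmult3 :: "complex \<Rightarrow> c3 \<Rightarrow> c3" where
  "cmult3 c p = (case p of (x, y, z) \<Rightarrow> (c * x, c * y, c * z))"

definition holo3 :: "(c3 \<Rightarrow> complex) \<Rightarrow> c3 set \<Rightarrow> bool" where
  "holo3 f U \<longleftrightarrow> open U \<and>
     (\<forall>p\<in>U. \<exists>D. (f has_derivative D) (at p) \<and> (\<forall>c v. D (cmult3 c v) = c * D v))"

definition order2 :: "(c3 \<Rightarrow> complex) \<Rightarrow> bool" where
  "order2 f \<longleftrightarrow> f 0 = 0 \<and> (f has_derivative (\<lambda>_. 0)) (at 0)"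

definition vfield :: "real \<Rightarrow> real \<Rightarrow> complex \<Rightarrow> (c3 \<Rightarrow> complex) \<Rightarrow> (c3 \<Rightarrow> complex)
    \<Rightarrow> (c3 \<Rightarrow> complex) \<Rightarrow> c3 \<Rightarrow> c3" where
  "vfield w1 w2 lam f g h p = (case p of (x, y, z) \<Rightarrow>
     (\<i> * complex_of_real w1 * x + f p, \<i> * complex_of_real w2 * y + g p, lam * z + h p))"

definition solves_on :: "c3 set \<Rightarrow> (c3 \<Rightarrow> c3) \<Rightarrow> real set \<Rightarrow> (real \<Rightarrow> c3) \<Rightarrow> bool" where
  "solves_on U V J \<phi> \<longleftrightarrow>
     (\<forall>t\<in>J. \<phi> t \<in> U \<and> (\<phi> has_vector_derivative V (\<phi> t)) (at t within J))"

definition periodic_traj :: "c3 set \<Rightarrow> (c3 \<Rightarrow> c3) \<Rightarrow> real \<Rightarrow> c3 \<Rightarrow> bool" where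
  "periodic_traj U V T p \<longleftrightarrow> (\<exists>\<psi>. solves_on U V UNIV \<psi> \<and> \<psi> 0 = p \<and>
     (\<forall>t. \<psi> (t + T) = \<psi> t) \<and> (\<forall>s. 0 < s \<and> s < T \<longrightarrow> \<psi> s \<noteq> p) \<and>
     (\<forall>J \<phi>. is_interval J \<and> 0 \<in> J \<and> solves_on U V J \<phi> \<and> \<phi> 0 = p \<longrightarrow> (\<forall>t\<in>J. \<phi> t = \<psi> t)))"

definition iso_family :: "c3 set \<Rightarrow> (c3 \<Rightarrow> c3) \<Rightarrow> c3 set \<Rightarrow> real \<Rightarrow> bool" where
  "iso_family U V S T \<longleftrightarrow> (\<exists>\<epsilon>>0. \<forall>p\<in>S. 0 < norm p \<and> norm p < \<epsilon> \<longrightarrow> periodic_traj U V T p)"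

text \<open>One-dimensional complex submanifold germ tangent to the x-axis, as the
  graph y = phi x, z = psi x over a disc, invariant (V tangent to it).\<close>
definition x_graph :: "(complex \<Rightarrow> complex) \<Rightarrow> (complex \<Rightarrow> complex) \<Rightarrow> real \<Rightarrow> c3 set" where
  "x_graph \<phi> \<psi> r = {(x, \<phi> x, \<psi> x) | x. x \<in> ball 0 r}"

definition x_center_manifold :: "c3 set \<Rightarrow> (c3 \<Rightarrow> c3) \<Rightarrow> (complex \<Rightarrow> complex)
    \<Rightarrow> (complex \<Rightarrow> complex) \<Rightarrow> real \<Rightarrow> bool" where
  "x_center_manifold U V \<phi> \<psi> r \<longleftrightarrow> r > 0 \<and>
     \<phi> holomorphic_on ball 0 r \<and> \<psi> holomorphic_on ball 0 r \<and>
     \<phi> 0 = 0 \<and> \<psi> 0 = 0 \<and> deriv \<phi> 0 = 0 \<and> deriv \<psi> 0 = 0 \<and>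
     (\<forall>x\<in>ball 0 r. (x, \<phi> x, \<psi> x) \<in> U \<and>
        (\<exists>c. V (x, \<phi> x, \<psi> x) = (c, c * deriv \<phi> x, c * deriv \<psi> x)))"

definition y_graph :: "(complex \<Rightarrow> complex) \<Rightarrow> (complex \<Rightarrow> complex) \<Rightarrow> real \<Rightarrow> c3 set" where
  "y_graph \<phi> \<psi> r = {(\<phi> y, y, \<psi> y) | y. y \<in> ball 0 r}"

definition y_center_manifold :: "c3 set \<Rightarrow> (c3 \<Rightarrow> c3) \<Rightarrow> (complex \<Rightarrow> complex)
    \<Rightarrow> (complex \<Rightarrow> complex) \<Rightarrow> real \<Rightarrow> bool" where
  "y_center_manifold U V \<phi> \<psi> r \<longleftrightarrow> r > 0 \<and>
     \<phi> holomorphic_on ball 0 r \<and> \<psi> holomorphic_on ball 0 r \<and>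
     \<phi> 0 = 0 \<and> \<psi> 0 = 0 \<and> deriv \<phi> 0 = 0 \<and> deriv \<psi> 0 = 0 \<and>
     (\<forall>y\<in>ball 0 r. (\<phi> y, y, \<psi> y) \<in> U \<and>
        (\<exists>c. V (\<phi> y, y, \<psi> y) = (c * deriv \<phi> y, c, c * deriv \<psi> y)))"

text \<open>Briot--Bouquet systems x w' = x a + M w + F(x,w), represented by (a, M, F).\<close>
type_synonym bbsys = "(complex^2) \<times> (complex^2^2) \<times> (complex \<Rightarrow> complex^2 \<Rightarrow> complex^2)"

definition bb_const :: "bbsys \<Rightarrow> complex^2" where "bb_const B = fst B"
definition bb_matrix :: "bbsys \<Rightarrow> complex^2^2" where "bb_matrix B = fst (snd B)"
definition bb_nonlin :: "bbsys \<Rightarrow> (complex \<Rightarrow> complex^2 \<Rightarrow> complex^2)" where "bb_nonlin B = snd (snd B)"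

text \<open>Homogeneous quadratic part F_2 of F (F vanishing to second order at 0).\<close>
definition quad_part :: "(complex \<Rightarrow> complex^2 \<Rightarrow> complex^2) \<Rightarrow> complex \<Rightarrow> complex^2 \<Rightarrow> complex^2" where
  "quad_part F x w = Lim (at 0) (\<lambda>t. inverse (t ^ 2) *s F (t * x) (t *s w))"

text \<open>The reduction step (with c = (I - M)^(-1) a).  Note that in HOL
  inverse 0 = 0, so the formula gives the holomorphic extension at x = 0.\<close>
definition reduce_step :: "bbsys \<Rightarrow> bbsys" where
  "reduce_step B = (let a = bb_const B; M = bb_matrix B; F = bb_nonlin B;
      c = matrix_inv (mat 1 - M) *v a; a' = quad_part F 1 c
    in (a', M - mat 1, \<lambda>x w. inverse x *s F x (x *s (w + c)) - x *s a'))"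

definition bb_of_rhs :: "(complex \<Rightarrow> complex^2 \<Rightarrow> complex^2) \<Rightarrow> bbsys" where
  "bb_of_rhs G = (let a = (\<chi> i. deriv (\<lambda>x. G x 0 $ i) 0);
                      M = (\<chi> i j. deriv (\<lambda>t. G 0 (t *s axis j 1) $ i) 0)
                  in (a, M, \<lambda>x w. G x w - x *s a - M *v w))"

definition bb_x_raw :: "(c3 \<Rightarrow> c3) \<Rightarrow> complex \<Rightarrow> complex^2 \<Rightarrow> complex^2" where
  "bb_x_raw V x w = (let u = w $ 1; v = w $ 2; p = V (x, x * u, x * v)
     in (\<chi> i. if i = 1 then fst (snd p) / fst p - u else snd (snd p) / fst p - v))"

definition bb_x_rhs :: "(c3 \<Rightarrow> c3) \<Rightarrow> complex \<Rightarrow> complex^2 \<Rightarrow> complex^2" where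
  "bb_x_rhs V x w = (if x = 0 then Lim (at 0) (\<lambda>t. bb_x_raw V t w) else bb_x_raw V x w)"

end

theory Submission
  imports Defs "HOL-Complex_Analysis.Conformal_Mappings"
begin

text \<open>
  An invariant curve tangent to the \<open>x\<close>-axis is sought in parametrised form: a holomorphic \<open>\<Gamma>\<close> with
  \<open>\<i> \<omega>\<^sub>1 s \<Gamma>'(s) = V(\<Gamma>(s))\<close>, \<open>\<Gamma>(0) = 0\<close> and \<open>\<Gamma>'(0) = (1, 0, 0)\<close>. Then \<open>t \<mapsto> \<Gamma>(exp(\<i> \<omega>\<^sub>1 t) s\<^sub>0)\<close> are
  trajectories, so the isochronous family comes for free, and inverting the first component of \<open>\<Gamma>\<close>
  turns the curve into a graph. The coefficient of \<open>s^n\<close> in \<open>\<Gamma>\<close> is determined by the lower ones unless \<open>n\<close> is one of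
  the eigenvalues \<open>1\<close>, \<open>\<omega>\<^sub>2/\<omega>\<^sub>1\<close>, \<open>\<lambda>/(\<i> \<omega>\<^sub>1)\<close>, and a jet of sufficiently high order is corrected to
  an exact solution by a contraction.

  Writing \<open>y = Y(x)\<close>, \<open>z = Z(x)\<close> for the polynomial graph accumulated by \<open>j\<close> reduction steps, the constant vector after these
  steps is, up to the factor \<open>\<i> \<omega>\<^sub>1\<close>, the leading coefficient (of \<open>x^(j+2)\<close>) of the invariance defect \<open>(Q - Y' P, R - Z' P)\<close>
  of this graph. At \<open>j = k - 2\<close> the degree \<open>k\<close> coefficient of \<open>Y\<close> no longer influences the first
  component, so \<open>pbar\<close> is the obstruction to an invariant graph; if it vanishes, that coefficient is free.
\<close>

section \<open>Order of vanishing at the origin\<close>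

text \<open>The equation for \<Gamma> is singular at s = 0: its differential part is the Euler
  operator s d/ds, which multiplies s^n by n. Inverting it on functions of size |s|^N gains a factor
  1/N, so any Lipschitz constant of the field, however large, is beaten by starting from a jet of
  high enough order. Re lam \<noteq> 0 keeps lam/(\<i> w1) away from the naturals; beyond the
  eigenvalue 1, which normalises \<Gamma>'(0), only w2/w1 can be resonant. Coefficients are never
  extracted from power series in three variables. Orders of vanishing are O-bounds, and the estimate
  behind all jet computations is that a change of order n in a curve through 0 alters f, g, h only
  at order n + 1. The obstacle in the resonant case is that \<open>reduce_step\<close> acts on bare
  functions, by limits and matrix inverses, with no analyticity attached. The invariant
  \<open>reduced_jet\<close> therefore couples the reduced system to a concrete graph. Its identity
  in w is purely algebraic, so it can be demanded for all w, even where the argument of f, g, h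
  leaves U.\<close>

definition vanishes :: "nat \<Rightarrow> (complex \<Rightarrow> 'a::real_normed_vector) \<Rightarrow> bool" where
  "vanishes n f \<longleftrightarrow> (\<exists>K. \<forall>\<^sub>F s in nhds 0. norm (f s) \<le> K * norm s ^ n)"

lemma vanishesI:
  assumes "\<forall>\<^sub>F s in nhds 0. norm (f s) \<le> K * norm s ^ n"
  shows "vanishes n f"
  using assms unfolding vanishes_def by blast

lemma vanishesE:
  assumes "vanishes n f"
  obtains K where "K > 0" "\<forall>\<^sub>F s in nhds 0. norm (f s) \<le> K * norm s ^ n"
proof -
  obtain K where K: "\<forall>\<^sub>F s in nhds 0. norm (f s) \<le> K * norm s ^ n"
    using assms unfolding vanishes_def by blast
  have "\<forall>\<^sub>F s in nhds 0. norm (f s) \<le> max K 1 * norm s ^ n"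
    using K
  proof eventually_elim
    case (elim s)
    have "K * norm s ^ n \<le> max K 1 * norm s ^ n"
      by (intro mult_right_mono) auto
    with elim show ?case by linarith
  qed
  then show ?thesis using that[of "max K 1"] by simp
qed

lemma eventually_norm_less_nhds_0:
  assumes "e > 0"
  shows "\<forall>\<^sub>F s in nhds (0::'a::real_normed_vector). norm s < e"
  using assms eventually_nhds_metric[of "\<lambda>s. norm s < e" 0] by (auto simp: dist_norm)

lemma vanishes_le_bound:
  assumes "vanishes n g" "\<forall>\<^sub>F s in nhds 0. norm (f s) \<le> C * norm (g s)" "C \<ge> 0"
  shows "vanishes n f"
proof -
  obtain K where "\<forall>\<^sub>F s in nhds 0. norm (g s) \<le> K * norm s ^ n" using vanishesE[OF assms(1)] by blast
  with assms(2) have "\<forall>\<^sub>F s in nhds 0. norm (f s) \<le> (C * K) * norm s ^ n"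
  proof eventually_elim
    case (elim s)
    have "C * norm (g s) \<le> C * (K * norm s ^ n)" using elim assms(3) by (intro mult_left_mono) auto
    with elim show ?case by (simp add: mult.assoc)
  qed
  then show ?thesis by (rule vanishesI)
qed

lemma vanishes_cong:
  assumes "vanishes n g" "\<forall>\<^sub>F s in nhds 0. f s = g s"
  shows "vanishes n f"
  by (rule vanishes_le_bound[OF assms(1), of f 1]) (use assms(2) in \<open>auto elim: eventually_mono\<close>)

lemma vanishes_add:
  assumes "vanishes n f" "vanishes n g"
  shows "vanishes n (\<lambda>s. f s + g s)"
proof -
  obtain K where K: "\<forall>\<^sub>F s in nhds 0. norm (f s) \<le> K * norm s ^ n" using vanishesE[OF assms(1)] by blast
  obtain L where L: "\<forall>\<^sub>F s in nhds 0. norm (g s) \<le> L * norm s ^ n" using vanishesE[OF assms(2)] by blast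
  from K L have "\<forall>\<^sub>F s in nhds 0. norm (f s + g s) \<le> (K + L) * norm s ^ n"
  proof eventually_elim
    case (elim s)
    then show ?case using norm_triangle_ineq[of "f s" "g s"] by (simp add: distrib_right)
  qed
  then show ?thesis by (rule vanishesI)
qed

lemma vanishes_minus: "vanishes n f \<Longrightarrow> vanishes n (\<lambda>s. - f s)"
  unfolding vanishes_def by simp

lemma vanishes_diff:
  assumes "vanishes n f" "vanishes n g"
  shows "vanishes n (\<lambda>s. f s - g s)"
  using vanishes_add[OF assms(1) vanishes_minus[OF assms(2)]] by simp

lemma vanishes_mono:
  assumes "vanishes n f" "m \<le> n"
  shows "vanishes m f"
proof -
  obtain K where K: "K > 0" "\<forall>\<^sub>F s in nhds 0. norm (f s) \<le> K * norm s ^ n"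
    using vanishesE[OF assms(1)] by blast
  have "\<forall>\<^sub>F s in nhds (0::complex). norm s < 1" by (rule eventually_norm_less_nhds_0) simp
  with K(2) have "\<forall>\<^sub>F s in nhds 0. norm (f s) \<le> K * norm s ^ m"
  proof eventually_elim
    case (elim s)
    have "norm s ^ n \<le> norm s ^ m" using elim assms(2) by (intro power_decreasing) auto
    then have "K * norm s ^ n \<le> K * norm s ^ m" using K(1) by simp
    with elim show ?case by linarith
  qed
  then show ?thesis by (rule vanishesI)
qed

lemma vanishes_mult:
  fixes f g :: "complex \<Rightarrow> complex"
  assumes "vanishes m f" "vanishes n g"
  shows "vanishes (m + n) (\<lambda>s. f s * g s)"
proof -
  obtain K where K: "K > 0" "\<forall>\<^sub>F s in nhds 0. norm (f s) \<le> K * norm s ^ m"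
    using vanishesE[OF assms(1)] by blast
  obtain L where L: "\<forall>\<^sub>F s in nhds 0. norm (g s) \<le> L * norm s ^ n"
    using vanishesE[OF assms(2)] by blast
  from K(2) L have "\<forall>\<^sub>F s in nhds 0. norm (f s * g s) \<le> (K * L) * norm s ^ (m + n)"
  proof eventually_elim
    case (elim s)
    have "norm (f s) * norm (g s) \<le> (K * norm s ^ m) * (L * norm s ^ n)"
      using elim K(1) by (intro mult_mono) auto
    then show ?case by (simp add: norm_mult power_add mult_ac)
  qed
  then show ?thesis by (rule vanishesI)
qed

lemma vanishes_power: "vanishes n (\<lambda>s::complex. s ^ n)"
  by (rule vanishesI[of _ 1]) (simp add: norm_power)

lemma vanishes_ident: "vanishes 1 (\<lambda>s::complex. s)"
  using vanishes_power[of 1] by simp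

lemma vanishes_0_isCont:
  assumes "isCont f 0"
  shows "vanishes 0 f"
proof -
  have "\<forall>\<^sub>F s in nhds 0. norm (f s) < norm (f 0) + 1"
    using order_tendstoD(2)[OF tendsto_norm[OF assms[unfolded isCont_def tendsto_at_iff_tendsto_nhds]],
        of "norm (f 0) + 1"] by simp
  then show ?thesis by (intro vanishesI[of _ "norm (f 0) + 1"]) (auto elim: eventually_mono)
qed

lemma vanishes_0_const: "vanishes 0 (\<lambda>_. c)"
  by (rule vanishesI[of _ "norm c"]) simp

lemma vanishes_cmult:
  fixes f :: "complex \<Rightarrow> complex"
  shows "vanishes n f \<Longrightarrow> vanishes n (\<lambda>s. c * f s)"
  using vanishes_mult[OF vanishes_0_const[of c], of n f] by simp

lemma vanishes_pair:
  "vanishes n (\<lambda>s. (f s, g s)) \<longleftrightarrow> vanishes n f \<and> vanishes n g"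
proof (intro iffI conjI)
  assume *: "vanishes n (\<lambda>s. (f s, g s))"
  show "vanishes n f" by (rule vanishes_le_bound[OF *, of f 1]) (simp_all add: norm_Pair)
  show "vanishes n g" by (rule vanishes_le_bound[OF *, of g 1]) (simp_all add: norm_Pair)
next
  assume *: "vanishes n f \<and> vanishes n g"
  obtain K where K: "\<forall>\<^sub>F s in nhds 0. norm (f s) \<le> K * norm s ^ n" using vanishesE[of n f] * by blast
  obtain L where L: "\<forall>\<^sub>F s in nhds 0. norm (g s) \<le> L * norm s ^ n" using vanishesE[of n g] * by blast
  from K L have "\<forall>\<^sub>F s in nhds 0. norm (f s, g s) \<le> (K + L) * norm s ^ n"
  proof eventually_elim
    case (elim s)
    then show ?case using norm_Pair_le[of "f s" "g s"] by (simp add: distrib_right)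
  qed
  then show "vanishes n (\<lambda>s. (f s, g s))" by (rule vanishesI)
qed

text \<open>The bound in \<open>vanishes\<close> holds on a full neighbourhood of 0, the origin
  included, where a positive power of norm s is zero.\<close>

lemma vanishes_Suc_imp_zero:
  assumes "vanishes (Suc n) f"
  shows "f 0 = 0"
  using assms unfolding vanishes_def by (auto dest!: eventually_nhds_x_imp_x)

text \<open>Turns an expansion with remainder into a limit. Constant vectors and quadratic parts of
  Briot-Bouquet systems are defined by limits, and leading coefficients reach them this way.\<close>

lemma tendsto_quotient_of_vanishes:
  fixes f :: "complex \<Rightarrow> complex"
  assumes "vanishes (Suc n) (\<lambda>s. f s - s ^ n * d)"
  shows "((\<lambda>s. f s / s ^ n) \<longlongrightarrow> d) (at 0)"
proof -
  obtain K where K: "K > 0" "\<forall>\<^sub>F s in nhds 0. norm (f s - s ^ n * d) \<le> K * norm s ^ Suc n"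
    using vanishesE[OF assms] by blast
  have "\<forall>\<^sub>F s in at 0. norm (f s / s ^ n - d) \<le> K * norm s"
    unfolding eventually_at_filter
  proof (rule eventually_mono[OF K(2)], intro impI)
    fix s :: complex assume *: "norm (f s - s ^ n * d) \<le> K * norm s ^ Suc n" "s \<noteq> 0"
    then have "f s / s ^ n - d = (f s - s ^ n * d) / s ^ n" by (simp add: field_simps)
    with * show "norm (f s / s ^ n - d) \<le> K * norm s"
      by (simp add: norm_divide norm_power divide_le_eq mult_ac)
  qed
  moreover have "((\<lambda>s::complex. K * norm s) \<longlongrightarrow> 0) (at 0)"
    by (auto intro!: tendsto_eq_intros)
  ultimately have "((\<lambda>s. f s / s ^ n - d) \<longlongrightarrow> 0) (at 0)"
    by (rule Lim_null_comparison)
  then show ?thesis by (simp add: LIM_zero_iff)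
qed

text \<open>Induction on n, splitting off one factor s at a time: f 0 = 0 makes f s / s extend
  holomorphically, and the quotient inherits the bound with the exponent lowered by one.\<close>

lemma analytic_vanishes_factor:
  fixes f :: "complex \<Rightarrow> complex"
  assumes "f analytic_on {0}" "vanishes n f"
  obtains g where "g analytic_on {0}" "\<forall>\<^sub>F s in nhds 0. f s = s ^ n * g s"
  using assms
proof (induction n arbitrary: f thesis)
  case 0
  show ?case by (rule 0(1)[of f]) (use 0 in auto)
next
  case (Suc n)
  have f0: "f 0 = 0" using Suc.prems(3) by (rule vanishes_Suc_imp_zero)
  obtain S where S: "open S" "0 \<in> S" "f holomorphic_on S"
    using Suc.prems(2) analytic_at by blast
  define h where "h = (\<lambda>z. if z = 0 then deriv f 0 else (f z - f 0) / (z - 0))"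
  have h: "h holomorphic_on S" unfolding h_def by (rule pole_lemma) (use S interior_open in auto)
  have fh: "f s = s * h s" for s using f0 by (auto simp: h_def)
  have han: "h analytic_on {0}" using h S analytic_at by blast
  obtain K where K: "K > 0" "\<forall>\<^sub>F s in nhds 0. norm (f s) \<le> K * norm s ^ Suc n"
    using vanishesE[OF Suc.prems(3)] by blast
  have ev: "\<forall>\<^sub>F s in at 0. norm (h s) \<le> K * norm s ^ n"
    unfolding eventually_at_filter
  proof (rule eventually_mono[OF K(2)], intro impI)
    fix s :: complex assume "norm (f s) \<le> K * norm s ^ Suc n" "s \<noteq> 0"
    then show "norm (h s) \<le> K * norm s ^ n" unfolding fh[of s] by (simp add: norm_mult mult_ac)
  qed
  \<comment> \<open>Division by s gives the bound on h only for s \<noteq> 0; continuity carries it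
    to s = 0, which \<open>vanishes\<close> includes.\<close>
  have "isCont h 0" using han by (rule analytic_at_imp_isCont)
  then have "(h \<longlongrightarrow> h 0) (at 0)" by (rule isContD)
  then have "norm (h 0) \<le> K * norm (0::complex) ^ n"
    by (intro tendsto_le[OF _ _ tendsto_norm ev] tendsto_intros) auto
  with ev have "\<forall>\<^sub>F s in nhds 0. norm (h s) \<le> K * norm s ^ n"
    by (simp add: eventually_nhds_conv_at)
  then have "vanishes n h" by (rule vanishesI)
  from Suc.IH[OF _ han this] obtain g where
    g: "g analytic_on {0}" "\<forall>\<^sub>F s in nhds 0. h s = s ^ n * g s" by blast
  show ?case
    by (rule Suc.prems(1)[OF g(1)]) (use g(2) in \<open>auto simp: fh elim!: eventually_mono\<close>)
qed

text \<open>The coefficient d is g 0 for the factorisation f s = s^n g s, and differentiability of g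
  at 0 makes the rest one order smaller. This takes the place of the Taylor coefficient of degree
  n.\<close>

lemma analytic_vanishes_leading:
  fixes f :: "complex \<Rightarrow> complex"
  assumes "f analytic_on {0}" "vanishes n f"
  obtains d where "vanishes (Suc n) (\<lambda>s. f s - s ^ n * d)"
proof -
  obtain g where g: "g analytic_on {0}" "\<forall>\<^sub>F s in nhds 0. f s = s ^ n * g s"
    using analytic_vanishes_factor[OF assms] .
  have gd: "(\<lambda>s. g s - g 0) analytic_on {0}" by (intro analytic_intros g)
  obtain D where "(g has_field_derivative D) (at 0)"
    using g(1) analytic_on_imp_differentiable_at field_differentiable_def by blast
  then have "((\<lambda>s. (g s - g 0) / s) \<longlongrightarrow> D) (at 0)" by (simp add: has_field_derivative_iff)
  then have "((\<lambda>s. norm ((g s - g 0) / s)) \<longlongrightarrow> norm D) (at 0)" by (rule tendsto_norm)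
  then have "\<forall>\<^sub>F s in at 0. norm ((g s - g 0) / s) < norm D + 1" by (rule order_tendstoD) simp
  then have "\<forall>\<^sub>F s in at 0. s \<noteq> 0 \<and> norm ((g s - g 0) / s) < norm D + 1"
    by (simp add: eventually_at_filter)
  then have "\<forall>\<^sub>F s in at 0. norm (g s - g 0) \<le> (norm D + 1) * norm s ^ 1"
    by (rule eventually_mono) (auto simp: norm_divide divide_less_eq mult_ac)
  then have "\<forall>\<^sub>F s in nhds 0. norm (g s - g 0) \<le> (norm D + 1) * norm s ^ 1"
    by (simp add: eventually_nhds_conv_at)
  then have "vanishes 1 (\<lambda>s. g s - g 0)" by (rule vanishesI)
  then have v: "vanishes (n + 1) (\<lambda>s. s ^ n * (g s - g 0))" by (intro vanishes_mult vanishes_power)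
  have "vanishes (Suc n) (\<lambda>s. f s - s ^ n * g 0)"
    by (rule vanishes_cong[OF v[simplified]]) (use g(2) in \<open>auto simp: algebra_simps elim!: eventually_mono\<close>)
  then show ?thesis by (rule that)
qed

lemma analytic_zero_vanishes_1:
  fixes f :: "complex \<Rightarrow> complex"
  assumes "f analytic_on {0}" "f 0 = 0"
  shows "vanishes 1 f"
proof -
  have "vanishes 0 f" by (intro vanishes_0_isCont analytic_at_imp_isCont assms)
  then obtain d where d: "vanishes (Suc 0) (\<lambda>s. f s - s ^ 0 * d)"
    using analytic_vanishes_leading[OF assms(1)] by blast
  from vanishes_Suc_imp_zero[OF d] assms(2) have "d = 0" by simp
  with d show ?thesis by simp
qed

lemma vanishes_0_analytic:
  fixes f :: "complex \<Rightarrow> complex"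
  assumes "f analytic_on {0}"
  shows "vanishes 0 f"
  by (intro vanishes_0_isCont analytic_at_imp_isCont assms)

text \<open>The quotient by s^n tends both to 0 and to c; this is the form in which coefficients are
  compared below.\<close>

lemma vanishes_Suc_coeff_zero:
  fixes c :: complex
  assumes "vanishes (Suc n) (\<lambda>s. s ^ n * c)"
  shows "c = 0"
proof -
  have "((\<lambda>s. (s ^ n * c) / s ^ n) \<longlongrightarrow> 0) (at 0)"
    by (rule tendsto_quotient_of_vanishes) (use assms in simp)
  moreover have "((\<lambda>s. (s ^ n * c) / s ^ n) \<longlongrightarrow> c) (at 0)"
    by (rule tendsto_eventually) (simp add: eventually_at_filter)
  ultimately show ?thesis using tendsto_unique[OF at_neq_bot] by blast
qed

text \<open>A bound on f alone does not control its derivative; the factorisation s^(n+1) g s, valid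
  near every point close to 0, can be differentiated.\<close>

lemma vanishes_deriv:
  fixes f :: "complex \<Rightarrow> complex"
  assumes "f analytic_on {0}" "vanishes (Suc n) f"
  shows "vanishes n (deriv f)"
proof -
  obtain g where g: "g analytic_on {0}" "\<forall>\<^sub>F s in nhds 0. f s = s ^ Suc n * g s"
    using analytic_vanishes_factor[OF assms] .
  obtain S where S: "open S" "0 \<in> S" "g holomorphic_on S"
    using g analytic_at by blast
  have dg: "deriv g analytic_on {0}" using S holomorphic_deriv analytic_at by blast
  have "\<forall>\<^sub>F s in nhds 0. deriv f s = s ^ n * (of_nat (Suc n) * g s + s * deriv g s)"
  proof -
    have "\<forall>\<^sub>F s in nhds 0. \<forall>\<^sub>F t in nhds s. f t = t ^ Suc n * g t"
      using g(2) by (simp add: eventually_eventually)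
    moreover have "\<forall>\<^sub>F s in nhds 0. s \<in> S" using S eventually_nhds by blast
    ultimately show ?thesis
    proof eventually_elim
      case (elim s)
      have "(g has_field_derivative deriv g s) (at s)" using S elim holomorphic_derivI by blast
      then have "((\<lambda>t. t ^ Suc n * g t) has_field_derivative
          s ^ n * (of_nat (Suc n) * g s + s * deriv g s)) (at s)"
        by - ((rule derivative_eq_intros refl | assumption)+, simp add: algebra_simps)
      then have "deriv (\<lambda>t. t ^ Suc n * g t) s = s ^ n * (of_nat (Suc n) * g s + s * deriv g s)"
        by (rule DERIV_imp_deriv)
      moreover have "deriv f s = deriv (\<lambda>t. t ^ Suc n * g t) s"
        using elim(1) by (rule deriv_cong_ev) simp
      ultimately show ?case by simp
    qed
  qed
  moreover have "vanishes (n + 0) (\<lambda>s. s ^ n * (of_nat (Suc n) * g s + s * deriv g s))"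
    by (intro vanishes_mult vanishes_power vanishes_0_analytic analytic_intros g dg)
  ultimately show ?thesis using vanishes_cong by fastforce
qed

section \<open>Holomorphic functions of three variables\<close>

lemma norm_cmult3: "norm (cmult3 c p) = norm c * norm p"
  by (cases p) (simp add: cmult3_def norm_Pair norm_mult power_mult_distrib flip: distrib_left
      add: real_sqrt_mult)

lemma cmult3_Pair [simp]: "cmult3 c (x, y, z) = (c * x, c * y, c * z)"
  by (simp add: cmult3_def)

lemma cmult3_add: "cmult3 (a + b) p = cmult3 a p + cmult3 b p"
  by (cases p) (simp add: distrib_right)

lemma bounded_linear_cmult3: "bounded_linear (\<lambda>c. cmult3 c p)"
  by (rule bounded_linear_intro[of _ "norm p"])
    (auto simp: cmult3_add norm_cmult3, cases p, simp add: scaleR_conv_of_real mult.assoc)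

lemma holo3_derivative:
  assumes "holo3 f U" "p \<in> U"
  obtains D where "(f has_derivative D) (at p)" "\<And>c v. D (cmult3 c v) = c * D v"
  using assms unfolding holo3_def by blast

lemma holo3_open: "holo3 f U \<Longrightarrow> open U"
  by (simp add: holo3_def)

text \<open>The derivative in \<open>holo3\<close> is real linear and commutes with complex scalars,
  so along a holomorphic curve the chain rule yields multiplication by the complex number D (a', b',
  c').\<close>

lemma holo3_compose_field_differentiable:
  assumes "holo3 f U" "(a z, b z, c z) \<in> U"
    and "a field_differentiable (at z)" "b field_differentiable (at z)" "c field_differentiable (at z)"
  shows "(\<lambda>s. f (a s, b s, c s)) field_differentiable (at z)"
proof -
  obtain a' b' c' where d: "(a has_field_derivative a') (at z)" "(b has_field_derivative b') (at z)"
    "(c has_field_derivative c') (at z)" using assms field_differentiable_def by metis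
  obtain D where D: "(f has_derivative D) (at (a z, b z, c z))" "\<And>c v. D (cmult3 c v) = c * D v"
    using holo3_derivative[OF assms(1,2)] by metis
  have "((\<lambda>s. (a s, b s, c s)) has_derivative (\<lambda>t. (a' * t, b' * t, c' * t))) (at z)"
    using d unfolding has_field_derivative_def by (intro has_derivative_Pair)
  from has_derivative_compose[OF this D(1)]
  have "((\<lambda>s. f (a s, b s, c s)) has_derivative (\<lambda>t. D (a' * t, b' * t, c' * t))) (at z)" .
  moreover have "D (a' * t, b' * t, c' * t) = D (a', b', c') * t" for t
    using D(2)[of t "(a', b', c')"] by (simp add: mult_ac)
  ultimately have "((\<lambda>s. f (a s, b s, c s)) has_field_derivative D (a', b', c')) (at z)"
    by (simp only: has_field_derivative_def)
  then show ?thesis unfolding field_differentiable_def by blast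
qed

lemma holo3_compose_holomorphic:
  assumes "holo3 f U" "open S" "\<And>z. z \<in> S \<Longrightarrow> (a z, b z, c z) \<in> U"
    and "a holomorphic_on S" "b holomorphic_on S" "c holomorphic_on S"
  shows "(\<lambda>s. f (a s, b s, c s)) holomorphic_on S"
proof -
  have "(\<lambda>s. f (a s, b s, c s)) field_differentiable at z within S" if z: "z \<in> S" for z
  proof -
    have d: "a field_differentiable at z" "b field_differentiable at z" "c field_differentiable at z"
      using holomorphic_on_imp_differentiable_at assms(2,4-6) z by blast+
    show ?thesis
      by (rule field_differentiable_at_within[OF holo3_compose_field_differentiable[OF assms(1) assms(3)[OF z] d]])
  qed
  then show ?thesis by (simp add: holomorphic_on_def)
qed

lemma holo3_compose_analytic:
  assumes "holo3 f U" "(a 0, b 0, c 0) \<in> U"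
    and "a analytic_on {0}" "b analytic_on {0}" "c analytic_on {0}"
  shows "(\<lambda>s. f (a s, b s, c s)) analytic_on {0}"
proof -
  obtain A B C where S: "open A" "0 \<in> A" "a holomorphic_on A" "open B" "0 \<in> B" "b holomorphic_on B"
    "open C" "0 \<in> C" "c holomorphic_on C" using assms analytic_at by metis
  define T where "T = A \<inter> B \<inter> C"
  have T: "open T" "0 \<in> T" "a holomorphic_on T" "b holomorphic_on T" "c holomorphic_on T"
    using S by (auto simp: T_def elim!: holomorphic_on_subset)
  define T' where "T' = T \<inter> (\<lambda>s. (a s, b s, c s)) -` U"
  have "continuous_on T (\<lambda>s. (a s, b s, c s))"
    using T by (intro continuous_intros holomorphic_on_imp_continuous_on)
  then have "open T'" unfolding T'_def
    by (rule continuous_open_preimage[OF _ T(1) holo3_open[OF assms(1)]])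
  moreover have "0 \<in> T'" using assms(2) T by (simp add: T'_def)
  moreover have "(\<lambda>s. f (a s, b s, c s)) holomorphic_on T'"
    by (rule holo3_compose_holomorphic[OF assms(1) \<open>open T'\<close>])
      (use T in \<open>auto simp: T'_def elim!: holomorphic_on_subset\<close>)
  ultimately show ?thesis using analytic_at by blast
qed

section \<open>Restriction to complex lines, Cauchy estimates and Lipschitz bounds\<close>

lemma holo3_line:
  assumes "holo3 f U" "\<And>t. t \<in> S \<Longrightarrow> p + cmult3 t v \<in> U" "open S"
  shows "(\<lambda>t. f (p + cmult3 t v)) holomorphic_on S"
proof -
  obtain x y z a b c where pv: "p = (x, y, z)" "v = (a, b, c)" by (metis prod_cases3)
  have "(\<lambda>t. f (x + t * a, y + t * b, z + t * c)) holomorphic_on S"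
    by (rule holo3_compose_holomorphic[OF assms(1,3)])
      (use assms(2) in \<open>auto simp: pv intro!: holomorphic_intros\<close>)
  then show ?thesis by (simp add: pv)
qed

lemma holo3_derivative_line:
  assumes "(f has_derivative D) (at p)" "\<And>c v. D (cmult3 c v) = c * D v"
  shows "((\<lambda>t. f (p + cmult3 t v)) has_field_derivative D v) (at 0)"
proof -
  have z: "cmult3 0 v = 0" by (cases v) (simp add: zero_prod_def)
  have "((\<lambda>t. p + cmult3 t v) has_derivative (\<lambda>t. 0 + cmult3 t v)) (at 0)"
    by (intro has_derivative_add has_derivative_const
        bounded_linear_imp_has_derivative bounded_linear_cmult3)
  from has_derivative_compose[OF this, of f D]
  have "((\<lambda>t. f (p + cmult3 t v)) has_derivative (\<lambda>t. D (cmult3 t v))) (at 0)"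
    using assms(1) by (simp add: z)
  then show ?thesis by (simp add: has_field_derivative_def assms(2) mult_commute_abs)
qed

text \<open>Cauchy's inequality for the one-variable function f (p + t u), with u the unit vector
  along v; \<open>cmult3 t u\<close> has norm |t|, so the disc of radius \<rho> is mapped into the
  ball.\<close>

lemma holo3_derivative_bound:
  assumes "holo3 f U" "\<rho> > 0" "cball p \<rho> \<subseteq> U" "\<And>q. q \<in> cball p \<rho> \<Longrightarrow> norm (f q) \<le> B"
    and D: "(f has_derivative D) (at p)" "\<And>c v. D (cmult3 c v) = c * D v"
  shows "norm (D v) \<le> B / \<rho> * norm v"
proof (cases "v = 0")
  case True
  have "D 0 = 0" using D(1) has_derivative_bounded_linear bounded_linear.linear linear_0 by blast
  with True show ?thesis by simp
next
  case False
  define u where "u = cmult3 (1 / of_real (norm v)) v"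
  have nu: "norm u = 1" using False by (simp add: u_def norm_cmult3 norm_divide)
  have v: "v = cmult3 (of_real (norm v)) u"
    using False by (cases v) (simp add: u_def)
  let ?g = "\<lambda>t. f (p + cmult3 t u)"
  have memU: "p + cmult3 t u \<in> cball p \<rho>" if "norm t \<le> \<rho>" for t
    using that by (simp add: dist_norm norm_cmult3 nu)
  define S where "S = {t. p + cmult3 t u \<in> U}"
  have "open S" unfolding S_def
    by (intro open_vimage[of U "\<lambda>t. p + cmult3 t u", unfolded vimage_def] continuous_intros
        linear_continuous_on bounded_linear_cmult3 holo3_open[OF assms(1)])
  have hol: "?g holomorphic_on S" by (rule holo3_line[OF assms(1) _ \<open>open S\<close>]) (simp add: S_def)
  have sub: "cball 0 \<rho> \<subseteq> S" using memU assms(3) by (auto simp: S_def)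
  have "norm ((deriv ^^ 1) ?g 0) \<le> fact 1 * B / \<rho> ^ 1"
  proof (rule Cauchy_inequality)
    show "?g holomorphic_on ball 0 \<rho>" using hol sub by (rule holomorphic_on_subset[OF _ order_trans[OF ball_subset_cball]])
    show "continuous_on (cball 0 \<rho>) ?g" using hol sub holomorphic_on_imp_continuous_on continuous_on_subset by blast
    show "norm (?g x) \<le> B" if "norm (0 - x) = \<rho>" for x using assms(4)[OF memU[of x]] that by simp
  qed fact
  moreover have "deriv ?g 0 = D u" by (intro DERIV_imp_deriv holo3_derivative_line D)
  ultimately have "norm (D u) \<le> B / \<rho>" by simp
  moreover have "norm (D v) = norm v * norm (D u)"
    by (subst v) (simp add: D(2) norm_mult)
  ultimately show ?thesis using mult_left_mono[of "norm (D u)" "B / \<rho>" "norm v"] by (simp add: mult.commute)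
qed

lemma holo3_continuous_on: "holo3 f U \<Longrightarrow> continuous_on U f"
  unfolding holo3_def
  by (meson continuous_at_imp_continuous_on has_derivative_continuous)

lemma holo3_bounded_near:
  assumes "holo3 f U" "p \<in> U"
  obtains r B where "r > 0" "B > 0" "cball p r \<subseteq> U" "\<And>q. q \<in> cball p r \<Longrightarrow> norm (f q) \<le> B"
proof -
  obtain r where r: "r > 0" "cball p r \<subseteq> U" using open_contains_cball_eq[OF holo3_open] assms by metis
  have "compact (f ` cball p r)"
    using holo3_continuous_on[OF assms(1)] r(2) by (intro compact_continuous_image) (auto elim: continuous_on_subset)
  then obtain B where "B > 0" "\<forall>x\<in>f ` cball p r. norm x \<le> B" using compact_imp_bounded bounded_pos by metis
  then show ?thesis using that r by blast
qed

text \<open>The mean value inequality on a convex set; the bound is asked of every complex-linear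
  derivative, so that Cauchy estimates can be fed in directly.\<close>

lemma holo3_lipschitz_of_bound:
  assumes "holo3 f U" "convex S" "S \<subseteq> U" "x \<in> S" "y \<in> S"
    and "\<And>p D v. p \<in> S \<Longrightarrow> (f has_derivative D) (at p) \<Longrightarrow> (\<And>c v. D (cmult3 c v) = c * D v)
      \<Longrightarrow> norm (D v) \<le> L * norm v"
  shows "norm (f x - f y) \<le> L * norm (x - y)"
proof -
  have "\<exists>D. (f has_derivative D) (at p) \<and> (\<forall>c v. D (cmult3 c v) = c * D v)" if "p \<in> S" for p
    by (rule holo3_derivative[OF assms(1), of p]) (use that assms(3) in auto)
  then obtain D where D: "\<And>p. p \<in> S \<Longrightarrow> (f has_derivative D p) (at p)"
     "\<And>p c v. p \<in> S \<Longrightarrow> D p (cmult3 c v) = c * D p v"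
    by metis
  show ?thesis
  proof (rule differentiable_bound[OF assms(2) _ _ assms(4,5)])
    show "(f has_derivative D p) (at p within S)" if "p \<in> S" for p
      using D(1)[OF that] by (rule has_derivative_at_withinI)
    show "onorm (D p) \<le> L" if "p \<in> S" for p
    proof (rule onorm_le)
      show "norm (D p v) \<le> L * norm v" for v using assms(6)[OF that D(1)[OF that] D(2)[OF that]] .
    qed
  qed
qed

text \<open>Cauchy estimates on balls of radius r/2 about points of \<open>ball p (r/2)\<close>;
  these stay in \<open>cball p r\<close>, where f is bounded.\<close>

lemma holo3_locally_lipschitz:
  assumes "holo3 f U" "p \<in> U"
  obtains r L where "r > 0" "L > 0" "ball p r \<subseteq> U"
    "\<And>x y. x \<in> ball p r \<Longrightarrow> y \<in> ball p r \<Longrightarrow> norm (f x - f y) \<le> L * norm (x - y)"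
proof -
  obtain r B where r: "r > 0" "B > 0" "cball p r \<subseteq> U" "\<And>q. q \<in> cball p r \<Longrightarrow> norm (f q) \<le> B"
    using holo3_bounded_near[OF assms] by metis
  have sub: "cball q (r/2) \<subseteq> cball p r" if "q \<in> ball p (r/2)" for q
  proof
    fix s assume "s \<in> cball q (r/2)"
    then show "s \<in> cball p r" using that dist_triangle[of p s q] by auto
  qed
  show ?thesis
  proof (rule that[of "r/2" "B/(r/2)"])
    show "r/2 > 0" "B/(r/2) > 0" using r by auto
    show "ball p (r/2) \<subseteq> U" using r by (auto simp: subset_iff)
    fix x y assume xy: "x \<in> ball p (r/2)" "y \<in> ball p (r/2)"
    show "norm (f x - f y) \<le> B/(r/2) * norm (x - y)"
    proof (rule holo3_lipschitz_of_bound[OF assms(1) convex_ball \<open>ball p (r/2) \<subseteq> U\<close> xy])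
      fix q D v assume q: "q \<in> ball p (r/2)" "(f has_derivative D) (at q)" "\<And>c v. D (cmult3 c v) = c * D v"
      show "norm (D v) \<le> B/(r/2) * norm v"
        by (rule holo3_derivative_bound[OF assms(1) _ _ _ q(2,3)]) (use sub[OF q(1)] r in auto)
    qed
  qed
qed

lemma holomorphic_double_zero_bound:
  assumes "g holomorphic_on ball 0 r" "r > 0" "\<And>t. t \<in> ball 0 r \<Longrightarrow> norm (g t) \<le> B"
    and "g 0 = 0" "deriv g 0 = 0" "norm t < r/2"
  shows "norm (g t) \<le> 32 * B / r^2 * norm t ^ 2"
proof -
  have "norm ((deriv ^^ 0) g t - (\<Sum>i\<le>1. (deriv ^^ i) g 0 * (t - 0) ^ i / fact i))
      \<le> (32 * B / r^2) * norm (t - 0) ^ Suc 1 / fact 1"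
  proof (rule complex_Taylor[of "ball 0 (r/2)" 1 "\<lambda>i. (deriv ^^ i) g"])
    fix i x assume x: "x \<in> ball (0::complex) (r/2)"
    then have "x \<in> ball 0 r" using assms(2) by auto
    moreover have "(deriv ^^ i) g holomorphic_on ball 0 r"
      by (rule holomorphic_higher_deriv[OF assms(1)]) auto
    ultimately have "((deriv ^^ i) g has_field_derivative (deriv ^^ Suc i) g x) (at x)"
      using holomorphic_derivI[of "(deriv ^^ i) g"] by simp
    then show "((deriv ^^ i) g has_field_derivative (deriv ^^ Suc i) g x) (at x within ball 0 (r/2))"
      by (rule has_field_derivative_at_within)
  next
    fix x assume x: "x \<in> ball (0::complex) (r/2)"
    have sub: "cball x (r/4) \<subseteq> ball 0 r"
    proof
      fix s assume "s \<in> cball x (r/4)"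
      then show "s \<in> ball 0 r" using x dist_triangle[of 0 s x] assms(2) by auto
    qed
    \<comment> \<open>Points with norm x < r/2 admit a circle of radius r/4 inside the disc; 2!
      times 4^2 gives the constant 32.\<close>
    have "norm ((deriv ^^ 2) g x) \<le> fact 2 * B / (r/4) ^ 2"
    proof (rule Cauchy_inequality)
      show "g holomorphic_on ball x (r/4)" using assms(1) sub ball_subset_cball holomorphic_on_subset by blast
      show "continuous_on (cball x (r/4)) g"
        using assms(1) sub holomorphic_on_imp_continuous_on continuous_on_subset by blast
      show "norm (g s) \<le> B" if "norm (x - s) = r/4" for s
        using assms(3)[of s] sub that by (auto simp: dist_norm subset_iff)
    qed (use assms(2) in auto)
    then have "norm ((deriv ^^ 2) g x) \<le> 32 * B / r^2" by (simp add: power_divide)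
    then show "norm ((deriv ^^ Suc 1) g x) \<le> 32 * B / r^2" by (simp only: Suc_1)
  qed (use assms in auto)
  then show ?thesis using assms(4,5) by (simp add: numeral_2_eq_2)
qed

text \<open>On the complex line through p the function has a double zero at 0, since value and
  derivative of f vanish there, and the one-variable bound is uniform over unit directions.\<close>

lemma order2_quadratic_bound:
  assumes "holo3 f U" "0 \<in> U" "order2 f"
  obtains r C where "r > 0" "C > 0" "ball 0 r \<subseteq> U"
    "\<And>p. p \<in> ball 0 r \<Longrightarrow> norm (f p) \<le> C * norm p ^ 2"
proof -
  obtain r B where r: "r > 0" "B > 0" "cball 0 r \<subseteq> U" "\<And>q. q \<in> cball 0 r \<Longrightarrow> norm (f q) \<le> B"
    using holo3_bounded_near[OF assms(1,2)] by metis
  show ?thesis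
  proof (rule that[of "r/2" "32 * B / r^2"])
    show "r/2 > 0" "32 * B / r^2 > 0" using r by auto
    show "ball 0 (r/2) \<subseteq> U" using r by (auto simp: subset_iff)
    fix p :: c3 assume p: "p \<in> ball 0 (r/2)"
    show "norm (f p) \<le> 32 * B / r^2 * norm p ^ 2"
    proof (cases "p = 0")
      case True then show ?thesis using assms(3) by (simp add: order2_def)
    next
      case False
      define u where "u = cmult3 (1 / of_real (norm p)) p"
      have nu: "norm u = 1" using False by (simp add: u_def norm_cmult3 norm_divide)
      have pu: "p = 0 + cmult3 (of_real (norm p)) u"
        using False by (cases p) (simp add: u_def zero_prod_def)
      let ?g = "\<lambda>t. f (0 + cmult3 t u)"
      have "norm (?g (of_real (norm p))) \<le> 32 * B / r^2 * norm (complex_of_real (norm p)) ^ 2"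
      proof (rule holomorphic_double_zero_bound)
        show "?g holomorphic_on ball 0 r"
        proof (rule holo3_line[OF assms(1) _ open_ball])
          fix t :: complex assume "t \<in> ball 0 r"
          then have "0 + cmult3 t u \<in> cball 0 r" by (simp add: norm_cmult3 nu)
          then show "0 + cmult3 t u \<in> U" using r(3) by blast
        qed
        show "norm (?g t) \<le> B" if "t \<in> ball 0 r" for t
          using r(4)[of "cmult3 t u"] that by (simp add: norm_cmult3 nu)
        show "?g 0 = 0" using assms(3) by (cases u) (simp add: order2_def flip: zero_prod_def)
        show "deriv ?g 0 = 0"
          using holo3_derivative_line[of f "\<lambda>_. 0" 0 u] assms(3)
          by (intro DERIV_imp_deriv) (simp add: order2_def)
      qed (use r p in auto)
      then show ?thesis using pu by simp
    qed
  qed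
qed

text \<open>On the ball of radius norm x about x, f is at most C (2 norm x)^2, so Cauchy bounds the
  derivative at x by 4 C norm x; the mean value inequality on the ball of radius max (norm p) (norm
  q) finishes. Points of the Cauchy ball have norm at most 2 norm x, and the radius r/3 keeps them
  inside \<open>ball 0 r\<close>.\<close>

lemma order2_lipschitz:
  assumes "holo3 f U" "0 \<in> U" "order2 f"
  obtains r C where "r > 0" "C > 0" "ball 0 r \<subseteq> U"
    "\<And>p q. p \<in> ball 0 r \<Longrightarrow> q \<in> ball 0 r \<Longrightarrow> norm (f p - f q) \<le> C * (norm p + norm q) * norm (p - q)"
proof -
  obtain r C where r: "r > 0" "C > 0" "ball 0 r \<subseteq> U" "\<And>p. p \<in> ball 0 r \<Longrightarrow> norm (f p) \<le> C * norm p ^ 2"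
    using order2_quadratic_bound[OF assms] by metis
  show ?thesis
  proof (rule that[of "r/3" "4 * C"])
    show "r/3 > 0" "4 * C > 0" using r by auto
    show sub: "ball 0 (r/3) \<subseteq> U" using r by (auto simp: subset_iff)
    fix p q :: c3 assume pq: "p \<in> ball 0 (r/3)" "q \<in> ball 0 (r/3)"
    define m where "m = max (norm p) (norm q)"
    have "norm (f p - f q) \<le> (4 * C * m) * norm (p - q)"
    proof (rule holo3_lipschitz_of_bound[OF assms(1) convex_cball])
      show "cball 0 m \<subseteq> U" using pq sub by (auto simp: m_def subset_iff)
      show "p \<in> cball 0 m" "q \<in> cball 0 m" by (auto simp: m_def)
      fix x D v assume x: "x \<in> cball 0 m" "(f has_derivative D) (at x)" "\<And>c v. D (cmult3 c v) = c * D v"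
      show "norm (D v) \<le> (4 * C * m) * norm v"
      \<comment> \<open>At x = 0 the Cauchy ball degenerates, but there the derivative is 0 by
        \<open>order2\<close>.\<close>
      proof (cases "x = 0")
        case True
        then have "D = (\<lambda>_. 0)" using x(2) assms(3) has_derivative_unique unfolding order2_def by blast
        moreover have "0 \<le> m" by (simp add: m_def le_max_iff_disj)
        ultimately show ?thesis using r(2) by simp
      next
        case False
        have b: "norm s \<le> 2 * norm x" if "s \<in> cball x (norm x)" for s
          using that norm_triangle_ineq[of x "s - x"] by (simp add: dist_norm norm_minus_commute)
        have xr: "norm x < r / 3" using x(1) pq by (auto simp: m_def)
        have inr: "s \<in> ball 0 r" if "s \<in> cball x (norm x)" for s
          using b[OF that] xr r(1) by auto
        have "norm (D v) \<le> (C * (2 * norm x) ^ 2) / norm x * norm v"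
        proof (rule holo3_derivative_bound[OF assms(1) _ _ _ x(2,3)])
          show "norm x > 0" using False by simp
          show "cball x (norm x) \<subseteq> U" using inr r(3) by blast
          fix s assume s: "s \<in> cball x (norm x)"
          have "norm s ^ 2 \<le> (2 * norm x) ^ 2" using b[OF s] by (intro power_mono) auto
          then show "norm (f s) \<le> C * (2 * norm x) ^ 2"
            using r(4)[OF inr[OF s]] r(2) by (meson mult_left_mono less_imp_le order_trans)
        qed
        also have "\<dots> = 4 * C * norm x * norm v" using False by (simp add: power2_eq_square)
        also have "\<dots> \<le> 4 * C * m * norm v"
          using x(1) r(2) by (intro mult_right_mono mult_left_mono) auto
        finally show ?thesis .
      qed
    qed
    also have "\<dots> \<le> 4 * C * (norm p + norm q) * norm (p - q)"
      using r(2) by (intro mult_right_mono mult_left_mono) (auto simp: m_def)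
    finally show "norm (f p - f q) \<le> 4 * C * (norm p + norm q) * norm (p - q)" .
  qed
qed

text \<open>The factor norm p + norm q of the Lipschitz bound is itself O(|s|) along curves through
  0, hence the extra order. This gain makes the coefficient equations triangular: a term of degree n
  enters the equation of degree n only through the linear part.\<close>

lemma order2_difference_vanishes:
  assumes "holo3 f U" "0 \<in> U" "order2 f"
    and "vanishes 1 \<gamma>" "vanishes 1 \<delta>" "vanishes n (\<lambda>s. \<gamma> s - \<delta> s)"
  shows "vanishes (Suc n) (\<lambda>s. f (\<gamma> s) - f (\<delta> s))"
proof -
  obtain r C where r: "r > 0" "C > 0" "ball 0 r \<subseteq> U"
    "\<And>p q. p \<in> ball 0 r \<Longrightarrow> q \<in> ball 0 r \<Longrightarrow> norm (f p - f q) \<le> C * (norm p + norm q) * norm (p - q)"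
    using order2_lipschitz[OF assms(1-3)] by metis
  obtain K where K: "K > 0" "\<forall>\<^sub>F s in nhds 0. norm (\<gamma> s) \<le> K * norm s ^ 1" using vanishesE assms(4) by blast
  obtain L where L: "L > 0" "\<forall>\<^sub>F s in nhds 0. norm (\<delta> s) \<le> L * norm s ^ 1" using vanishesE assms(5) by blast
  obtain J where J: "J > 0" "\<forall>\<^sub>F s in nhds 0. norm (\<gamma> s - \<delta> s) \<le> J * norm s ^ n"
    using vanishesE assms(6) by blast
  have "\<forall>\<^sub>F s in nhds (0::complex). norm s < r / (K + L)"
    using r K L by (intro eventually_norm_less_nhds_0) auto
  with K(2) L(2) J(2)
  have "\<forall>\<^sub>F s in nhds 0. norm (f (\<gamma> s) - f (\<delta> s)) \<le> (C * (K + L) * J) * norm s ^ Suc n"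
  proof eventually_elim
    case (elim s)
    have "(K + L) * norm s < r" using elim(4) K L by (simp add: field_simps)
    moreover have "K * norm s \<ge> 0" "L * norm s \<ge> 0" using K L by auto
    ultimately have "\<gamma> s \<in> ball 0 r" "\<delta> s \<in> ball 0 r"
      using elim by (auto simp: distrib_right)
    from r(4)[OF this] have "norm (f (\<gamma> s) - f (\<delta> s)) \<le> C * (norm (\<gamma> s) + norm (\<delta> s)) * norm (\<gamma> s - \<delta> s)" .
    also have "\<dots> \<le> C * (K * norm s + L * norm s) * (J * norm s ^ n)"
      using elim r(2) K L by (intro mult_mono) auto
    finally show ?case by (simp add: algebra_simps)
  qed
  then show ?thesis by (rule vanishesI)
qed

lemma order2_compose_vanishes:
  assumes "holo3 f U" "0 \<in> U" "order2 f" "vanishes 1 \<gamma>"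
  shows "vanishes 2 (\<lambda>s. f (\<gamma> s))"
proof -
  have "vanishes (Suc 1) (\<lambda>s. f (\<gamma> s) - f 0)"
    by (rule order2_difference_vanishes[OF assms]) (use assms(4) in \<open>simp_all add: vanishes_def exI[of _ 0]\<close>)
  then show ?thesis using assms(3) by (simp add: order2_def numeral_2_eq_2)
qed

section \<open>Uniqueness for locally Lipschitz differential equations\<close>

text \<open>The set where the two solutions agree is closed in J by continuity and open by the
  Lipschitz estimate, so connectedness decides. Derivatives are taken within J because
  \<open>periodic_traj\<close> quantifies over solutions on arbitrary intervals.\<close>

lemma ode_unique:
  fixes V :: "'a::real_normed_vector \<Rightarrow> 'a"
  assumes lip: "\<And>p. p \<in> U \<Longrightarrow> \<exists>r>0. \<exists>L>0. \<forall>x\<in>ball p r. \<forall>y\<in>ball p r. norm (V x - V y) \<le> L * norm (x - y)"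
    and J: "is_interval J" "t0 \<in> J" "t \<in> J"
    and \<phi>: "\<And>t. t \<in> J \<Longrightarrow> \<phi> t \<in> U \<and> (\<phi> has_vector_derivative V (\<phi> t)) (at t within J)"
    and \<psi>: "\<And>t. t \<in> J \<Longrightarrow> \<psi> t \<in> U \<and> (\<psi> has_vector_derivative V (\<psi> t)) (at t within J)"
    and eq: "\<phi> t0 = \<psi> t0"
  shows "\<phi> t = \<psi> t"
proof -
  have c\<phi>: "continuous_on J \<phi>" and c\<psi>: "continuous_on J \<psi>"
    by (rule continuous_on_vector_derivative[OF conjunct2[OF \<phi>]], assumption)
      (rule continuous_on_vector_derivative[OF conjunct2[OF \<psi>]], assumption)
  define A where "A = {t \<in> J. \<phi> t - \<psi> t = 0}"
  have conv: "convex J" using J(1) is_interval_convex by blast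
  have "closedin (top_of_set J) A" unfolding A_def
    by (intro continuous_closedin_preimage_constant continuous_intros c\<phi> c\<psi>)
  moreover have "openin (top_of_set J) A"
    unfolding openin_contains_ball
  proof (intro conjI ballI)
    show "A \<subseteq> J" by (auto simp: A_def)
    fix t1 assume t1: "t1 \<in> A"
    then have t1J: "t1 \<in> J" and e1: "\<phi> t1 = \<psi> t1" by (auto simp: A_def)
    obtain r L where rL: "r > 0" "L > 0" "\<And>x y. x \<in> ball (\<phi> t1) r \<Longrightarrow> y \<in> ball (\<phi> t1) r
        \<Longrightarrow> norm (V x - V y) \<le> L * norm (x - y)"
      using lip[of "\<phi> t1"] \<phi>[OF t1J] by metis
    obtain d1 where d1: "d1 > 0" "\<And>t. t \<in> J \<Longrightarrow> dist t t1 < d1 \<Longrightarrow> dist (\<phi> t) (\<phi> t1) < r"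
      using c\<phi> t1J rL(1) unfolding continuous_on_iff by metis
    obtain d2 where d2: "d2 > 0" "\<And>t. t \<in> J \<Longrightarrow> dist t t1 < d2 \<Longrightarrow> dist (\<psi> t) (\<psi> t1) < r"
      using c\<psi> t1J rL(1) unfolding continuous_on_iff by metis
    \<comment> \<open>On a segment from t1 shorter than 1/(2L) the largest difference m satisfies m
      \<le> L m / (2L) = m/2, hence vanishes.\<close>
    define d where "d = min (min d1 d2) (1 / (2 * L))"
    have d: "d > 0" using d1 d2 rL by (simp add: d_def)
    have "\<phi> t = \<psi> t" if t: "t \<in> ball t1 d \<inter> J" for t
    proof -
      define I where "I = closed_segment t1 t"
      have IJ: "I \<subseteq> J" unfolding I_def using conv t1J t by (intro closed_segment_subset) auto
      have Id: "dist s t1 < d" if "s \<in> I" for s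
      proof -
        have "closed_segment t1 t \<subseteq> ball t1 d" using t d by (intro closed_segment_subset) auto
        with that show ?thesis by (auto simp: I_def dist_commute)
      qed
      have near: "\<phi> s \<in> ball (\<phi> t1) r \<and> \<psi> s \<in> ball (\<phi> t1) r" if "s \<in> I" for s
        using d1(2)[of s] d2(2)[of s] Id[OF that] IJ that e1 by (auto simp: d_def dist_commute)
      have "continuous_on I (\<lambda>s. norm (\<phi> s - \<psi> s))"
        by (intro continuous_intros continuous_on_subset[OF c\<phi> IJ] continuous_on_subset[OF c\<psi> IJ])
      moreover have "compact I" "I \<noteq> {}" by (auto simp: I_def)
      ultimately obtain s where s: "s \<in> I" "\<And>u. u \<in> I \<Longrightarrow> norm (\<phi> u - \<psi> u) \<le> norm (\<phi> s - \<psi> s)"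
        using continuous_attains_sup[of I "\<lambda>s. norm (\<phi> s - \<psi> s)"] by blast
      define m where "m = norm (\<phi> s - \<psi> s)"
      have "norm ((\<phi> s - \<psi> s) - (\<phi> t1 - \<psi> t1)) \<le> (L * m) * norm (s - t1)"
      proof (rule differentiable_bound[where S = I and f = "\<lambda>u. \<phi> u - \<psi> u"
            and f' = "\<lambda>u h. h *\<^sub>R (V (\<phi> u) - V (\<psi> u))"])
        show "convex I" by (simp add: I_def)
        show "s \<in> I" "t1 \<in> I" using s by (auto simp: I_def)
        fix u assume u: "u \<in> I"
        then have uJ: "u \<in> J" using IJ by auto
        have "((\<lambda>u. \<phi> u - \<psi> u) has_vector_derivative V (\<phi> u) - V (\<psi> u)) (at u within J)"
          using \<phi>[OF uJ] \<psi>[OF uJ] by (intro has_vector_derivative_diff) auto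
        then show "((\<lambda>u. \<phi> u - \<psi> u) has_derivative (\<lambda>h. h *\<^sub>R (V (\<phi> u) - V (\<psi> u)))) (at u within I)"
          unfolding has_vector_derivative_def by (rule has_derivative_subset[OF _ IJ])
        have "norm (V (\<phi> u) - V (\<psi> u)) \<le> L * norm (\<phi> u - \<psi> u)" using rL(3) near[OF u] by blast
        also have "\<dots> \<le> L * m" using s(2)[OF u] rL(2) by (simp add: m_def)
        finally show "onorm (\<lambda>h. h *\<^sub>R (V (\<phi> u) - V (\<psi> u))) \<le> L * m"
          by (intro onorm_le) (simp add: mult.commute[of "L * m"] mult_left_mono)
      qed
      then have "m \<le> L * m * norm (s - t1)" using e1 by (simp add: m_def)
      also have "\<dots> \<le> L * m * (1 / (2 * L))"
        using Id[OF s(1)] rL(2) by (intro mult_left_mono) (auto simp: d_def dist_norm m_def)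
      also have "\<dots> = m / 2" using rL(2) by simp
      finally have "m \<le> 0" by simp
      then have "norm (\<phi> t - \<psi> t) \<le> 0" using s(2)[of t] by (simp add: m_def I_def)
      then show ?thesis by simp
    qed
    then have "ball t1 d \<inter> J \<subseteq> A" by (auto simp: A_def)
    with d show "\<exists>e>0. ball t1 e \<inter> J \<subseteq> A" by blast
  qed
  moreover have "connected J" using J(1) is_interval_connected by blast
  ultimately have "A = {} \<or> A = J" unfolding connected_clopen by blast
  moreover have "t0 \<in> A" using J eq by (simp add: A_def)
  ultimately have "t \<in> A" using J by blast
  then show ?thesis by (simp add: A_def)
qed

section \<open>Picard iteration for the singular equation\<close>

definition holo_curve :: "(complex \<Rightarrow> c3) \<Rightarrow> complex set \<Rightarrow> bool" where
  "holo_curve \<Gamma> S \<longleftrightarrow> (\<lambda>s. fst (\<Gamma> s)) holomorphic_on S \<and> (\<lambda>s. fst (snd (\<Gamma> s))) holomorphic_on S \<and>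
     (\<lambda>s. snd (snd (\<Gamma> s))) holomorphic_on S"

definition deriv3 :: "(complex \<Rightarrow> c3) \<Rightarrow> complex \<Rightarrow> c3" where
  "deriv3 \<Gamma> s = (deriv (\<lambda>s. fst (\<Gamma> s)) s, deriv (\<lambda>s. fst (snd (\<Gamma> s))) s, deriv (\<lambda>s. snd (snd (\<Gamma> s))) s)"

lemma norm_c3_le: "norm (p::c3) \<le> norm (fst p) + norm (fst (snd p)) + norm (snd (snd p))"
proof -
  obtain x y z where p: "p = (x, y, z)" by (metis prod_cases3)
  show ?thesis using norm_Pair_le[of x "(y, z)"] norm_Pair_le[of y z] by (simp add: p)
qed

lemma norm_c3_components:
  "norm (fst (p::c3)) \<le> norm p" "norm (fst (snd p)) \<le> norm p" "norm (snd (snd p)) \<le> norm p"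
proof -
  obtain x y z where p: "p = (x, y, z)" by (metis prod_cases3)
  show "norm (fst (p::c3)) \<le> norm p" "norm (fst (snd p)) \<le> norm p" "norm (snd (snd p)) \<le> norm p"
    by (auto simp: p norm_Pair intro!: real_le_rsqrt)
qed

text \<open>h 0 = 0 removes the singularity of h s / s, whose primitive on the disc is then
  normalised at 0.\<close>

lemma euler_primitive:
  assumes "h holomorphic_on ball 0 r" "r > 0" "h 0 = 0"
  obtains \<gamma> where "\<gamma> holomorphic_on ball 0 r" "\<gamma> 0 = 0" "\<And>s. s \<in> ball 0 r \<Longrightarrow> s * deriv \<gamma> s = h s"
proof -
  let ?q = "\<lambda>z. if z = 0 then deriv h 0 else (h z - h 0) / (z - 0)"
  have "?q holomorphic_on ball 0 r" by (rule pole_lemma) (use assms in auto)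
  then obtain g where g: "\<And>x. x \<in> ball 0 r \<Longrightarrow> (g has_field_derivative ?q x) (at x within ball 0 r)"
    using holomorphic_convex_primitive'[of "ball 0 r" ?q] by auto
  have g': "((\<lambda>x. g x - g 0) has_field_derivative ?q x) (at x)" if "x \<in> ball 0 r" for x
    using g[OF that] at_within_open[OF that open_ball] by (auto intro!: derivative_eq_intros)
  show ?thesis
  proof (rule that[of "\<lambda>x. g x - g 0"])
    show "(\<lambda>x. g x - g 0) holomorphic_on ball 0 r"
      unfolding holomorphic_on_open[OF open_ball] using g' by blast
    show "s * deriv (\<lambda>x. g x - g 0) s = h s" if "s \<in> ball 0 r" for s
      using DERIV_imp_deriv[OF g'[OF that]] assms(3) by auto
  qed simp
qed

lemma holo_curve_primitive:
  assumes "holo_curve H (ball 0 r)" "r > 0" "H 0 = 0"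
  obtains \<Gamma> where "holo_curve \<Gamma> (ball 0 r)" "\<Gamma> 0 = 0" "\<And>s. s \<in> ball 0 r \<Longrightarrow> cmult3 s (deriv3 \<Gamma> s) = H s"
proof -
  obtain a where a: "a holomorphic_on ball 0 r" "a 0 = 0" "\<And>s. s \<in> ball 0 r \<Longrightarrow> s * deriv a s = fst (H s)"
    by (rule euler_primitive[of "\<lambda>s. fst (H s)" r]) (use assms in \<open>auto simp: holo_curve_def\<close>)
  obtain b where b: "b holomorphic_on ball 0 r" "b 0 = 0" "\<And>s. s \<in> ball 0 r \<Longrightarrow> s * deriv b s = fst (snd (H s))"
    by (rule euler_primitive[of "\<lambda>s. fst (snd (H s))" r]) (use assms in \<open>auto simp: holo_curve_def\<close>)
  obtain c where c: "c holomorphic_on ball 0 r" "c 0 = 0" "\<And>s. s \<in> ball 0 r \<Longrightarrow> s * deriv c s = snd (snd (H s))"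
    by (rule euler_primitive[of "\<lambda>s. snd (snd (H s))" r]) (use assms in \<open>auto simp: holo_curve_def\<close>)
  show ?thesis
    by (rule that[of "\<lambda>s. (a s, b s, c s)"])
      (use a b c in \<open>auto simp: holo_curve_def deriv3_def zero_prod_def\<close>)
qed

text \<open>Radial integration: along t s the derivative in t is at most \<kappa> |s|^N t^(N-1),
  whose integral over [0,1] produces the factor 1/N on which the contraction rests.\<close>

lemma euler_derivative_bound:
  assumes "\<gamma> holomorphic_on ball 0 r" "\<gamma> 0 = 0" "N \<ge> 1"
    and bd: "\<And>s. s \<in> ball 0 r \<Longrightarrow> norm (s * deriv \<gamma> s) \<le> \<kappa> * norm s ^ N"
    and s: "s \<in> ball 0 r"
  shows "norm (\<gamma> s) \<le> \<kappa> / N * norm s ^ N"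
proof (cases "s = 0")
  case True then show ?thesis using assms(2,3) by (simp add: power_0_left)
next
  case False
  define C where "C = \<kappa> * norm s ^ N"
  have ts: "of_real t * s \<in> ball 0 r" if "0 \<le> t" "t \<le> 1" for t
  proof -
    have "norm (of_real t * s) \<le> 1 * norm s" unfolding norm_mult
      using that by (intro mult_right_mono) auto
    with s show ?thesis by simp
  qed
  have der: "((\<lambda>t. \<gamma> (of_real t * s)) has_vector_derivative (s * deriv \<gamma> (of_real t * s))) (at t)"
    if "0 \<le> t" "t \<le> 1" for t
  proof -
    have "(\<gamma> has_field_derivative deriv \<gamma> (of_real t * s)) (at (of_real t * s))"
      using holomorphic_derivI[OF assms(1) open_ball ts[OF that]] .
    moreover have "((\<lambda>t. of_real t * s) has_vector_derivative s) (at t)"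
      by (auto intro!: derivative_eq_intros simp: has_vector_derivative_def scaleR_conv_of_real)
    ultimately show ?thesis
      using field_vector_diff_chain_at[of "\<lambda>t. of_real t * s" s t \<gamma>] by (simp add: o_def)
  qed
  have "norm (\<gamma> (of_real 1 * s) - \<gamma> (of_real 0 * s)) \<le> C * 1 ^ N / N - C * 0 ^ N / N"
  proof (rule differentiable_bound_general[where \<phi>' = "\<lambda>t. C * t ^ (N - 1)"])
    show "continuous_on {0..1} (\<lambda>t. \<gamma> (of_real t * s))"
      using has_vector_derivative_continuous[OF der] by (intro continuous_at_imp_continuous_on) simp
    show "continuous_on {0..1} (\<lambda>t. C * t ^ N / N)" by (intro continuous_intros) (use assms in auto)
    fix t :: real assume t: "0 < t" "t < 1"
    then show "((\<lambda>t. \<gamma> (of_real t * s)) has_vector_derivative (s * deriv \<gamma> (of_real t * s))) (at t)"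
      using der by auto
    have "((\<lambda>t. C * t ^ N / N) has_field_derivative C * t ^ (N - 1)) (at t)"
      using assms(3) by (auto intro!: derivative_eq_intros)
    then show "((\<lambda>t. C * t ^ N / N) has_vector_derivative C * t ^ (N - 1)) (at t)"
      by (simp add: has_real_derivative_iff_has_vector_derivative)
    \<comment> \<open>The hypothesis at the point t s carries an extra factor t from the Euler
      operator; it is cancelled below, t being positive.\<close>
    have "norm (of_real t * s * deriv \<gamma> (of_real t * s)) \<le> \<kappa> * norm (of_real t * s) ^ N"
      using bd[OF ts] t by simp
    also have "\<dots> = t * (C * t ^ (N - 1))"
      using t assms(3) by (cases N) (simp_all add: C_def norm_mult power_mult_distrib mult_ac)
    finally have "t * norm (s * deriv \<gamma> (of_real t * s)) \<le> t * (C * t ^ (N - 1))"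
      using t by (simp add: norm_mult mult_ac)
    then show "norm (s * deriv \<gamma> (of_real t * s)) \<le> C * t ^ (N - 1)"
      using t by (simp only: mult_le_cancel_left_pos)
  qed simp
  then show ?thesis using assms(2,3) by (simp add: C_def power_0_left)
qed

lemma holo_curve_field_differentiable:
  assumes "holo_curve \<Gamma> S" "open S" "s \<in> S"
  shows "(\<lambda>s. fst (\<Gamma> s)) field_differentiable at s" "(\<lambda>s. fst (snd (\<Gamma> s))) field_differentiable at s"
    "(\<lambda>s. snd (snd (\<Gamma> s))) field_differentiable at s"
  using assms holomorphic_on_imp_differentiable_at unfolding holo_curve_def by blast+

lemma deriv3_diff:
  assumes "holo_curve \<Gamma> S" "holo_curve \<Delta> S" "open S" "s \<in> S"
  shows "deriv3 (\<lambda>s. \<Gamma> s - \<Delta> s) s = deriv3 \<Gamma> s - deriv3 \<Delta> s"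
  using holo_curve_field_differentiable[OF assms(1,3,4)] holo_curve_field_differentiable[OF assms(2,3,4)]
  by (simp add: deriv3_def)

lemma holo_curve_diff:
  "holo_curve \<Gamma> S \<Longrightarrow> holo_curve \<Delta> S \<Longrightarrow> holo_curve (\<lambda>s. \<Gamma> s - \<Delta> s) S"
  by (auto simp: holo_curve_def intro!: holomorphic_intros)

text \<open>The scalar bound is applied to each component; adding the three gives the factor
  3.\<close>

lemma holo_curve_euler_bound:
  assumes "holo_curve \<Gamma> (ball 0 r)" "\<Gamma> 0 = 0" "N \<ge> 1"
    and bd: "\<And>s. s \<in> ball 0 r \<Longrightarrow> norm (cmult3 s (deriv3 \<Gamma> s)) \<le> \<kappa> * norm s ^ N"
    and s: "s \<in> ball 0 r"
  shows "norm (\<Gamma> s) \<le> 3 * \<kappa> / N * norm s ^ N"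
proof -
  have *: "norm (fst (\<Gamma> s)) \<le> \<kappa> / N * norm s ^ N"
    by (rule euler_derivative_bound[OF _ _ assms(3) _ s])
      (use assms(1,2) order_trans[OF norm_c3_components(1) bd] in \<open>auto simp: holo_curve_def deriv3_def\<close>)
  have **: "norm (fst (snd (\<Gamma> s))) \<le> \<kappa> / N * norm s ^ N"
    by (rule euler_derivative_bound[OF _ _ assms(3) _ s])
      (use assms(1,2) order_trans[OF norm_c3_components(2) bd] in \<open>auto simp: holo_curve_def deriv3_def\<close>)
  have ***: "norm (snd (snd (\<Gamma> s))) \<le> \<kappa> / N * norm s ^ N"
    by (rule euler_derivative_bound[OF _ _ assms(3) _ s])
      (use assms(1,2) order_trans[OF norm_c3_components(3) bd] in \<open>auto simp: holo_curve_def deriv3_def\<close>)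
  have "3 * \<kappa> / N * norm s ^ N = \<kappa> / N * norm s ^ N + \<kappa> / N * norm s ^ N + \<kappa> / N * norm s ^ N" by simp
  then show ?thesis using norm_c3_le[of "\<Gamma> s"] * ** *** by linarith
qed

text \<open>Weierstrass' theorem componentwise; convergence of the derivatives lets the differential
  equation pass to the limit.\<close>

lemma holo_curve_uniform_limit:
  assumes "\<And>n. holo_curve (G n) S" "uniform_limit S G \<Gamma> sequentially" "open S"
  shows "holo_curve \<Gamma> S" "s \<in> S \<Longrightarrow> (\<lambda>n. deriv3 (G n) s) \<longlonglongrightarrow> deriv3 \<Gamma> s"
proof -
  have u1: "uniform_limit S (\<lambda>n s. fst (G n s)) (\<lambda>s. fst (\<Gamma> s)) sequentially"
    by (rule bounded_linear.uniform_limit[OF bounded_linear_fst assms(2)])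
  have u2: "uniform_limit S (\<lambda>n s. fst (snd (G n s))) (\<lambda>s. fst (snd (\<Gamma> s))) sequentially"
    by (intro bounded_linear.uniform_limit[OF bounded_linear_fst] bounded_linear.uniform_limit[OF bounded_linear_snd] assms(2))
  have u3: "uniform_limit S (\<lambda>n s. snd (snd (G n s))) (\<lambda>s. snd (snd (\<Gamma> s))) sequentially"
    by (intro bounded_linear.uniform_limit[OF bounded_linear_snd] assms(2))
  have hol: "g holomorphic_on S"
    if "uniform_limit S f g sequentially" "\<And>n. f n holomorphic_on S" for f and g :: "complex \<Rightarrow> complex"
  proof (rule holomorphic_uniform_sequence[OF assms(3) that(2)])
    fix x assume "x \<in> S"
    then obtain d where "d > 0" "cball x d \<subseteq> S" using assms(3) open_contains_cball by blast
    then show "\<exists>d>0. cball x d \<subseteq> S \<and> uniform_limit (cball x d) f g sequentially"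
      using that(1) uniform_limit_on_subset by blast
  qed
  show "holo_curve \<Gamma> S"
    unfolding holo_curve_def using hol[OF u1] hol[OF u2] hol[OF u3] assms(1) by (auto simp: holo_curve_def)
  assume s: "s \<in> S"
  show "(\<lambda>n. deriv3 (G n) s) \<longlonglongrightarrow> deriv3 \<Gamma> s"
    unfolding deriv3_def
    by (intro tendsto_Pair deriv_complex_uniform_limit[OF u1 _ _ assms(3) s]
        deriv_complex_uniform_limit[OF u2 _ _ assms(3) s] deriv_complex_uniform_limit[OF u3 _ _ assms(3) s])
      (use assms(1) in \<open>auto simp: holo_curve_def\<close>)
qed

text \<open>The operator taking \<open>\<Gamma>\<close> to the primitive of \<open>W(\<Gamma>(s))/s\<close> maps a difference bounded by
  \<open>c |s|^N\<close> to one bounded by \<open>(3A/N) c |s|^N\<close>, so it is a contraction once \<open>N\<close> is large.\<close>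

lemma singular_picard:
  fixes W :: "c3 \<Rightarrow> c3"
  assumes "R > 0" "A \<ge> 0" "K \<ge> 0" "W 0 = 0" "N \<ge> 1" "real N \<ge> 6 * A"
    and lip: "\<And>p q. p \<in> ball 0 R \<Longrightarrow> q \<in> ball 0 R \<Longrightarrow> norm (W p - W q) \<le> A * norm (p - q)"
    and comp: "\<And>\<Gamma> S. open S \<Longrightarrow> holo_curve \<Gamma> S \<Longrightarrow> \<Gamma> ` S \<subseteq> ball 0 R \<Longrightarrow> holo_curve (\<lambda>s. W (\<Gamma> s)) S"
    and "r0 > 0" and \<Gamma>0: "holo_curve \<Gamma>0 (ball 0 r0)" "\<Gamma>0 0 = 0"
    and res: "\<And>s. s \<in> ball 0 r0 \<Longrightarrow> norm (cmult3 s (deriv3 \<Gamma>0 s) - W (\<Gamma>0 s)) \<le> K * norm s ^ N"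
  obtains r \<Gamma> where "r > 0" "holo_curve \<Gamma> (ball 0 r)" "\<Gamma> 0 = 0" "\<Gamma> ` ball 0 r \<subseteq> ball 0 R"
    "\<And>s. s \<in> ball 0 r \<Longrightarrow> cmult3 s (deriv3 \<Gamma> s) = W (\<Gamma> s)" "vanishes N (\<lambda>s. \<Gamma> s - \<Gamma>0 s)"
proof -
  \<comment> \<open>Size of the first correction to \<open>\<Gamma>0\<close>, from
    \<open>holo_curve_euler_bound\<close> applied to the residual; the halving corrections then sum
    to at most 2 \<kappa>.\<close>
  define \<kappa> where "\<kappa> = 3 * K / N"
  have \<kappa>: "\<kappa> \<ge> 0" using assms by (simp add: \<kappa>_def)
  have "continuous_on (ball 0 r0) \<Gamma>0"
  proof -
    have "continuous_on (ball 0 r0) (\<lambda>s. (fst (\<Gamma>0 s), fst (snd (\<Gamma>0 s)), snd (snd (\<Gamma>0 s))))"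
      using \<Gamma>0(1) unfolding holo_curve_def
      by (intro continuous_on_Pair holomorphic_on_imp_continuous_on) auto
    then show ?thesis by simp
  qed
  then obtain r1 where r1: "r1 > 0" "\<And>s. s \<in> ball 0 r0 \<Longrightarrow> dist s 0 < r1 \<Longrightarrow> dist (\<Gamma>0 s) (\<Gamma>0 0) < R / 2"
    using \<open>R > 0\<close> \<open>r0 > 0\<close> unfolding continuous_on_iff by (metis centre_in_ball half_gt_zero)
  \<comment> \<open>Together with norm s < 1, the last bound makes the total correction 2 \<kappa>
    |s|^N at most R/2; as \<open>\<Gamma>0\<close> itself stays below R/2, all iterates remain in
    \<open>ball 0 R\<close>.\<close>
  define r where "r = min (min r0 r1) (min 1 (R / (4 * \<kappa> + 1)))"
  have r: "r > 0" "r \<le> r0" "r \<le> r1" "r \<le> 1" using r1 assms \<kappa> by (auto simp: r_def)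
  define B where "B = ball (0::complex) r"
  have small: "2 * \<kappa> * norm s ^ N \<le> R / 2" if "s \<in> B" for s
  proof -
    have "norm s < R / (4 * \<kappa> + 1)" "norm s < 1" using that by (auto simp: B_def r_def)
    then have "norm s * (4 * \<kappa> + 1) < R" using \<kappa> by (simp add: field_simps)
    then have "4 * \<kappa> * norm s \<le> R" using norm_ge_zero[of s] by (simp add: algebra_simps, linarith)
    moreover have "norm s ^ N \<le> norm s ^ 1" using \<open>norm s < 1\<close> assms(5) by (intro power_decreasing) auto
    then have "\<kappa> * norm s ^ N \<le> \<kappa> * norm s" using \<kappa> by (simp add: mult_left_mono)
    ultimately show ?thesis by linarith
  qed
  have \<Gamma>0B: "holo_curve \<Gamma>0 B"
    using \<Gamma>0(1) r(2) unfolding holo_curve_def B_def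
    by (meson holomorphic_on_subset subset_ball)
  have \<Gamma>0R: "norm (\<Gamma>0 s) < R / 2" if "s \<in> B" for s
    using r1(2)[of s] that r \<Gamma>0(2) by (auto simp: B_def)
  define good where "good = (\<lambda>\<Gamma>. holo_curve \<Gamma> B \<and> \<Gamma> 0 = 0 \<and> \<Gamma> ` B \<subseteq> ball 0 R)"
  \<comment> \<open>The primitive is available only for curves inside \<open>ball 0 R\<close>; the
    implication under the quantifier lets a total operator T be chosen.\<close>
  have "\<exists>\<Delta>. good \<Gamma> \<longrightarrow> holo_curve \<Delta> B \<and> \<Delta> 0 = 0 \<and> (\<forall>s\<in>B. cmult3 s (deriv3 \<Delta> s) = W (\<Gamma> s))" for \<Gamma>
  proof (cases "good \<Gamma>")
    case True
    then have "holo_curve (\<lambda>s. W (\<Gamma> s)) B" by (intro comp) (auto simp: good_def B_def)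
    then show ?thesis
      using holo_curve_primitive[of "\<lambda>s. W (\<Gamma> s)" r] True r(1) assms(4) unfolding B_def good_def by metis
  qed auto
  then obtain T where T: "\<And>\<Gamma>. good \<Gamma> \<Longrightarrow> holo_curve (T \<Gamma>) B \<and> T \<Gamma> 0 = 0 \<and>
      (\<forall>s\<in>B. cmult3 s (deriv3 (T \<Gamma>) s) = W (\<Gamma> s))"
    by metis
  have cm: "cmult3 s (p - q) = cmult3 s p - cmult3 s q" for s p q
    by (cases p; cases q) (simp add: right_diff_distrib)
  have contr: "norm (T \<Gamma> s - T \<Delta> s) \<le> c / 2 * norm s ^ N"
    if g: "good \<Gamma>" "good \<Delta>" and c: "\<And>s. s \<in> B \<Longrightarrow> norm (\<Gamma> s - \<Delta> s) \<le> c * norm s ^ N" and s: "s \<in> B"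
    for \<Gamma> \<Delta> c s
  proof -
    have "norm (T \<Gamma> s - T \<Delta> s) \<le> 3 * (A * c) / N * norm s ^ N"
    proof (rule holo_curve_euler_bound[where \<Gamma> = "\<lambda>s. T \<Gamma> s - T \<Delta> s" and r = r, OF _ _ assms(5)])
      show "holo_curve (\<lambda>s. T \<Gamma> s - T \<Delta> s) (ball 0 r)"
        using T[OF g(1)] T[OF g(2)] by (auto simp: B_def intro!: holo_curve_diff)
      show "T \<Gamma> 0 - T \<Delta> 0 = 0" using T[OF g(1)] T[OF g(2)] by simp
      show "s \<in> ball 0 r" using s by (simp add: B_def)
      fix u assume u: "u \<in> ball (0::complex) r"
      then have uB: "u \<in> B" by (simp add: B_def)
      have "deriv3 (\<lambda>s. T \<Gamma> s - T \<Delta> s) u = deriv3 (T \<Gamma>) u - deriv3 (T \<Delta>) u"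
        by (rule deriv3_diff[of _ B]) (use T[OF g(1)] T[OF g(2)] uB in \<open>auto simp: B_def\<close>)
      then have "cmult3 u (deriv3 (\<lambda>s. T \<Gamma> s - T \<Delta> s) u) = W (\<Gamma> u) - W (\<Delta> u)"
        using T[OF g(1)] T[OF g(2)] uB by (simp add: cm)
      also have "norm \<dots> \<le> A * norm (\<Gamma> u - \<Delta> u)"
        using g uB by (intro lip) (auto simp: good_def)
      also have "\<dots> \<le> A * (c * norm u ^ N)" using c[OF uB] assms(2) by (rule mult_left_mono)
      finally show "norm (cmult3 u (deriv3 (\<lambda>s. T \<Gamma> s - T \<Delta> s) u)) \<le> A * c * norm u ^ N" by (simp add: mult.assoc)
    qed
    also have "\<dots> \<le> c / 2 * norm s ^ N"
    \<comment> \<open>The sign of c is open; for c < 0 the assumed bound is already contradictory at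
      a nonzero point of the disc.\<close>
    proof (cases "c \<ge> 0")
      case True
      have "6 * A * c \<le> N * c" using True assms(6) by (intro mult_right_mono) auto
      then have "3 * (A * c) / N \<le> c / 2" using assms(5) by (simp add: field_simps)
      then show ?thesis by (intro mult_right_mono) auto
    next
      case False
      define u where "u = complex_of_real (r / 2)"
      have u: "u \<in> B" "u \<noteq> 0" using r(1) by (auto simp: B_def u_def)
      have "c * norm u ^ N < 0" using u False by (simp add: mult_neg_pos)
      then show ?thesis using c[OF u(1)] norm_ge_zero[of "\<Gamma> u - \<Delta> u"] by linarith
    qed
    finally show ?thesis .
  qed
  have good0: "good \<Gamma>0" using \<Gamma>0B \<Gamma>0(2) \<Gamma>0R \<open>R > 0\<close> by (fastforce simp: good_def)
  define G where "G = (\<lambda>n. (T ^^ n) \<Gamma>0)"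
  have GS: "G (Suc n) = T (G n)" for n by (simp add: G_def)
  have first: "norm (G 1 s - G 0 s) \<le> \<kappa> * norm s ^ N" if s: "s \<in> B" for s
    unfolding \<kappa>_def
  proof (rule holo_curve_euler_bound[where \<Gamma> = "\<lambda>s. G 1 s - G 0 s" and r = r, OF _ _ assms(5)])
    show "holo_curve (\<lambda>s. G 1 s - G 0 s) (ball 0 r)"
      using T[OF good0] \<Gamma>0B by (auto simp: B_def G_def intro!: holo_curve_diff)
    show "G 1 0 - G 0 0 = 0" using T[OF good0] \<Gamma>0 by (simp add: G_def)
    show "s \<in> ball 0 r" using s by (simp add: B_def)
    fix u assume u: "u \<in> ball (0::complex) r"
    then have uB: "u \<in> B" by (simp add: B_def)
    have "deriv3 (\<lambda>s. G 1 s - G 0 s) u = deriv3 (T \<Gamma>0) u - deriv3 \<Gamma>0 u"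
      unfolding G_def by (simp, rule deriv3_diff[of _ B]) (use T[OF good0] \<Gamma>0B uB in \<open>auto simp: B_def\<close>)
    then have "cmult3 u (deriv3 (\<lambda>s. G 1 s - G 0 s) u) = W (\<Gamma>0 u) - cmult3 u (deriv3 \<Gamma>0 u)"
      using T[OF good0] uB by (simp add: cm)
    then show "norm (cmult3 u (deriv3 (\<lambda>s. G 1 s - G 0 s) u)) \<le> K * norm u ^ N"
      using res[of u] u r by (simp add: norm_minus_commute)
  qed
  \<comment> \<open>The partial sums \<kappa> (1 + 1/2 + ... + 1/2^n) = 2 \<kappa> - \<kappa>/2^n
    control the distance from \<open>\<Gamma>0\<close>, and with it membership in
    \<open>good\<close>, at every stage.\<close>
  have main: "good (G n) \<and> good (G (Suc n)) \<and> (\<forall>s\<in>B. norm (G (Suc n) s - G n s) \<le> \<kappa> / 2 ^ n * norm s ^ N)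
    \<and> (\<forall>s\<in>B. norm (G (Suc n) s - \<Gamma>0 s) \<le> (2 * \<kappa> - \<kappa> / 2 ^ n) * norm s ^ N)" for n
  proof -
    have gg: "good \<Delta>" if "holo_curve \<Delta> B" "\<Delta> 0 = 0"
      "\<And>s. s \<in> B \<Longrightarrow> norm (\<Delta> s - \<Gamma>0 s) \<le> (2 * \<kappa> - \<kappa> / 2 ^ n) * norm s ^ N" for \<Delta> n
    proof -
      have "norm (\<Delta> s) < R" if s: "s \<in> B" for s
      proof -
        have "(2 * \<kappa> - \<kappa> / 2 ^ n) * norm s ^ N \<le> 2 * \<kappa> * norm s ^ N"
          using \<kappa> by (intro mult_right_mono) auto
        moreover have "norm (\<Delta> s) \<le> norm (\<Delta> s - \<Gamma>0 s) + norm (\<Gamma>0 s)"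
          using norm_triangle_ineq[of "\<Delta> s - \<Gamma>0 s" "\<Gamma>0 s"] by simp
        ultimately show ?thesis using that(1) \<Gamma>0R[OF s] small[OF s] that
          \<open>\<And>s. s \<in> B \<Longrightarrow> norm (\<Delta> s - \<Gamma>0 s) \<le> (2 * \<kappa> - \<kappa> / 2 ^ n) * norm s ^ N\<close>[OF s] by linarith
      qed
      then show ?thesis using that(1,2) by (auto simp: good_def)
    qed
    show ?thesis
    proof (induction n)
      case 0
      have b: "norm (G (Suc 0) s - \<Gamma>0 s) \<le> \<kappa> * norm s ^ N" if "s \<in> B" for s
        using first[OF that] by (simp add: G_def)
      have "good (G (Suc 0))"
        by (rule gg[where n = 0]) (use T[OF good0] b in \<open>auto simp: G_def\<close>)
      then show ?case using good0 b by (auto simp: G_def)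
    next
      case (Suc n)
      then have g: "good (G n)" "good (G (Suc n))" by auto
      have d: "norm (G (Suc (Suc n)) s - G (Suc n) s) \<le> \<kappa> / 2 ^ Suc n * norm s ^ N" if s: "s \<in> B" for s
        using contr[OF g(2,1) _ s, of "\<kappa> / 2 ^ n"] Suc by (simp add: GS mult.commute)
      have e: "norm (G (Suc (Suc n)) s - \<Gamma>0 s) \<le> (2 * \<kappa> - \<kappa> / 2 ^ Suc n) * norm s ^ N" if s: "s \<in> B" for s
      proof -
        have "norm (G (Suc (Suc n)) s - \<Gamma>0 s) \<le> norm (G (Suc (Suc n)) s - G (Suc n) s) + norm (G (Suc n) s - \<Gamma>0 s)"
          using norm_triangle_ineq[of "G (Suc (Suc n)) s - G (Suc n) s" "G (Suc n) s - \<Gamma>0 s"] by simp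
        also have "\<dots> \<le> \<kappa> / 2 ^ Suc n * norm s ^ N + (2 * \<kappa> - \<kappa> / 2 ^ n) * norm s ^ N"
          using d[OF s] Suc s by (intro add_mono) auto
        also have "\<dots> = (2 * \<kappa> - \<kappa> / 2 ^ Suc n) * norm s ^ N" by (simp add: field_simps)
        finally show ?thesis .
      qed
      have "good (G (Suc (Suc n)))"
        by (rule gg[where n = "Suc n"]) (use T[OF g(2)] e in \<open>auto simp: GS\<close>)
      then show ?case using g d e by blast
    qed
  qed
  define D where "D = (\<lambda>n s. G (Suc n) s - G n s)"
  have tele: "G 0 s + (\<Sum>i<n. D i s) = G n s" for n s
    using sum_lessThan_telescope[of "\<lambda>n. G n s" n] by (simp add: D_def)
  have "\<exists>l. uniform_limit B (\<lambda>n s. \<Sum>i<n. D i s) l sequentially"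
  proof -
    have b: "norm (D n s) \<le> \<kappa> * (1/2) ^ n" if "s \<in> B" for n s
    proof -
      have "norm (D n s) \<le> \<kappa> / 2 ^ n * norm s ^ N" using main[of n] that by (simp add: D_def)
      also have "\<dots> \<le> \<kappa> / 2 ^ n * 1"
        using that r \<kappa> by (intro mult_left_mono power_le_one) (auto simp: B_def)
      finally show ?thesis by (simp add: power_one_over)
    qed
    have "summable (\<lambda>n. \<kappa> * (1/2) ^ n)" by (intro summable_mult summable_geometric) simp
    with b show ?thesis using Weierstrass_m_test[of B D "\<lambda>n. \<kappa> * (1/2) ^ n"] by blast
  qed
  then obtain l where l: "uniform_limit B (\<lambda>n s. \<Sum>i<n. D i s) l sequentially" by blast
  define \<Gamma> where "\<Gamma> = (\<lambda>s. G 0 s + l s)"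
  have ul: "uniform_limit B G \<Gamma> sequentially"
  proof -
    have "uniform_limit B (\<lambda>n s. G 0 s + (\<Sum>i<n. D i s)) (\<lambda>s. G 0 s + l s) sequentially"
      by (intro uniform_limit_add uniform_limit_const l)
    then show ?thesis unfolding tele \<Gamma>_def .
  qed
  have lim: "(\<lambda>n. G n s) \<longlonglongrightarrow> \<Gamma> s" if "s \<in> B" for s
    using ul that by (rule tendsto_uniform_limitI)
  have hG: "holo_curve (G n) B" for n using main[of n] by (simp add: good_def)
  have oB: "open B" by (simp add: B_def)
  have h\<Gamma>: "holo_curve \<Gamma> B" by (rule holo_curve_uniform_limit(1)[OF hG ul oB])
  have bnd: "norm (\<Gamma> s - \<Gamma>0 s) \<le> 2 * \<kappa> * norm s ^ N" if s: "s \<in> B" for s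
  proof (rule tendsto_upperbound)
    show "(\<lambda>n. norm (G (Suc n) s - \<Gamma>0 s)) \<longlonglongrightarrow> norm (\<Gamma> s - \<Gamma>0 s)"
      using LIMSEQ_Suc[OF lim[OF s]] by (intro tendsto_intros)
    have "norm (G (Suc n) s - \<Gamma>0 s) \<le> 2 * \<kappa> * norm s ^ N" for n
    proof -
      have "(2 * \<kappa> - \<kappa> / 2 ^ n) * norm s ^ N \<le> 2 * \<kappa> * norm s ^ N"
        using \<kappa> by (intro mult_right_mono) auto
      then show ?thesis using main[of n] s by fastforce
    qed
    then show "\<forall>\<^sub>F n in sequentially. norm (G (Suc n) s - \<Gamma>0 s) \<le> 2 * \<kappa> * norm s ^ N" by simp
  qed simp
  have \<Gamma>R: "\<Gamma> ` B \<subseteq> ball 0 R"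
  proof (rule image_subsetI)
    fix s assume s: "s \<in> B"
    have "norm (\<Gamma> s) \<le> norm (\<Gamma> s - \<Gamma>0 s) + norm (\<Gamma>0 s)"
      using norm_triangle_ineq[of "\<Gamma> s - \<Gamma>0 s" "\<Gamma>0 s"] by simp
    then show "\<Gamma> s \<in> ball 0 R" using bnd[OF s] small[OF s] \<Gamma>0R[OF s] by simp
  qed
  show ?thesis
  proof (rule that[of r \<Gamma>])
    show "r > 0" by fact
    show "holo_curve \<Gamma> (ball 0 r)" using h\<Gamma> by (simp add: B_def)
    show "\<Gamma> ` ball 0 r \<subseteq> ball 0 R" using \<Gamma>R by (simp add: B_def)
    show "\<Gamma> 0 = 0" using bnd[of 0] r(1) assms(5) \<Gamma>0(2) by (simp add: B_def power_0_left)
    show "vanishes N (\<lambda>s. \<Gamma> s - \<Gamma>0 s)"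
    proof (rule vanishesI[of _ "2 * \<kappa>"])
      have "\<forall>\<^sub>F s in nhds 0. s \<in> B" using oB r(1) by (intro eventually_nhds_in_open) (auto simp: B_def)
      then show "\<forall>\<^sub>F s in nhds 0. norm (\<Gamma> s - \<Gamma>0 s) \<le> 2 * \<kappa> * norm s ^ N"
        by (rule eventually_mono) (rule bnd)
    qed
    fix s assume "s \<in> ball (0::complex) r"
    then have s: "s \<in> B" by (simp add: B_def)
    have bl: "bounded_linear (cmult3 s)"
    proof (rule bounded_linear_intro[of _ "norm s"])
      show "cmult3 s (p + q) = cmult3 s p + cmult3 s q" for p q by (cases p; cases q) (simp add: distrib_left)
      show "cmult3 s (a *\<^sub>R p) = a *\<^sub>R cmult3 s p" for a p by (cases p) simp
      show "norm (cmult3 s p) \<le> norm p * norm s" for p by (simp add: norm_cmult3 mult.commute)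
    qed
    \<comment> \<open>Both sides of the iteration
      \<open>cmult3 s (deriv3 (G (Suc n)) s) = W (G n s)\<close> converge: the left by convergence
      of the derivatives, the right by the Lipschitz bound.\<close>
    have "(\<lambda>n. cmult3 s (deriv3 (G (Suc n)) s)) \<longlonglongrightarrow> cmult3 s (deriv3 \<Gamma> s)"
      by (intro bounded_linear.tendsto[OF bl] LIMSEQ_Suc holo_curve_uniform_limit(2)[OF hG ul oB s])
    moreover have "cmult3 s (deriv3 (G (Suc n)) s) = W (G n s)" for n
      using T[of "G n"] main[of n] s by (simp add: GS)
    ultimately have "(\<lambda>n. W (G n s)) \<longlonglongrightarrow> cmult3 s (deriv3 \<Gamma> s)" by simp
    moreover have "(\<lambda>n. W (G n s)) \<longlonglongrightarrow> W (\<Gamma> s)"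
    proof -
      have "norm (W (G n s) - W (\<Gamma> s)) \<le> A * norm (G n s - \<Gamma> s)" for n
        using main[of n] \<Gamma>R s by (intro lip) (auto simp: good_def)
      then have "\<forall>\<^sub>F n in sequentially. norm (W (G n s) - W (\<Gamma> s)) \<le> A * norm (G n s - \<Gamma> s)"
        by (intro always_eventually allI)
      moreover have "(\<lambda>n. A * norm (G n s - \<Gamma> s)) \<longlonglongrightarrow> 0"
        using tendsto_mult_right_zero[OF tendsto_norm_zero[OF LIM_zero[OF lim[OF s]]]] .
      ultimately have "(\<lambda>n. W (G n s) - W (\<Gamma> s)) \<longlonglongrightarrow> 0"
        by (rule Lim_null_comparison)
      then show ?thesis by (rule LIM_zero_cancel)
    qed
    ultimately show "cmult3 s (deriv3 \<Gamma> s) = W (\<Gamma> s)" using LIMSEQ_unique by blast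
  qed
qed

section \<open>Non-resonant jets extend to invariant curves\<close>

definition diag_field :: "complex \<Rightarrow> complex \<Rightarrow> complex \<Rightarrow> (c3 \<Rightarrow> complex) \<Rightarrow> (c3 \<Rightarrow> complex)
    \<Rightarrow> (c3 \<Rightarrow> complex) \<Rightarrow> c3 \<Rightarrow> c3" where
  "diag_field m1 m2 m3 f g h p = (m1 * fst p + f p, m2 * fst (snd p) + g p, m3 * snd (snd p) + h p)"

definition curve_germ :: "(complex \<Rightarrow> c3) \<Rightarrow> bool" where
  "curve_germ \<Gamma> \<longleftrightarrow> \<Gamma> 0 = 0 \<and> (\<lambda>s. fst (\<Gamma> s)) analytic_on {0} \<and> (\<lambda>s. fst (snd (\<Gamma> s))) analytic_on {0} \<and>
     (\<lambda>s. snd (snd (\<Gamma> s))) analytic_on {0}"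

text \<open>W is meant to be the field divided by the eigenvalue of the chosen direction, so that
  this eigenvalue becomes 1 and exact curves solve s \<Gamma>' = W(\<Gamma>).\<close>

definition euler_residual :: "(c3 \<Rightarrow> c3) \<Rightarrow> (complex \<Rightarrow> c3) \<Rightarrow> complex \<Rightarrow> c3" where
  "euler_residual W \<Gamma> s = cmult3 s (deriv3 \<Gamma> s) - W (\<Gamma> s)"

lemma vanishes_c3_iff:
  fixes \<Gamma> :: "complex \<Rightarrow> c3"
  shows "vanishes n \<Gamma> \<longleftrightarrow> vanishes n (\<lambda>s. fst (\<Gamma> s)) \<and> vanishes n (\<lambda>s. fst (snd (\<Gamma> s))) \<and>
    vanishes n (\<lambda>s. snd (snd (\<Gamma> s)))"
  using vanishes_pair[of n "\<lambda>s. fst (\<Gamma> s)" "\<lambda>s. (fst (snd (\<Gamma> s)), snd (snd (\<Gamma> s)))"]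
    vanishes_pair[of n "\<lambda>s. fst (snd (\<Gamma> s))" "\<lambda>s. snd (snd (\<Gamma> s))"]
  by simp

lemma curve_germ_vanishes: "curve_germ \<Gamma> \<Longrightarrow> vanishes 1 \<Gamma>"
  unfolding vanishes_c3_iff curve_germ_def by (intro conjI analytic_zero_vanishes_1) auto

lemma analytic_at_ball:
  assumes "f analytic_on {0}"
  obtains r where "r > 0" "f holomorphic_on ball 0 r"
  using assms unfolding analytic_on_def by auto

lemma curve_germ_holo_curve:
  assumes "curve_germ \<Gamma>"
  obtains r where "r > 0" "holo_curve \<Gamma> (ball 0 r)"
proof -
  obtain r1 where r1: "r1 > 0" "(\<lambda>s. fst (\<Gamma> s)) holomorphic_on ball 0 r1"
    using assms analytic_at_ball unfolding curve_germ_def by blast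
  obtain r2 where r2: "r2 > 0" "(\<lambda>s. fst (snd (\<Gamma> s))) holomorphic_on ball 0 r2"
    using assms analytic_at_ball unfolding curve_germ_def by blast
  obtain r3 where r3: "r3 > 0" "(\<lambda>s. snd (snd (\<Gamma> s))) holomorphic_on ball 0 r3"
    using assms analytic_at_ball unfolding curve_germ_def by blast
  define r where "r = min r1 (min r2 r3)"
  have "ball 0 r \<subseteq> ball (0::complex) r1" "ball 0 r \<subseteq> ball (0::complex) r2" "ball 0 r \<subseteq> ball (0::complex) r3"
    by (auto simp: r_def)
  then have "holo_curve \<Gamma> (ball 0 r)"
    using r1 r2 r3 holomorphic_on_subset unfolding holo_curve_def by blast
  moreover have "r > 0" using r1 r2 r3 by (simp add: r_def)
  ultimately show ?thesis using that by blast
qed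

lemma holo_curve_imp_curve_germ:
  assumes "holo_curve \<Gamma> (ball 0 r)" "r > 0" "\<Gamma> 0 = 0"
  shows "curve_germ \<Gamma>"
  using assms unfolding holo_curve_def curve_germ_def
  by (auto intro!: holomorphic_on_imp_analytic_at[OF _ open_ball])

lemma holo3_compose_curve_germ:
  assumes "holo3 f U" "0 \<in> U" "curve_germ \<Gamma>"
  shows "(\<lambda>s. f (\<Gamma> s)) analytic_on {0}"
  using holo3_compose_analytic[of f U "\<lambda>s. fst (\<Gamma> s)" "\<lambda>s. fst (snd (\<Gamma> s))" "\<lambda>s. snd (snd (\<Gamma> s))"] assms
  by (simp add: curve_germ_def zero_prod_def)

lemma eventually_deriv_add_power:
  assumes "a analytic_on {0}" "N \<ge> 1"
  shows "\<forall>\<^sub>F s in nhds 0. s * deriv (\<lambda>s. a s + s ^ N * d) s = s * deriv a s + of_nat N * s ^ N * d"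
proof -
  obtain r where r: "r > 0" "a holomorphic_on ball 0 r" using analytic_at_ball[OF assms(1)] .
  have "\<forall>\<^sub>F s in nhds 0. s \<in> ball (0::complex) r" using r(1) by (intro eventually_nhds_in_open) auto
  then show ?thesis
  proof eventually_elim
    case (elim s)
    have "(a has_field_derivative deriv a s) (at s)" using holomorphic_derivI[OF r(2) open_ball elim] .
    then have "((\<lambda>s. a s + s ^ N * d) has_field_derivative deriv a s + of_nat N * s ^ (N - 1) * d) (at s)"
      by (auto intro!: derivative_eq_intros)
    then have "deriv (\<lambda>s. a s + s ^ N * d) s = deriv a s + of_nat N * s ^ (N - 1) * d"
      by (rule DERIV_imp_deriv)
    moreover have "s * s ^ (N - 1) = s ^ N" using assms(2) by (cases N) auto
    ultimately show ?case by (simp add: distrib_left flip: mult.assoc)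
  qed
qed

lemma curve_germ_add_power:
  assumes "curve_germ \<Gamma>" "N \<ge> 1"
  shows "curve_germ (\<lambda>s. \<Gamma> s + cmult3 (s ^ N) d)"
  using assms unfolding curve_germ_def
  by (cases d) (auto intro!: analytic_intros simp: power_0_left zero_prod_def)

lemma vanishes_cmult3_power: "vanishes N (\<lambda>s. cmult3 (s ^ N) d)"
  by (rule vanishesI[of _ "norm d"]) (simp add: norm_cmult3 norm_power mult.commute)

text \<open>s d/ds multiplies s^N by N and the linear part of W multiplies it by m1, m2, m3, while
  f, g, h feel the change only at order N + 1. Resonances show up as zeros of these
  differences.\<close>

lemma euler_residual_add_power:
  fixes m1 m2 m3 :: complex
  assumes "holo3 f U" "holo3 g U" "holo3 h U" "0 \<in> U" "order2 f" "order2 g" "order2 h"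
    and "curve_germ \<Gamma>" "N \<ge> 1"
  defines "W \<equiv> diag_field m1 m2 m3 f g h"
  shows "vanishes (Suc N) (\<lambda>s. euler_residual W (\<lambda>s. \<Gamma> s + cmult3 (s ^ N) (d1, d2, d3)) s - euler_residual W \<Gamma> s
    - cmult3 (s ^ N) ((of_nat N - m1) * d1, (of_nat N - m2) * d2, (of_nat N - m3) * d3))"
proof -
  define \<Delta> where "\<Delta> = (\<lambda>s. \<Gamma> s + cmult3 (s ^ N) (d1, d2, d3))"
  have \<Delta>: "curve_germ \<Delta>" unfolding \<Delta>_def by (rule curve_germ_add_power) fact+
  have v: "vanishes N (\<lambda>s. \<Delta> s - \<Gamma> s)"
    using vanishes_cmult3_power[of N "(d1, d2, d3)"] by (simp only: \<Delta>_def add_diff_cancel_left')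
  have F: "vanishes (Suc N) (\<lambda>s. k (\<Gamma> s) - k (\<Delta> s))" if "holo3 k U" "order2 k" for k
    using vanishes_minus[OF order2_difference_vanishes[OF that(1) assms(4) that(2) curve_germ_vanishes[OF \<Delta>]
        curve_germ_vanishes[OF assms(8)] v]] by simp
  have a: "(\<lambda>s. fst (\<Gamma> s)) analytic_on {0}" "(\<lambda>s. fst (snd (\<Gamma> s))) analytic_on {0}"
    "(\<lambda>s. snd (snd (\<Gamma> s))) analytic_on {0}" using assms(8) by (auto simp: curve_germ_def)
  have "vanishes (Suc N) (\<lambda>s. (f (\<Gamma> s) - f (\<Delta> s), g (\<Gamma> s) - g (\<Delta> s), h (\<Gamma> s) - h (\<Delta> s)))"
    unfolding vanishes_pair using F assms(1-7) by blast
  then have "vanishes (Suc N) (\<lambda>s. euler_residual W \<Delta> s - euler_residual W \<Gamma> s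
    - cmult3 (s ^ N) ((of_nat N - m1) * d1, (of_nat N - m2) * d2, (of_nat N - m3) * d3))"
  proof (rule vanishes_cong)
    show "\<forall>\<^sub>F s in nhds 0. euler_residual W \<Delta> s - euler_residual W \<Gamma> s
        - cmult3 (s ^ N) ((of_nat N - m1) * d1, (of_nat N - m2) * d2, (of_nat N - m3) * d3)
        = (f (\<Gamma> s) - f (\<Delta> s), g (\<Gamma> s) - g (\<Delta> s), h (\<Gamma> s) - h (\<Delta> s))"
      using eventually_deriv_add_power[OF a(1) assms(9), of d1] eventually_deriv_add_power[OF a(2) assms(9), of d2]
        eventually_deriv_add_power[OF a(3) assms(9), of d3]
    proof eventually_elim
      case (elim s)
      have D: "deriv3 \<Delta> s = (deriv (\<lambda>s. fst (\<Gamma> s) + s ^ N * d1) s, deriv (\<lambda>s. fst (snd (\<Gamma> s)) + s ^ N * d2) s,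
          deriv (\<lambda>s. snd (snd (\<Gamma> s)) + s ^ N * d3) s)"
        by (simp add: deriv3_def \<Delta>_def)
      have G: "deriv3 \<Gamma> s = (deriv (\<lambda>s. fst (\<Gamma> s)) s, deriv (\<lambda>s. fst (snd (\<Gamma> s))) s, deriv (\<lambda>s. snd (snd (\<Gamma> s))) s)"
        by (simp add: deriv3_def)
      have c: "fst (\<Delta> s) = fst (\<Gamma> s) + s ^ N * d1" "fst (snd (\<Delta> s)) = fst (snd (\<Gamma> s)) + s ^ N * d2"
        "snd (snd (\<Delta> s)) = snd (snd (\<Gamma> s)) + s ^ N * d3" by (simp_all add: \<Delta>_def)
      show ?case
        unfolding euler_residual_def D G W_def diag_field_def c cmult3_Pair elim
        by (simp add: algebra_simps)
    qed
  qed
  then show ?thesis by (simp add: \<Delta>_def)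
qed

lemma curve_germ_deriv_analytic:
  assumes "curve_germ \<Gamma>"
  shows "(\<lambda>s. fst (deriv3 \<Gamma> s)) analytic_on {0}" "(\<lambda>s. fst (snd (deriv3 \<Gamma> s))) analytic_on {0}"
    "(\<lambda>s. snd (snd (deriv3 \<Gamma> s))) analytic_on {0}"
  using assms unfolding curve_germ_def deriv3_def by (auto intro: analytic_deriv)

text \<open>Each component e of the leading coefficient of the residual is cancelled by d = -e / (N
  - m), which non-resonance at degree N permits.\<close>

lemma jet_step:
  assumes "holo3 f U" "holo3 g U" "holo3 h U" "0 \<in> U" "order2 f" "order2 g" "order2 h"
    and "curve_germ \<Gamma>" "N \<ge> 1" "of_nat N \<noteq> m1" "of_nat N \<noteq> m2" "of_nat N \<noteq> m3"
  defines "W \<equiv> diag_field m1 m2 m3 f g h"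
  assumes res: "vanishes N (euler_residual W \<Gamma>)"
  obtains \<Delta> where "curve_germ \<Delta>" "vanishes N (\<lambda>s. \<Delta> s - \<Gamma> s)" "vanishes (Suc N) (euler_residual W \<Delta>)"
proof -
  note an = assms(8)[unfolded curve_germ_def] curve_germ_deriv_analytic[OF assms(8)]
  have "(\<lambda>s. fst (euler_residual W \<Gamma> s)) analytic_on {0}"
    unfolding euler_residual_def W_def diag_field_def cmult3_def case_prod_beta fst_diff snd_diff fst_conv snd_conv
    using an by (intro analytic_intros holo3_compose_curve_germ[OF assms(1,4,8)]) auto
  from analytic_vanishes_leading[OF this] obtain e1 where e1: "vanishes (Suc N) (\<lambda>s. fst (euler_residual W \<Gamma> s) - s ^ N * e1)"
    using res unfolding vanishes_c3_iff by blast
  have "(\<lambda>s. fst (snd (euler_residual W \<Gamma> s))) analytic_on {0}"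
    unfolding euler_residual_def W_def diag_field_def cmult3_def case_prod_beta fst_diff snd_diff fst_conv snd_conv
    using an by (intro analytic_intros holo3_compose_curve_germ[OF assms(2,4,8)]) auto
  from analytic_vanishes_leading[OF this] obtain e2 where e2: "vanishes (Suc N) (\<lambda>s. fst (snd (euler_residual W \<Gamma> s)) - s ^ N * e2)"
    using res unfolding vanishes_c3_iff by blast
  have "(\<lambda>s. snd (snd (euler_residual W \<Gamma> s))) analytic_on {0}"
    unfolding euler_residual_def W_def diag_field_def cmult3_def case_prod_beta fst_diff snd_diff fst_conv snd_conv
    using an by (intro analytic_intros holo3_compose_curve_germ[OF assms(3,4,8)]) auto
  from analytic_vanishes_leading[OF this] obtain e3 where e3: "vanishes (Suc N) (\<lambda>s. snd (snd (euler_residual W \<Gamma> s)) - s ^ N * e3)"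
    using res unfolding vanishes_c3_iff by blast
  define d1 where "d1 = - e1 / (of_nat N - m1)"
  define d2 where "d2 = - e2 / (of_nat N - m2)"
  define d3 where "d3 = - e3 / (of_nat N - m3)"
  have d: "(of_nat N - m1) * d1 = - e1" "(of_nat N - m2) * d2 = - e2" "(of_nat N - m3) * d3 = - e3"
    using assms(10-12) by (auto simp: d1_def d2_def d3_def)
  define \<Delta> where "\<Delta> = (\<lambda>s. \<Gamma> s + cmult3 (s ^ N) (d1, d2, d3))"
  have E: "vanishes (Suc N) (\<lambda>s. euler_residual W \<Gamma> s - cmult3 (s ^ N) (e1, e2, e3))"
    unfolding vanishes_c3_iff using e1 e2 e3 by simp
  have P: "vanishes (Suc N) (\<lambda>s. euler_residual W \<Delta> s - euler_residual W \<Gamma> s - cmult3 (s ^ N) (- e1, - e2, - e3))"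
    using euler_residual_add_power[OF assms(1-9), of m1 m2 m3 d1 d2 d3] by (simp only: d W_def \<Delta>_def)
  show ?thesis
  proof (rule that[of \<Delta>])
    show "curve_germ \<Delta>" unfolding \<Delta>_def by (rule curve_germ_add_power) fact+
    show "vanishes N (\<lambda>s. \<Delta> s - \<Gamma> s)"
      using vanishes_cmult3_power[of N "(d1, d2, d3)"] by (simp only: \<Delta>_def add_diff_cancel_left')
    have eq: "euler_residual W \<Delta> s - euler_residual W \<Gamma> s - cmult3 (s ^ N) (- e1, - e2, - e3) +
        (euler_residual W \<Gamma> s - cmult3 (s ^ N) (e1, e2, e3)) = euler_residual W \<Delta> s" for s
      by (simp add: algebra_simps flip: zero_prod_def)
    show "vanishes (Suc N) (euler_residual W \<Delta>)"
      using vanishes_add[OF P E] unfolding eq .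
  qed
qed

text \<open>Formulated about an arbitrary point: at 0 it supplies the constant of the contraction,
  elsewhere in U the local condition for uniqueness of trajectories.\<close>

lemma diag_field_lipschitz:
  assumes "holo3 f U" "holo3 g U" "holo3 h U" "p0 \<in> U"
  obtains R A where "R > 0" "A > 0" "ball p0 R \<subseteq> U"
    "\<And>p q. p \<in> ball p0 R \<Longrightarrow> q \<in> ball p0 R \<Longrightarrow>
      norm (diag_field m1 m2 m3 f g h p - diag_field m1 m2 m3 f g h q) \<le> A * norm (p - q)"
proof -
  obtain r1 L1 where 1: "r1 > 0" "L1 > 0" "ball p0 r1 \<subseteq> U"
    "\<And>x y. x \<in> ball p0 r1 \<Longrightarrow> y \<in> ball p0 r1 \<Longrightarrow> norm (f x - f y) \<le> L1 * norm (x - y)"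
    using holo3_locally_lipschitz[OF assms(1,4)] by metis
  obtain r2 L2 where 2: "r2 > 0" "L2 > 0" "ball p0 r2 \<subseteq> U"
    "\<And>x y. x \<in> ball p0 r2 \<Longrightarrow> y \<in> ball p0 r2 \<Longrightarrow> norm (g x - g y) \<le> L2 * norm (x - y)"
    using holo3_locally_lipschitz[OF assms(2,4)] by metis
  obtain r3 L3 where 3: "r3 > 0" "L3 > 0" "ball p0 r3 \<subseteq> U"
    "\<And>x y. x \<in> ball p0 r3 \<Longrightarrow> y \<in> ball p0 r3 \<Longrightarrow> norm (h x - h y) \<le> L3 * norm (x - y)"
    using holo3_locally_lipschitz[OF assms(3,4)] by metis
  have c: "norm (m * a + u - (m * b + v)) \<le> (norm m + L) * n"
    if "norm (u - v) \<le> L * n" "norm (a - b) \<le> n" for m a b u v :: complex and L n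
  proof -
    have "m * a + u - (m * b + v) = m * (a - b) + (u - v)" by (simp add: algebra_simps)
    then have "norm (m * a + u - (m * b + v)) \<le> norm (m * (a - b)) + norm (u - v)"
      by (metis norm_triangle_ineq)
    also have "\<dots> \<le> norm m * n + L * n"
      using that by (intro add_mono) (auto simp: norm_mult intro!: mult_left_mono)
    finally show ?thesis by (simp add: distrib_right)
  qed
  show ?thesis
  proof (rule that[of "min r1 (min r2 r3)" "(norm m1 + L1) + (norm m2 + L2) + (norm m3 + L3)"])
    show "ball p0 (min r1 (min r2 r3)) \<subseteq> U" using 1(3) by (auto simp: subset_iff)
    show "(norm m1 + L1) + (norm m2 + L2) + (norm m3 + L3) > 0"
      using 1 2 3 by (intro add_pos_pos add_nonneg_pos) auto
    fix p q :: c3 assume pq: "p \<in> ball p0 (min r1 (min r2 r3))" "q \<in> ball p0 (min r1 (min r2 r3))"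
    have *: "norm (fst p - fst q) \<le> norm (p - q)" "norm (fst (snd p) - fst (snd q)) \<le> norm (p - q)"
      "norm (snd (snd p) - snd (snd q)) \<le> norm (p - q)" using norm_c3_components[of "p - q"] by auto
    have "norm (diag_field m1 m2 m3 f g h p - diag_field m1 m2 m3 f g h q)
      \<le> norm (m1 * fst p + f p - (m1 * fst q + f q)) + norm (m2 * fst (snd p) + g p - (m2 * fst (snd q) + g q))
        + norm (m3 * snd (snd p) + h p - (m3 * snd (snd q) + h q))"
      using norm_c3_le[of "diag_field m1 m2 m3 f g h p - diag_field m1 m2 m3 f g h q"] by (simp add: diag_field_def)
    also have "\<dots> \<le> (norm m1 + L1) * norm (p - q) + (norm m2 + L2) * norm (p - q) + (norm m3 + L3) * norm (p - q)"
      by (intro add_mono c * 1(4) 2(4) 3(4)) (use pq in auto)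
    finally show "norm (diag_field m1 m2 m3 f g h p - diag_field m1 m2 m3 f g h q)
      \<le> ((norm m1 + L1) + (norm m2 + L2) + (norm m3 + L3)) * norm (p - q)" by (simp add: algebra_simps)
  qed (use 1 2 3 in auto)
qed

text \<open>The contraction asks for a jet of order at least 6 A, with A a Lipschitz constant of W
  near 0, possibly far beyond N. As no resonance occurs from N on, \<open>jet_step\<close> can raise
  the order that far; all corrections are O(|s|^N), so the given jet survives.\<close>

lemma exact_curve_of_jet:
  assumes "holo3 f U" "holo3 g U" "holo3 h U" "0 \<in> U" "order2 f" "order2 g" "order2 h"
    and "curve_germ \<Gamma>" "N \<ge> 1"
    and nonres: "\<And>n. n \<ge> N \<Longrightarrow> of_nat n \<noteq> m1 \<and> of_nat n \<noteq> m2 \<and> of_nat n \<noteq> m3"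
  defines "W \<equiv> diag_field m1 m2 m3 f g h"
  assumes res: "vanishes N (euler_residual W \<Gamma>)"
  obtains r \<Delta> where "r > 0" "holo_curve \<Delta> (ball 0 r)" "\<Delta> 0 = 0" "\<Delta> ` ball 0 r \<subseteq> U"
    "\<forall>s\<in>ball 0 r. cmult3 s (deriv3 \<Delta> s) = W (\<Delta> s)" "vanishes N (\<lambda>s. \<Delta> s - \<Gamma> s)"
proof -
  have W0: "W 0 = 0" using assms(5-7) by (simp add: W_def diag_field_def order2_def zero_prod_def)
  obtain R A where R: "R > 0" "A > 0" "ball 0 R \<subseteq> U"
    "\<And>p q. p \<in> ball 0 R \<Longrightarrow> q \<in> ball 0 R \<Longrightarrow> norm (W p - W q) \<le> A * norm (p - q)"
    using diag_field_lipschitz[OF assms(1-4), of m1 m2 m3] unfolding W_def by metis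
  define M where "M = max N (nat \<lceil>6 * A\<rceil>)"
  have M: "M \<ge> N" "M \<ge> 1" "real M \<ge> 6 * A"
    using assms(9) real_nat_ceiling_ge[of "6 * A"] by (auto simp: M_def)
  have "\<exists>\<Delta>. curve_germ \<Delta> \<and> vanishes N (\<lambda>s. \<Delta> s - \<Gamma> s) \<and> vanishes M (euler_residual W \<Delta>)"
    using M(1)
  proof (induction M rule: dec_induct)
    case base
    have "vanishes N (\<lambda>s. \<Gamma> s - \<Gamma> s)" by (rule vanishesI[of _ 0]) simp
    then show ?case using assms(8) res by blast
  next
    case (step n)
    then obtain \<Delta> where \<Delta>: "curve_germ \<Delta>" "vanishes N (\<lambda>s. \<Delta> s - \<Gamma> s)" "vanishes n (euler_residual W \<Delta>)" by blast
    have n1: "n \<ge> 1" using step assms(9) by simp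
    obtain \<Delta>' where \<Delta>': "curve_germ \<Delta>'" "vanishes n (\<lambda>s. \<Delta>' s - \<Delta> s)" "vanishes (Suc n) (euler_residual W \<Delta>')"
      using jet_step[OF assms(1-7) \<Delta>(1) n1, of m1 m2 m3] nonres[OF step(1)] \<Delta>(3) unfolding W_def by metis
    have "vanishes N (\<lambda>s. (\<Delta>' s - \<Delta> s) + (\<Delta> s - \<Gamma> s))"
      by (intro vanishes_add vanishes_mono[OF \<Delta>'(2) step(1)] \<Delta>(2))
    then show ?case using \<Delta>' by auto
  qed
  then obtain \<Gamma>1 where \<Gamma>1: "curve_germ \<Gamma>1" "vanishes N (\<lambda>s. \<Gamma>1 s - \<Gamma> s)" "vanishes M (euler_residual W \<Gamma>1)" by blast
  obtain r1 where r1: "r1 > 0" "holo_curve \<Gamma>1 (ball 0 r1)" using curve_germ_holo_curve[OF \<Gamma>1(1)] .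
  obtain K where K: "K > 0" "\<forall>\<^sub>F s in nhds 0. norm (euler_residual W \<Gamma>1 s) \<le> K * norm s ^ M"
    using vanishesE[OF \<Gamma>1(3)] .
  obtain r2 where r2: "r2 > 0" "\<And>s. norm s < r2 \<Longrightarrow> norm (euler_residual W \<Gamma>1 s) \<le> K * norm s ^ M"
    using K(2) unfolding eventually_nhds_metric by (auto simp: dist_norm)
  have comp: "holo_curve (\<lambda>s. W (\<Delta> s)) S" if "open S" "holo_curve \<Delta> S" "\<Delta> ` S \<subseteq> ball 0 R" for \<Delta> S
  proof -
    have "(\<lambda>s. k (fst (\<Delta> s), fst (snd (\<Delta> s)), snd (snd (\<Delta> s)))) holomorphic_on S" if "holo3 k U" for k
      by (rule holo3_compose_holomorphic[OF that \<open>open S\<close>])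
        (use \<open>holo_curve \<Delta> S\<close> \<open>\<Delta> ` S \<subseteq> ball 0 R\<close> R(3) in \<open>auto simp: holo_curve_def\<close>)
    then have "(\<lambda>s. f (\<Delta> s)) holomorphic_on S" "(\<lambda>s. g (\<Delta> s)) holomorphic_on S" "(\<lambda>s. h (\<Delta> s)) holomorphic_on S"
      using assms(1-3) by simp_all
    then show ?thesis using that(2) unfolding holo_curve_def W_def diag_field_def
      by (auto intro!: holomorphic_intros)
  qed
  show ?thesis
  proof (rule singular_picard[of R A K W M "min r1 r2" \<Gamma>1, OF R(1) less_imp_le[OF R(2)] less_imp_le[OF K(1)] W0 M(2,3) R(4)])
    show "holo_curve (\<lambda>s. W (\<Delta> s)) S" if "open S" "holo_curve \<Delta> S" "\<Delta> ` S \<subseteq> ball 0 R" for \<Delta> S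
      by (rule comp) fact+
    show "min r1 r2 > 0" using r1 r2 by simp
    show "holo_curve \<Gamma>1 (ball 0 (min r1 r2))"
      using r1(2) unfolding holo_curve_def by (auto elim!: holomorphic_on_subset)
    show "\<Gamma>1 0 = 0" using \<Gamma>1(1) by (simp add: curve_germ_def)
    show "norm (cmult3 s (deriv3 \<Gamma>1 s) - W (\<Gamma>1 s)) \<le> K * norm s ^ M" if "s \<in> ball 0 (min r1 r2)" for s
      using r2(2)[of s] that by (simp add: euler_residual_def)
    fix r \<Delta> assume r: "r > 0" "holo_curve \<Delta> (ball 0 r)" "\<Delta> 0 = 0" "\<Delta> ` ball 0 r \<subseteq> ball 0 R"
      "\<And>s. s \<in> ball 0 r \<Longrightarrow> cmult3 s (deriv3 \<Delta> s) = W (\<Delta> s)" "vanishes M (\<lambda>s. \<Delta> s - \<Gamma>1 s)"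
    have "vanishes N (\<lambda>s. (\<Delta> s - \<Gamma>1 s) + (\<Gamma>1 s - \<Gamma> s))"
      by (intro vanishes_add vanishes_mono[OF r(6) M(1)] \<Gamma>1(2))
    then have v: "vanishes N (\<lambda>s. \<Delta> s - \<Gamma> s)" by simp
    have U: "\<Delta> ` ball 0 r \<subseteq> U" using r(4) R(3) by (rule order_trans)
    show ?thesis by (rule that[OF r(1-3) U _ v]) (use r(5) in blast)
  qed
qed

section \<open>Invariant curves as center manifolds with periodic trajectories\<close>

lemma vfield_eq_diag_field:
  "vfield w1 w2 lam f g h = diag_field (\<i> * of_real w1) (\<i> * of_real w2) lam f g h"
  by (auto simp: fun_eq_iff vfield_def diag_field_def)

lemma diag_field_rescale:
  assumes "\<mu> \<noteq> 0"
  shows "diag_field m1 m2 m3 f g h p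
    = cmult3 \<mu> (diag_field (m1 / \<mu>) (m2 / \<mu>) (m3 / \<mu>) (\<lambda>p. f p / \<mu>) (\<lambda>p. g p / \<mu>) (\<lambda>p. h p / \<mu>) p)"
  using assms by (simp add: diag_field_def distrib_left)

lemma holo3_divide:
  assumes "holo3 f U"
  shows "holo3 (\<lambda>p. f p / \<mu>) U"
  unfolding holo3_def
proof (intro conjI ballI)
  show "open U" using assms by (rule holo3_open)
  fix p assume "p \<in> U"
  then obtain D where D: "(f has_derivative D) (at p)" "\<And>c v. D (cmult3 c v) = c * D v"
    using holo3_derivative[OF assms] by metis
  have "((\<lambda>p. f p / \<mu>) has_derivative (\<lambda>v. D v / \<mu>)) (at p)"
    using bounded_linear.has_derivative[OF bounded_linear_divide D(1)] .
  then show "\<exists>D. ((\<lambda>p. f p / \<mu>) has_derivative D) (at p) \<and> (\<forall>c v. D (cmult3 c v) = c * D v)"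
    using D(2) by (intro exI[of _ "\<lambda>v. D v / \<mu>"]) simp
qed

lemma order2_divide:
  assumes "order2 f"
  shows "order2 (\<lambda>p. f p / \<mu>)"
  using assms bounded_linear.has_derivative[OF bounded_linear_divide[of \<mu>], of f "\<lambda>_. 0"]
  by (simp add: order2_def)

lemma holo_curve_vector_derivative:
  assumes "holo_curve \<Gamma> S" "open S" "(\<sigma> has_vector_derivative \<sigma>') (at t)" "\<sigma> t \<in> S"
  shows "((\<lambda>t. \<Gamma> (\<sigma> t)) has_vector_derivative cmult3 \<sigma>' (deriv3 \<Gamma> (\<sigma> t))) (at t)"
proof -
  have c: "((\<lambda>t. a (\<sigma> t)) has_derivative (\<lambda>u. u *\<^sub>R (\<sigma>' * deriv a (\<sigma> t)))) (at t)"
    if "a holomorphic_on S" for a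
    using field_vector_diff_chain_at[OF assms(3) holomorphic_derivI[OF that assms(2,4)]]
    by (simp add: has_vector_derivative_def o_def)
  have "((\<lambda>t. (fst (\<Gamma> (\<sigma> t)), fst (snd (\<Gamma> (\<sigma> t))), snd (snd (\<Gamma> (\<sigma> t))))) has_derivative
      (\<lambda>u. (u *\<^sub>R (\<sigma>' * deriv (\<lambda>s. fst (\<Gamma> s)) (\<sigma> t)), u *\<^sub>R (\<sigma>' * deriv (\<lambda>s. fst (snd (\<Gamma> s))) (\<sigma> t)),
        u *\<^sub>R (\<sigma>' * deriv (\<lambda>s. snd (snd (\<Gamma> s))) (\<sigma> t))))) (at t)"
    using assms(1) unfolding holo_curve_def by (intro has_derivative_Pair c) auto
  then show ?thesis by (simp add: has_vector_derivative_def deriv3_def)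
qed

text \<open>In the parameter s the field is the rotation s' = \<i> w s, so trajectories are images
  of circles. Injectivity of \<Gamma> excludes an earlier return, since \<open>periodic_traj\<close>
  asks for the minimal period. Keeping w apart from w1 and w2 serves both directions.\<close>

lemma periodic_traj_of_curve:
  fixes w w1 w2 :: real and lam :: complex
  assumes "holo3 f U" "holo3 g U" "holo3 h U" "w \<noteq> 0"
  defines "V \<equiv> vfield w1 w2 lam f g h"
  assumes \<Gamma>: "holo_curve \<Gamma> (ball 0 r)" "\<Gamma> ` ball 0 r \<subseteq> U"
    and eq: "\<And>s. s \<in> ball 0 r \<Longrightarrow> V (\<Gamma> s) = cmult3 (\<i> * of_real w * s) (deriv3 \<Gamma> s)"
    and inj: "inj_on \<Gamma> (ball 0 r)" and s0: "s0 \<in> ball 0 r" "s0 \<noteq> 0"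
  shows "periodic_traj U V (2 * pi / \<bar>w\<bar>) (\<Gamma> s0)"
proof -
  define \<sigma> where "\<sigma> = (\<lambda>t. cis (w * t) * s0)"
  have \<sigma>b: "\<sigma> t \<in> ball 0 r" for t using s0 by (simp add: \<sigma>_def norm_mult)
  have "(\<sigma> has_vector_derivative \<i> * of_real w * \<sigma> t) (at t)" for t
  proof -
    have "((\<lambda>t. exp (\<i> * of_real w * of_real t)) has_vector_derivative
        (\<i> * of_real w) * exp (\<i> * of_real w * of_real t)) (at t)"
    proof -
      have "((\<lambda>t. \<i> * of_real w * of_real t) has_vector_derivative \<i> * of_real w) (at t)"
        by (auto intro!: derivative_eq_intros simp: has_vector_derivative_def scaleR_conv_of_real)
      from field_vector_diff_chain_at[OF this DERIV_exp] show ?thesis by (simp add: o_def)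
    qed
    then have "((\<lambda>t. exp (\<i> * of_real w * of_real t) * s0) has_vector_derivative
        (\<i> * of_real w) * exp (\<i> * of_real w * of_real t) * s0) (at t)"
      by (rule has_vector_derivative_mult_left)
    moreover have "\<sigma> = (\<lambda>t. exp (\<i> * of_real w * of_real t) * s0)"
      by (simp add: \<sigma>_def cis_conv_exp mult.assoc)
    ultimately show ?thesis by (simp add: mult.assoc)
  qed
  from holo_curve_vector_derivative[OF \<Gamma>(1) open_ball this \<sigma>b]
  have der: "((\<lambda>t. \<Gamma> (\<sigma> t)) has_vector_derivative V (\<Gamma> (\<sigma> t))) (at t)" for t
    unfolding eq[OF \<sigma>b] .
  have U: "\<Gamma> (\<sigma> t) \<in> U" for t using \<Gamma>(2) \<sigma>b by blast
  have sol: "solves_on U V J (\<lambda>t. \<Gamma> (\<sigma> t))" for J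
    unfolding solves_on_def using U der has_vector_derivative_at_within by blast
  have per: "\<sigma> (t + 2 * pi / \<bar>w\<bar>) = \<sigma> t" for t
  proof -
    \<comment> \<open>The sign of w only decides the orientation; one full turn takes 2 pi / |w|
      either way.\<close>
    have "w * (t + 2 * pi / \<bar>w\<bar>) = w * t + sgn w * (2 * pi)"
      using \<open>w \<noteq> 0\<close> by (simp add: distrib_left sgn_if)
    then have "cis (w * (t + 2 * pi / \<bar>w\<bar>)) = cis (w * t) * cis (sgn w * (2 * pi))" by (simp add: cis_mult)
    moreover have "cis (sgn w * (2 * pi)) = 1" by (simp add: sgn_if complex_eq_iff)
    ultimately show ?thesis by (simp add: \<sigma>_def)
  qed
  have minper: "\<Gamma> (\<sigma> s) \<noteq> \<Gamma> s0" if s: "0 < s" "s < 2 * pi / \<bar>w\<bar>" for s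
  proof
    assume "\<Gamma> (\<sigma> s) = \<Gamma> s0"
    then have "\<sigma> s = s0" using inj \<sigma>b s0(1) by (simp add: inj_on_def)
    then have "cis (w * s) = 1" using s0(2) by (simp add: \<sigma>_def)
    then have "cos (w * s) = 1" by (simp add: complex_eq_iff)
    then obtain n :: int where n: "w * s = real_of_int n * 2 * pi" using cos_one_2pi_int by blast
    have "\<bar>w\<bar> * s < 2 * pi" using s \<open>w \<noteq> 0\<close> by (simp add: field_simps)
    then have "\<bar>w * s\<bar> < 2 * pi" using s by (simp add: abs_mult)
    then have "\<bar>real_of_int n\<bar> < 1" unfolding n by (simp add: abs_mult)
    then have "n = 0" by linarith
    then show False using n s \<open>w \<noteq> 0\<close> by simp
  qed
  have lip: "\<exists>r>0. \<exists>L>0. \<forall>x\<in>ball p r. \<forall>y\<in>ball p r. norm (V x - V y) \<le> L * norm (x - y)" if "p \<in> U" for p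
    using diag_field_lipschitz[OF assms(1-3) that, of "\<i> * of_real w1" "\<i> * of_real w2" lam]
    unfolding V_def vfield_eq_diag_field by metis
  have \<sigma>0: "\<sigma> 0 = s0" by (simp add: \<sigma>_def)
  have uniq: "\<phi> t = \<Gamma> (\<sigma> t)" if J: "is_interval J" "0 \<in> J" "solves_on U V J \<phi>" "\<phi> 0 = \<Gamma> s0" and t: "t \<in> J" for J \<phi> t
  proof -
    have 1: "\<phi> t \<in> U \<and> (\<phi> has_vector_derivative V (\<phi> t)) (at t within J)" if "t \<in> J" for t
      using J(3) that unfolding solves_on_def by blast
    have 2: "\<Gamma> (\<sigma> t) \<in> U \<and> ((\<lambda>t. \<Gamma> (\<sigma> t)) has_vector_derivative V (\<Gamma> (\<sigma> t))) (at t within J)" if "t \<in> J" for t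
      using sol[of J] that unfolding solves_on_def by blast
    show ?thesis by (rule ode_unique[OF lip J(1,2) t 1 2]) (simp_all add: J(4) \<sigma>0)
  qed
  show ?thesis
    unfolding periodic_traj_def
  proof (intro exI[of _ "\<lambda>t. \<Gamma> (\<sigma> t)"] conjI allI impI ballI)
    show "\<Gamma> (\<sigma> 0) = \<Gamma> s0" by (simp add: \<sigma>0)
    show "\<Gamma> (\<sigma> (t + 2 * pi / \<bar>w\<bar>)) = \<Gamma> (\<sigma> t)" for t by (simp only: per)
    show "\<Gamma> (\<sigma> s) \<noteq> \<Gamma> s0" if "0 < s \<and> s < 2 * pi / \<bar>w\<bar>" for s using minper that by blast
    show "\<phi> t = \<Gamma> (\<sigma> t)"
      if "is_interval J \<and> 0 \<in> J \<and> solves_on U V J \<phi> \<and> \<phi> 0 = \<Gamma> s0" "t \<in> J" for J \<phi> t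
      using uniq that by blast
  qed (rule sol)
qed

text \<open>The inverse function theorem with both discs explicit: \<rho> for the parameter,
  \<delta> inside its open image.\<close>

lemma local_inverse_at_0:
  assumes "\<gamma> holomorphic_on ball 0 r" "r > 0" "\<gamma> 0 = 0" "deriv \<gamma> 0 \<noteq> 0"
  obtains \<rho> \<delta> \<sigma> where "\<rho> > 0" "\<rho> \<le> r" "\<delta> > 0" "inj_on \<gamma> (ball 0 \<rho>)" "\<sigma> holomorphic_on ball 0 \<delta>" "\<sigma> 0 = 0"
    "\<And>x. x \<in> ball 0 \<delta> \<Longrightarrow> \<sigma> x \<in> ball 0 \<rho> \<and> \<gamma> (\<sigma> x) = x \<and> deriv \<gamma> (\<sigma> x) * deriv \<sigma> x = 1"
    "\<And>s. s \<in> ball 0 \<rho> \<Longrightarrow> \<sigma> (\<gamma> s) = s"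
proof -
  have r0: "0 \<in> ball (0::complex) r" using assms(2) by simp
  obtain \<rho> where \<rho>: "\<rho> > 0" "ball (0::complex) \<rho> \<subseteq> ball 0 r" "inj_on \<gamma> (ball 0 \<rho>)"
    using has_complex_derivative_locally_injective[OF assms(1) r0 open_ball assms(4)] .
  have hol: "\<gamma> holomorphic_on ball 0 \<rho>" using assms(1) \<rho>(2) by (rule holomorphic_on_subset)
  obtain \<sigma> where \<sigma>: "\<sigma> holomorphic_on \<gamma> ` ball 0 \<rho>" "\<And>z. z \<in> ball 0 \<rho> \<Longrightarrow> deriv \<gamma> z * deriv \<sigma> (\<gamma> z) = 1"
    "\<And>z. z \<in> ball 0 \<rho> \<Longrightarrow> \<sigma> (\<gamma> z) = z"
    using holomorphic_has_inverse[OF hol open_ball \<rho>(3)] by metis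
  have "open (\<gamma> ` ball 0 \<rho>)" by (rule open_mapping_thm3[OF hol open_ball \<rho>(3)])
  moreover have "0 \<in> \<gamma> ` ball 0 \<rho>" using \<rho>(1) assms(3) by (intro image_eqI[of _ _ 0]) auto
  ultimately obtain \<delta> where \<delta>: "\<delta> > 0" "ball 0 \<delta> \<subseteq> \<gamma> ` ball 0 \<rho>" using open_contains_ball by blast
  show ?thesis
  proof (rule that[of \<rho> \<delta> \<sigma>])
    show "\<rho> \<le> r" using \<rho> by (simp add: ball_subset_ball_iff)
    show "\<sigma> holomorphic_on ball 0 \<delta>" using \<sigma>(1) \<delta>(2) by (rule holomorphic_on_subset)
    show "\<sigma> 0 = 0" using \<sigma>(3)[of 0] \<rho>(1) assms(3) by simp
    show "\<sigma> x \<in> ball 0 \<rho> \<and> \<gamma> (\<sigma> x) = x \<and> deriv \<gamma> (\<sigma> x) * deriv \<sigma> x = 1" if x: "x \<in> ball 0 \<delta>" for x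
    proof -
      obtain z where z: "z \<in> ball 0 \<rho>" "x = \<gamma> z" using x \<delta>(2) by blast
      show ?thesis using z(1) \<sigma>(2,3)[OF z(1)] by (simp add: z(2))
    qed
  qed (use \<rho> \<delta> \<sigma> in auto)
qed

lemma deriv_compose_holomorphic:
  assumes "a holomorphic_on S" "open S" "\<sigma> holomorphic_on T" "open T" "x \<in> T" "\<sigma> x \<in> S"
  shows "deriv (\<lambda>x. a (\<sigma> x)) x = deriv a (\<sigma> x) * deriv \<sigma> x"
  using deriv_chain[of \<sigma> x a] assms holomorphic_on_imp_differentiable_at by (fastforce simp: o_def)

lemma holo_curve_subset: "holo_curve \<Gamma> S \<Longrightarrow> T \<subseteq> S \<Longrightarrow> holo_curve \<Gamma> T"
  unfolding holo_curve_def using holomorphic_on_subset by blast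

text \<open>Reparametrisation by the local inverse \<sigma> of a: \<phi> and \<psi> are b and c
  composed with \<sigma>. The derivative identities are the tangency condition in the form used for
  invariance; the last conclusion allows jets of the curve to be compared with those of the
  graph.\<close>

lemma graph_of_curve:
  assumes h: "a holomorphic_on ball 0 r" "b holomorphic_on ball 0 r" "c holomorphic_on ball 0 r" and "r > 0"
    and z: "a 0 = 0" "b 0 = 0" "c 0 = 0" and d0: "deriv a 0 = 1" "deriv b 0 = 0" "deriv c 0 = 0"
  obtains \<rho> \<delta> \<sigma> \<phi> \<psi> where "\<rho> > 0" "\<rho> \<le> r" "\<delta> > 0" "inj_on a (ball 0 \<rho>)"
    "\<phi> holomorphic_on ball 0 \<delta>" "\<psi> holomorphic_on ball 0 \<delta>" "\<phi> 0 = 0" "\<psi> 0 = 0" "deriv \<phi> 0 = 0" "deriv \<psi> 0 = 0"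
    "\<forall>x\<in>ball 0 \<delta>. \<sigma> x \<in> ball 0 \<rho> \<and> a (\<sigma> x) = x \<and> b (\<sigma> x) = \<phi> x \<and> c (\<sigma> x) = \<psi> x \<and>
      deriv b (\<sigma> x) = deriv a (\<sigma> x) * deriv \<phi> x \<and> deriv c (\<sigma> x) = deriv a (\<sigma> x) * deriv \<psi> x"
    "\<forall>s\<in>ball 0 \<rho>. \<phi> (a s) = b s"
proof -
  obtain \<rho> \<delta> \<sigma> where \<sigma>: "\<rho> > 0" "\<rho> \<le> r" "\<delta> > 0" "inj_on a (ball 0 \<rho>)" "\<sigma> holomorphic_on ball 0 \<delta>" "\<sigma> 0 = 0"
    "\<And>x. x \<in> ball 0 \<delta> \<Longrightarrow> \<sigma> x \<in> ball 0 \<rho> \<and> a (\<sigma> x) = x \<and> deriv a (\<sigma> x) * deriv \<sigma> x = 1"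
    "\<And>s. s \<in> ball 0 \<rho> \<Longrightarrow> \<sigma> (a s) = s"
    using local_inverse_at_0[OF h(1) \<open>r > 0\<close> z(1)] d0(1) by (metis zero_neq_one)
  have inr: "\<sigma> x \<in> ball 0 r" if "x \<in> ball 0 \<delta>" for x using \<sigma>(7)[OF that] \<sigma>(2) by auto
  have d: "deriv (\<lambda>x. k (\<sigma> x)) x = deriv k (\<sigma> x) * deriv \<sigma> x" if "k holomorphic_on ball 0 r" "x \<in> ball 0 \<delta>" for k x
    using that by (intro deriv_compose_holomorphic[OF _ open_ball \<sigma>(5) open_ball _ inr])
  have hc: "(\<lambda>x. k (\<sigma> x)) holomorphic_on ball 0 \<delta>" if "k holomorphic_on ball 0 r" for k
    using holomorphic_on_compose_gen[OF \<sigma>(5) that image_subsetI[OF inr]] by (simp add: o_def)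
  have e: "deriv k (\<sigma> x) = deriv a (\<sigma> x) * (deriv k (\<sigma> x) * deriv \<sigma> x)" if "x \<in> ball 0 \<delta>" for k x
    using \<sigma>(7)[OF that] by (metis mult.left_commute mult_1_right)
  have 0: "0 \<in> ball (0::complex) \<delta>" using \<sigma>(3) by simp
  show ?thesis
  proof (rule that[of \<rho> \<delta> "\<lambda>x. b (\<sigma> x)" "\<lambda>x. c (\<sigma> x)" \<sigma>])
    show "deriv (\<lambda>x. b (\<sigma> x)) 0 = 0" "deriv (\<lambda>x. c (\<sigma> x)) 0 = 0"
      by (simp_all add: d[OF h(2) 0] d[OF h(3) 0] \<sigma>(6) d0)
    show "\<forall>x\<in>ball 0 \<delta>. \<sigma> x \<in> ball 0 \<rho> \<and> a (\<sigma> x) = x \<and> b (\<sigma> x) = b (\<sigma> x) \<and> c (\<sigma> x) = c (\<sigma> x) \<and>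
      deriv b (\<sigma> x) = deriv a (\<sigma> x) * deriv (\<lambda>x. b (\<sigma> x)) x \<and> deriv c (\<sigma> x) = deriv a (\<sigma> x) * deriv (\<lambda>x. c (\<sigma> x)) x"
      using \<sigma>(7) e by (simp add: d[OF h(2)] d[OF h(3)])
  qed (use \<sigma> z hc[OF h(2)] hc[OF h(3)] in auto)
qed

lemma x_manifold_of_curve:
  fixes w1 w2 :: real and lam :: complex
  assumes "holo3 f U" "holo3 g U" "holo3 h U" "w1 \<noteq> 0"
  defines "V \<equiv> vfield w1 w2 lam f g h"
  assumes \<Gamma>: "holo_curve \<Gamma> (ball 0 r)" "r > 0" "\<Gamma> 0 = 0" "\<Gamma> ` ball 0 r \<subseteq> U" "deriv3 \<Gamma> 0 = (1, 0, 0)"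
    and eq: "\<And>s. s \<in> ball 0 r \<Longrightarrow> V (\<Gamma> s) = cmult3 (\<i> * of_real w1 * s) (deriv3 \<Gamma> s)"
  obtains \<phi> \<psi> \<delta> where "x_center_manifold U V \<phi> \<psi> \<delta>" "iso_family U V (x_graph \<phi> \<psi> \<delta>) (2 * pi / \<bar>w1\<bar>)"
    "\<forall>\<^sub>F s in nhds 0. \<phi> (fst (\<Gamma> s)) = fst (snd (\<Gamma> s))"
proof -
  let ?a = "\<lambda>s. fst (\<Gamma> s)" and ?b = "\<lambda>s. fst (snd (\<Gamma> s))" and ?c = "\<lambda>s. snd (snd (\<Gamma> s))"
  obtain \<rho> \<delta> \<sigma> \<phi> \<psi> where G: "\<rho> > 0" "\<rho> \<le> r" "\<delta> > 0" "inj_on ?a (ball 0 \<rho>)"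
    "\<phi> holomorphic_on ball 0 \<delta>" "\<psi> holomorphic_on ball 0 \<delta>" "\<phi> 0 = 0" "\<psi> 0 = 0" "deriv \<phi> 0 = 0" "deriv \<psi> 0 = 0"
    "\<forall>x\<in>ball 0 \<delta>. \<sigma> x \<in> ball 0 \<rho> \<and> ?a (\<sigma> x) = x \<and> ?b (\<sigma> x) = \<phi> x \<and> ?c (\<sigma> x) = \<psi> x \<and>
      deriv ?b (\<sigma> x) = deriv ?a (\<sigma> x) * deriv \<phi> x \<and> deriv ?c (\<sigma> x) = deriv ?a (\<sigma> x) * deriv \<psi> x"
    "\<forall>s\<in>ball 0 \<rho>. \<phi> (?a s) = ?b s"
    by (rule graph_of_curve[of ?a r ?b ?c]) (use \<Gamma> in \<open>auto simp: holo_curve_def deriv3_def\<close>)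
  have sub: "ball 0 \<rho> \<subseteq> ball (0::complex) r" using G(2) by auto
  have pt: "(x, \<phi> x, \<psi> x) = \<Gamma> (\<sigma> x)" "\<sigma> x \<in> ball 0 \<rho>" if "x \<in> ball 0 \<delta>" for x
    using bspec[OF G(11) that] by (auto simp: prod_eq_iff)
  have inj: "inj_on \<Gamma> (ball 0 \<rho>)" using G(4) by (auto simp: inj_on_def)
  show ?thesis
  proof (rule that[of \<phi> \<psi> \<delta>])
    show "x_center_manifold U V \<phi> \<psi> \<delta>"
      unfolding x_center_manifold_def
    proof (intro conjI ballI)
      fix x :: complex assume x: "x \<in> ball 0 \<delta>"
      have s: "\<sigma> x \<in> ball 0 r" using pt(2)[OF x] sub by blast
      show "(x, \<phi> x, \<psi> x) \<in> U" unfolding pt(1)[OF x] using \<Gamma>(4) s by blast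
      show "\<exists>c. V (x, \<phi> x, \<psi> x) = (c, c * deriv \<phi> x, c * deriv \<psi> x)"
        unfolding pt(1)[OF x] eq[OF s] deriv3_def cmult3_Pair
        \<comment> \<open>The witness is the first component of the field at \<Gamma> (\<sigma> x);
          the other two follow from the derivative identities of
          \<open>graph_of_curve\<close>.\<close>
        by (rule exI[of _ "\<i> * of_real w1 * \<sigma> x * deriv ?a (\<sigma> x)"]) (use bspec[OF G(11) x] in simp)
    qed (rule G)+
    show "iso_family U V (x_graph \<phi> \<psi> \<delta>) (2 * pi / \<bar>w1\<bar>)"
      unfolding iso_family_def
    \<comment> \<open>Every nonzero point of the graph is \<Gamma> of a nonzero parameter, so
      periodicity holds on the whole graph and 1 is an arbitrary choice of \<epsilon>.\<close>
    proof (intro exI[of _ 1] conjI ballI impI)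
      fix p assume p: "p \<in> x_graph \<phi> \<psi> \<delta>" "0 < norm p \<and> norm p < 1"
      then obtain x where x: "p = (x, \<phi> x, \<psi> x)" "x \<in> ball 0 \<delta>" by (auto simp: x_graph_def)
      then have p\<Gamma>: "p = \<Gamma> (\<sigma> x)" using pt(1) by simp
      have "\<sigma> x \<noteq> 0" using p(2) p\<Gamma> \<Gamma>(3) by auto
      then show "periodic_traj U V (2 * pi / \<bar>w1\<bar>) p"
        unfolding p\<Gamma> V_def
        by (intro periodic_traj_of_curve[OF assms(1-4) holo_curve_subset[OF \<Gamma>(1) sub] _ _ inj])
          (use \<Gamma>(4) sub eq pt(2)[OF x(2)] in \<open>auto simp: V_def\<close>)
    qed simp
    have "\<forall>\<^sub>F s in nhds 0. s \<in> ball (0::complex) \<rho>" using G(1) by (intro eventually_nhds_in_open) auto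
    then show "\<forall>\<^sub>F s in nhds 0. \<phi> (fst (\<Gamma> s)) = fst (snd (\<Gamma> s))"
      by (rule eventually_mono) (use G(12) in blast)
  qed
qed

lemma y_manifold_of_curve:
  fixes w1 w2 :: real and lam :: complex
  assumes "holo3 f U" "holo3 g U" "holo3 h U" "w2 \<noteq> 0"
  defines "V \<equiv> vfield w1 w2 lam f g h"
  assumes \<Gamma>: "holo_curve \<Gamma> (ball 0 r)" "r > 0" "\<Gamma> 0 = 0" "\<Gamma> ` ball 0 r \<subseteq> U" "deriv3 \<Gamma> 0 = (0, 1, 0)"
    and eq: "\<And>s. s \<in> ball 0 r \<Longrightarrow> V (\<Gamma> s) = cmult3 (\<i> * of_real w2 * s) (deriv3 \<Gamma> s)"
  obtains \<phi> \<psi> \<delta> where "y_center_manifold U V \<phi> \<psi> \<delta>" "iso_family U V (y_graph \<phi> \<psi> \<delta>) (2 * pi / \<bar>w2\<bar>)"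
proof -
  \<comment> \<open>The first two components exchange roles: the graph variable is now y.\<close>
  let ?a = "\<lambda>s. fst (snd (\<Gamma> s))" and ?b = "\<lambda>s. fst (\<Gamma> s)" and ?c = "\<lambda>s. snd (snd (\<Gamma> s))"
  obtain \<rho> \<delta> \<sigma> \<phi> \<psi> where G: "\<rho> > 0" "\<rho> \<le> r" "\<delta> > 0" "inj_on ?a (ball 0 \<rho>)"
    "\<phi> holomorphic_on ball 0 \<delta>" "\<psi> holomorphic_on ball 0 \<delta>" "\<phi> 0 = 0" "\<psi> 0 = 0" "deriv \<phi> 0 = 0" "deriv \<psi> 0 = 0"
    "\<forall>x\<in>ball 0 \<delta>. \<sigma> x \<in> ball 0 \<rho> \<and> ?a (\<sigma> x) = x \<and> ?b (\<sigma> x) = \<phi> x \<and> ?c (\<sigma> x) = \<psi> x \<and>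
      deriv ?b (\<sigma> x) = deriv ?a (\<sigma> x) * deriv \<phi> x \<and> deriv ?c (\<sigma> x) = deriv ?a (\<sigma> x) * deriv \<psi> x"
    by (rule graph_of_curve[of ?a r ?b ?c]) (use \<Gamma> in \<open>auto simp: holo_curve_def deriv3_def\<close>)
  have sub: "ball 0 \<rho> \<subseteq> ball (0::complex) r" using G(2) by auto
  have pt: "(\<phi> x, x, \<psi> x) = \<Gamma> (\<sigma> x)" "\<sigma> x \<in> ball 0 \<rho>" if "x \<in> ball 0 \<delta>" for x
    using bspec[OF G(11) that] by (auto simp: prod_eq_iff)
  have inj: "inj_on \<Gamma> (ball 0 \<rho>)" using G(4) by (auto simp: inj_on_def)
  show ?thesis
  proof (rule that[of \<phi> \<psi> \<delta>])
    show "y_center_manifold U V \<phi> \<psi> \<delta>"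
      unfolding y_center_manifold_def
    proof (intro conjI ballI)
      fix x :: complex assume x: "x \<in> ball 0 \<delta>"
      have s: "\<sigma> x \<in> ball 0 r" using pt(2)[OF x] sub by blast
      show "(\<phi> x, x, \<psi> x) \<in> U" unfolding pt(1)[OF x] using \<Gamma>(4) s by blast
      show "\<exists>c. V (\<phi> x, x, \<psi> x) = (c * deriv \<phi> x, c, c * deriv \<psi> x)"
        unfolding pt(1)[OF x] eq[OF s] deriv3_def cmult3_Pair
        by (rule exI[of _ "\<i> * of_real w2 * \<sigma> x * deriv ?a (\<sigma> x)"]) (use bspec[OF G(11) x] in simp)
    qed (rule G)+
    show "iso_family U V (y_graph \<phi> \<psi> \<delta>) (2 * pi / \<bar>w2\<bar>)"
      unfolding iso_family_def
    proof (intro exI[of _ 1] conjI ballI impI)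
      fix p assume p: "p \<in> y_graph \<phi> \<psi> \<delta>" "0 < norm p \<and> norm p < 1"
      then obtain x where x: "p = (\<phi> x, x, \<psi> x)" "x \<in> ball 0 \<delta>" by (auto simp: y_graph_def)
      then have p\<Gamma>: "p = \<Gamma> (\<sigma> x)" using pt(1) by simp
      have "\<sigma> x \<noteq> 0" using p(2) p\<Gamma> \<Gamma>(3) by auto
      then show "periodic_traj U V (2 * pi / \<bar>w2\<bar>) p"
        unfolding p\<Gamma> V_def
        by (intro periodic_traj_of_curve[OF assms(1-4) holo_curve_subset[OF \<Gamma>(1) sub] _ _ inj])
          (use \<Gamma>(4) sub eq pt(2)[OF x(2)] in \<open>auto simp: V_def\<close>)
    qed simp
  qed
qed

section \<open>Second-order jets and composition with curves through 0\<close>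

lemma vanishes_2_of_deriv:
  fixes f :: "complex \<Rightarrow> complex"
  assumes "f analytic_on {0}" "f 0 = 0" "deriv f 0 = 0"
  shows "vanishes 2 f"
proof -
  have "vanishes 1 f" using analytic_zero_vanishes_1 assms by blast
  then obtain d where d: "vanishes (Suc 1) (\<lambda>s. f s - s ^ 1 * d)"
    using analytic_vanishes_leading[OF assms(1)] by blast
  have "(\<lambda>s. f s - s ^ 1 * d) analytic_on {0}" by (intro analytic_intros assms)
  from vanishes_deriv[OF this d] have "deriv (\<lambda>s. f s - s ^ 1 * d) 0 = 0"
    using vanishes_Suc_imp_zero[of 0] by simp
  moreover have "f field_differentiable at 0" using assms(1) analytic_on_imp_differentiable_at by blast
  then have "((\<lambda>s. f s - s ^ 1 * d) has_field_derivative deriv f 0 - d) (at 0)"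
    by (auto intro!: derivative_eq_intros field_differentiable_derivI)
  then have "deriv (\<lambda>s. f s - s ^ 1 * d) 0 = deriv f 0 - d" by (rule DERIV_imp_deriv)
  ultimately have "d = 0" using assms(3) by simp
  with d show ?thesis by (simp add: numeral_2_eq_2)
qed

lemma deriv_zero_of_vanishes_2:
  fixes f :: "complex \<Rightarrow> complex"
  assumes "f analytic_on {0}" "vanishes 2 f"
  shows "deriv f 0 = 0"
  using vanishes_deriv[of f 1] assms vanishes_Suc_imp_zero[of 0 "deriv f"] by (simp add: numeral_2_eq_2)

text \<open>Passes the tangent vector from a jet to the exact curve built from it.\<close>

lemma deriv3_eq_of_vanishes_2:
  assumes "curve_germ \<Gamma>" "curve_germ \<Delta>" "vanishes 2 (\<lambda>s. \<Gamma> s - \<Delta> s)"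
  shows "deriv3 \<Gamma> 0 = deriv3 \<Delta> 0"
proof -
  have e: "deriv a 0 = deriv b 0" if "a analytic_on {0}" "b analytic_on {0}" "vanishes 2 (\<lambda>s. a s - b s)" for a b
  proof -
    have "(\<lambda>s. a s - b s) analytic_on {0}" by (intro analytic_intros that)
    then have "deriv (\<lambda>s. a s - b s) 0 = 0" using that(3) by (rule deriv_zero_of_vanishes_2)
    moreover have "a field_differentiable at 0" "b field_differentiable at 0"
      using that analytic_on_imp_differentiable_at by blast+
    ultimately show ?thesis by simp
  qed
  show ?thesis
    using assms unfolding deriv3_def curve_germ_def vanishes_c3_iff fst_diff snd_diff
    by (auto intro!: e)
qed

text \<open>A one-variable function is viewed as a function of the first of three coordinates, so
  that the Lipschitz bound and the existence result for curves also apply to scalar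
  problems.\<close>

lemma analytic_fst_holo3:
  assumes "a holomorphic_on ball 0 r"
  shows "holo3 (\<lambda>p. a (fst p)) {p. fst p \<in> ball 0 r}"
  unfolding holo3_def
proof (intro conjI ballI)
  show "open {p :: c3. fst p \<in> ball 0 r}"
    by (rule open_vimage[of "ball 0 r" fst, unfolded vimage_def]) (auto intro: continuous_intros)
  fix p :: c3 assume "p \<in> {p. fst p \<in> ball 0 r}"
  then have "(a has_derivative (\<lambda>v. deriv a (fst p) * v)) (at (fst p))"
    using holomorphic_derivI[OF assms open_ball] unfolding has_field_derivative_def by simp
  from has_derivative_compose[OF has_derivative_fst[OF has_derivative_ident] this]
  have "((\<lambda>p. a (fst p)) has_derivative (\<lambda>v. deriv a (fst p) * fst v)) (at p)" .
  then show "\<exists>D. ((\<lambda>p. a (fst p)) has_derivative D) (at p) \<and> (\<forall>c v. D (cmult3 c v) = c * D v)"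
    by (intro exI[of _ "\<lambda>v. deriv a (fst p) * fst v"]) (auto simp: cmult3_def)
qed

text \<open>Lipschitz continuity of F near 0. In contrast to
  \<open>order2_difference_vanishes\<close> no order is gained, as F may have a linear term.\<close>

lemma analytic_difference_vanishes:
  fixes a b F :: "complex \<Rightarrow> complex"
  assumes "F analytic_on {0}" "vanishes 1 a" "vanishes 1 b" "vanishes n (\<lambda>s. a s - b s)"
  shows "vanishes n (\<lambda>s. F (a s) - F (b s))"
proof -
  obtain r where r: "r > 0" "F holomorphic_on ball 0 r" using analytic_at_ball[OF assms(1)] .
  have r0: "0 \<in> {p :: c3. fst p \<in> ball 0 r}" using r(1) by simp
  obtain \<rho> L where L: "\<rho> > 0" "L > 0"
    and lip: "\<forall>x\<in>ball 0 \<rho>. \<forall>y\<in>ball 0 \<rho>. norm (F (fst x) - F (fst y)) \<le> L * norm (x - y :: c3)"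
  proof (rule holo3_locally_lipschitz[OF analytic_fst_holo3[OF r(2)] r0])
    fix \<rho> L assume "\<rho> > 0" "L > 0" "\<And>x y. x \<in> ball 0 \<rho> \<Longrightarrow> y \<in> ball 0 \<rho> \<Longrightarrow> norm (F (fst x) - F (fst y)) \<le> L * norm (x - y :: c3)"
    then show thesis by (intro that[of \<rho> L] ballI)
  qed
  have small: "\<forall>\<^sub>F s in nhds 0. norm (k s) < \<rho>" if k: "vanishes 1 k" for k :: "complex \<Rightarrow> complex"
  proof -
    obtain K where K: "K > 0" "\<forall>\<^sub>F s in nhds 0. norm (k s) \<le> K * norm s ^ 1" using vanishesE[OF k] .
    have "\<forall>\<^sub>F s in nhds (0::complex). norm s < \<rho> / K" using K(1) L(1) by (intro eventually_norm_less_nhds_0) auto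
    with K(2) show ?thesis
    proof eventually_elim
      case (elim s)
      then show ?case using K(1) by (simp add: field_simps)
    qed
  qed
  show ?thesis
  proof (rule vanishes_le_bound[OF assms(4), of _ L])
    show "\<forall>\<^sub>F s in nhds 0. norm (F (a s) - F (b s)) \<le> L * norm (a s - b s)"
      using small[OF assms(2)] small[OF assms(3)]
    proof eventually_elim
      case (elim s)
      show ?case using bspec[OF bspec[OF lip], of "(a s, 0, 0)" "(b s, 0, 0)"] elim by (simp add: norm_Pair)
    qed
  qed (use L in simp)
qed

lemma vanishes_tendsto_0:
  assumes "vanishes 1 a"
  shows "(a \<longlongrightarrow> 0) (nhds 0)"
proof -
  obtain K where K: "K > 0" "\<forall>\<^sub>F s in nhds 0. norm (a s) \<le> K * norm s ^ 1" using vanishesE[OF assms] .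
  have "((\<lambda>s::complex. K * norm s ^ 1) \<longlongrightarrow> 0) (nhds 0)"
  proof -
    have "((\<lambda>s::complex. K * norm s ^ 1) \<longlongrightarrow> K * norm (0::complex) ^ 1) (nhds 0)"
      by (intro tendsto_intros filterlim_ident)
    then show ?thesis by simp
  qed
  with K(2) show ?thesis by (rule Lim_null_comparison)
qed

lemma vanishes_compose:
  assumes "vanishes n F" "vanishes 1 a"
  shows "vanishes n (\<lambda>s. F (a s))"
proof -
  obtain L where L: "L > 0" "\<forall>\<^sub>F s in nhds 0. norm (F s) \<le> L * norm s ^ n" using vanishesE[OF assms(1)] .
  obtain K where K: "K > 0" "\<forall>\<^sub>F s in nhds 0. norm (a s) \<le> K * norm s ^ 1" using vanishesE[OF assms(2)] .
  have "\<forall>\<^sub>F s in nhds 0. norm (F (a s)) \<le> L * norm (a s) ^ n"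
    using L(2) vanishes_tendsto_0[OF assms(2)] by (rule eventually_compose_filterlim)
  with K(2) have "\<forall>\<^sub>F s in nhds 0. norm (F (a s)) \<le> (L * K ^ n) * norm s ^ n"
  proof eventually_elim
    case (elim s)
    have "norm (a s) ^ n \<le> (K * norm s) ^ n" using elim by (intro power_mono) auto
    then have "L * norm (a s) ^ n \<le> L * (K * norm s) ^ n" using L(1) by simp
    with elim show ?case by (simp add: power_mult_distrib mult.assoc)
  qed
  then show ?thesis by (rule vanishesI)
qed

section \<open>Center manifolds in a non-resonant direction\<close>

text \<open>Equality would make lam = n \<i> w purely imaginary; so the third eigenvalue is never
  resonant.\<close>

lemma nat_neq_imaginary_quotient:
  assumes "Re lam \<noteq> 0" "w \<noteq> 0"
  shows "of_nat n \<noteq> lam / (\<i> * complex_of_real w)"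
proof
  assume "of_nat n = lam / (\<i> * complex_of_real w)"
  then have "lam = of_nat n * (\<i> * of_real w)" using assms(2) by (simp add: field_simps)
  then have "Re lam = 0" by simp
  with assms(1) show False by simp
qed

lemma of_nat_eq_of_real_divide:
  "of_nat n = complex_of_real a / complex_of_real b \<longleftrightarrow> real n = a / b"
  by (metis of_real_divide of_real_eq_iff of_real_of_nat_eq)

text \<open>The last three hypotheses say that (v1, v2, v3) lies in the eigenspace of the linear
  part for the eigenvalue 1. Along its line s d/ds and the linear part cancel, and only the
  second-order terms f, g, h remain.\<close>

lemma eigenvector_residual:
  assumes "holo3 f U" "holo3 g U" "holo3 h U" "0 \<in> U" "order2 f" "order2 g" "order2 h"
    and "(m1 - 1) * v1 = 0" "(m2 - 1) * v2 = 0" "(m3 - 1) * v3 = 0"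
  shows "curve_germ (\<lambda>s. cmult3 s (v1, v2, v3))" "deriv3 (\<lambda>s. cmult3 s (v1, v2, v3)) 0 = (v1, v2, v3)"
    "vanishes 2 (euler_residual (diag_field m1 m2 m3 f g h) (\<lambda>s. cmult3 s (v1, v2, v3)))"
proof -
  let ?\<Gamma> = "\<lambda>s. cmult3 s (v1, v2, v3)"
  show c: "curve_germ ?\<Gamma>" by (auto simp: curve_germ_def zero_prod_def intro!: analytic_intros)
  have d: "deriv3 ?\<Gamma> s = (v1, v2, v3)" for s by (simp add: deriv3_def)
  then show "deriv3 ?\<Gamma> 0 = (v1, v2, v3)" .
  have e: "s * v - (m * (s * v) + k) = - k" if "(m - 1) * v = 0" for s m v k :: complex
    using that by (auto simp: algebra_simps)
  have "vanishes 2 (\<lambda>s. (- f (?\<Gamma> s), - g (?\<Gamma> s), - h (?\<Gamma> s)))"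
    unfolding vanishes_pair using assms(1-7) curve_germ_vanishes[OF c]
    by (intro conjI vanishes_minus order2_compose_vanishes) auto
  then show "vanishes 2 (euler_residual (diag_field m1 m2 m3 f g h) ?\<Gamma>)"
    by (rule vanishes_cong, unfold euler_residual_def d diag_field_def)
      (simp add: e[OF assms(8)] e[OF assms(9)] e[OF assms(10)])
qed

text \<open>Division by \<mu> turns the eigenvalues into 1, w2/w1 and lam/\<mu>; degrees from N
  \<ge> 2 on avoid the first, and Re lam \<noteq> 0 excludes the third. The curve \<Delta> stays in
  the conclusion because its jet later tells distinct manifolds apart.\<close>

lemma x_manifold_of_jet:
  fixes w1 w2 :: real and lam :: complex
  assumes hol: "holo3 f U" "holo3 g U" "holo3 h U" "0 \<in> U" "order2 f" "order2 g" "order2 h"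
    and "w1 \<noteq> 0" "Re lam \<noteq> 0" "curve_germ \<Gamma>" "deriv3 \<Gamma> 0 = (1, 0, 0)" "N \<ge> 2"
  defines "V \<equiv> vfield w1 w2 lam f g h" and "\<mu> \<equiv> \<i> * complex_of_real w1"
  assumes res: "vanishes N (euler_residual (diag_field 1 (of_real w2 / of_real w1) (lam / \<mu>)
      (\<lambda>p. f p / \<mu>) (\<lambda>p. g p / \<mu>) (\<lambda>p. h p / \<mu>)) \<Gamma>)"
    and nonres: "\<And>n. n \<ge> N \<Longrightarrow> real n \<noteq> w2 / w1"
  obtains \<phi> \<psi> \<delta> \<Delta> where "x_center_manifold U V \<phi> \<psi> \<delta>" "iso_family U V (x_graph \<phi> \<psi> \<delta>) (2 * pi / \<bar>w1\<bar>)"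
    "curve_germ \<Delta>" "vanishes N (\<lambda>s. \<Delta> s - \<Gamma> s)" "\<forall>\<^sub>F s in nhds 0. \<phi> (fst (\<Delta> s)) = fst (snd (\<Delta> s))"
proof -
  have \<mu>: "\<mu> \<noteq> 0" using assms(8) by (simp add: \<mu>_def)
  let ?W = "diag_field 1 (of_real w2 / of_real w1) (lam / \<mu>) (\<lambda>p. f p / \<mu>) (\<lambda>p. g p / \<mu>) (\<lambda>p. h p / \<mu>)"
  have N1: "N \<ge> 1" using assms(12) by simp
  have nr: "of_nat n \<noteq> (1::complex) \<and> of_nat n \<noteq> complex_of_real w2 / of_real w1 \<and> of_nat n \<noteq> lam / \<mu>" if "n \<ge> N" for n
    using that assms(12) nonres[OF that] nat_neq_imaginary_quotient[OF assms(9,8)]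
    by (auto simp: of_nat_eq_of_real_divide \<mu>_def)
  obtain r \<Delta> where \<Delta>: "r > 0" "holo_curve \<Delta> (ball 0 r)" "\<Delta> 0 = 0" "\<Delta> ` ball 0 r \<subseteq> U"
    "\<forall>s\<in>ball 0 r. cmult3 s (deriv3 \<Delta> s) = ?W (\<Delta> s)" "vanishes N (\<lambda>s. \<Delta> s - \<Gamma> s)"
    by (rule exact_curve_of_jet[OF holo3_divide[OF hol(1)] holo3_divide[OF hol(2)] holo3_divide[OF hol(3)] hol(4)
        order2_divide[OF hol(5)] order2_divide[OF hol(6)] order2_divide[OF hol(7)] assms(10) N1 nr res]) (assumption, rule that)
  have cg: "curve_germ \<Delta>" using \<Delta>(1-3) holo_curve_imp_curve_germ by blast
  have d: "deriv3 \<Delta> 0 = (1, 0, 0)"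
    by (rule trans[OF deriv3_eq_of_vanishes_2[OF cg assms(10) vanishes_mono[OF \<Delta>(6) assms(12)]] assms(11)])
  have eq: "V (\<Delta> s) = cmult3 (\<i> * of_real w1 * s) (deriv3 \<Delta> s)" if "s \<in> ball 0 r" for s
  proof -
    have "V (\<Delta> s) = cmult3 \<mu> (?W (\<Delta> s))"
      using diag_field_rescale[OF \<mu>, of "\<i> * of_real w1" "\<i> * of_real w2" lam f g h "\<Delta> s"] assms(8)
      by (simp add: V_def vfield_eq_diag_field \<mu>_def)
    also have "\<dots> = cmult3 \<mu> (cmult3 s (deriv3 \<Delta> s))" using \<Delta>(5) that by simp
    finally show ?thesis by (cases "deriv3 \<Delta> s") (simp add: \<mu>_def mult.assoc)
  qed
  show ?thesis
    by (rule x_manifold_of_curve[OF hol(1-3) assms(8) \<Delta>(2,1,3,4) d eq[unfolded V_def], folded V_def])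
      (assumption, rule that[OF _ _ cg \<Delta>(6)])
qed

lemma x_manifold_nonresonant:
  fixes w1 w2 :: real and lam :: complex
  assumes hol: "holo3 f U" "holo3 g U" "holo3 h U" "0 \<in> U" "order2 f" "order2 g" "order2 h"
    and "w1 \<noteq> 0" "Re lam \<noteq> 0" and nonres: "\<And>n. n \<ge> 2 \<Longrightarrow> real n \<noteq> w2 / w1"
  shows "\<exists>\<phi> \<psi> \<delta>. x_center_manifold U (vfield w1 w2 lam f g h) \<phi> \<psi> \<delta> \<and>
    iso_family U (vfield w1 w2 lam f g h) (x_graph \<phi> \<psi> \<delta>) (2 * pi / \<bar>w1\<bar>)"
proof -
  define \<mu> where "\<mu> = \<i> * complex_of_real w1"
  let ?\<Gamma> = "\<lambda>s. cmult3 s (1, 0, 0)"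
  let ?W = "diag_field 1 (of_real w2 / of_real w1) (lam / \<mu>) (\<lambda>p. f p / \<mu>) (\<lambda>p. g p / \<mu>) (\<lambda>p. h p / \<mu>)"
  note hol' = holo3_divide[OF hol(1), of \<mu>] holo3_divide[OF hol(2), of \<mu>] holo3_divide[OF hol(3), of \<mu>] hol(4)
        order2_divide[OF hol(5), of \<mu>] order2_divide[OF hol(6), of \<mu>] order2_divide[OF hol(7), of \<mu>]
  have E: "curve_germ ?\<Gamma>" "deriv3 ?\<Gamma> 0 = (1, 0, 0)" "vanishes 2 (euler_residual ?W ?\<Gamma>)"
    by (rule eigenvector_residual[OF hol']; simp)+
  show ?thesis
    by (rule x_manifold_of_jet[OF hol assms(8,9) E(1,2) order_refl E(3)[unfolded \<mu>_def] nonres]) blast+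
qed

lemma y_manifold_nonresonant:
  fixes w1 w2 :: real and lam :: complex
  assumes hol: "holo3 f U" "holo3 g U" "holo3 h U" "0 \<in> U" "order2 f" "order2 g" "order2 h"
    and w2: "w2 \<noteq> 0" and lam: "Re lam \<noteq> 0" and nonres: "\<And>n. n \<ge> 2 \<Longrightarrow> real n \<noteq> w1 / w2"
  shows "\<exists>\<phi> \<psi> \<delta>. y_center_manifold U (vfield w1 w2 lam f g h) \<phi> \<psi> \<delta> \<and>
    iso_family U (vfield w1 w2 lam f g h) (y_graph \<phi> \<psi> \<delta>) (2 * pi / \<bar>w2\<bar>)"
proof -
  define \<mu> where "\<mu> = \<i> * complex_of_real w2"
  have \<mu>: "\<mu> \<noteq> 0" using w2 by (simp add: \<mu>_def)
  let ?\<Gamma> = "\<lambda>s. cmult3 s (0, 1, 0)"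
  let ?W = "diag_field (of_real w1 / of_real w2) 1 (lam / \<mu>) (\<lambda>p. f p / \<mu>) (\<lambda>p. g p / \<mu>) (\<lambda>p. h p / \<mu>)"
  note hol' = holo3_divide[OF hol(1), of \<mu>] holo3_divide[OF hol(2), of \<mu>] holo3_divide[OF hol(3), of \<mu>] hol(4)
        order2_divide[OF hol(5), of \<mu>] order2_divide[OF hol(6), of \<mu>] order2_divide[OF hol(7), of \<mu>]
  have E: "curve_germ ?\<Gamma>" "deriv3 ?\<Gamma> 0 = (0, 1, 0)" "vanishes 2 (euler_residual ?W ?\<Gamma>)"
    by (rule eigenvector_residual[OF hol']; simp)+
  have nr: "of_nat n \<noteq> complex_of_real w1 / of_real w2 \<and> of_nat n \<noteq> (1::complex) \<and> of_nat n \<noteq> lam / \<mu>" if "n \<ge> 2" for n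
    using that nonres[OF that] nat_neq_imaginary_quotient[OF lam w2]
    by (auto simp: of_nat_eq_of_real_divide \<mu>_def)
  obtain r \<Delta> where \<Delta>: "r > 0" "holo_curve \<Delta> (ball 0 r)" "\<Delta> 0 = 0" "\<Delta> ` ball 0 r \<subseteq> U"
    "\<forall>s\<in>ball 0 r. cmult3 s (deriv3 \<Delta> s) = ?W (\<Delta> s)" "vanishes 2 (\<lambda>s. \<Delta> s - ?\<Gamma> s)"
    by (rule exact_curve_of_jet[OF hol' E(1) one_le_numeral nr E(3)]) (assumption, rule that)
  have cg: "curve_germ \<Delta>" using \<Delta>(1-3) holo_curve_imp_curve_germ by blast
  have d: "deriv3 \<Delta> 0 = (0, 1, 0)" by (rule trans[OF deriv3_eq_of_vanishes_2[OF cg E(1) \<Delta>(6)] E(2)])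
  have eq: "vfield w1 w2 lam f g h (\<Delta> s) = cmult3 (\<i> * of_real w2 * s) (deriv3 \<Delta> s)" if "s \<in> ball 0 r" for s
  proof -
    have "vfield w1 w2 lam f g h (\<Delta> s) = cmult3 \<mu> (?W (\<Delta> s))"
      using diag_field_rescale[OF \<mu>, of "\<i> * of_real w1" "\<i> * of_real w2" lam f g h "\<Delta> s"] w2
      by (simp add: vfield_eq_diag_field \<mu>_def)
    also have "\<dots> = cmult3 \<mu> (cmult3 s (deriv3 \<Delta> s))" using \<Delta>(5) that by simp
    finally show ?thesis by (cases "deriv3 \<Delta> s") (simp add: \<mu>_def mult.assoc)
  qed
  show ?thesis
    by (rule y_manifold_of_curve[OF hol(1-3) w2 \<Delta>(2,1,3,4) d eq]) blast+
qed

section \<open>The resonant case: a one-parameter family\<close>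

lemma holo3_zero: "open U \<Longrightarrow> holo3 (\<lambda>_. 0) U"
  unfolding holo3_def by (auto intro!: exI[of _ "\<lambda>_. 0"])

lemma order2_zero: "order2 (\<lambda>_. 0)"
  by (simp add: order2_def)

lemma order2_fst:
  assumes "a analytic_on {0}" "vanishes 2 a"
  shows "order2 (\<lambda>p. a (fst p))"
proof -
  have "a 0 = 0" using assms(2) vanishes_Suc_imp_zero[of 1 a] by (simp add: numeral_2_eq_2)
  have "(a has_field_derivative deriv a 0) (at 0)"
    using assms(1) analytic_on_imp_differentiable_at field_differentiable_derivI by blast
  then have "(a has_derivative (\<lambda>v. 0)) (at (fst (0::c3)))"
    using deriv_zero_of_vanishes_2[OF assms] by (simp add: has_field_derivative_def lambda_zero)
  from has_derivative_compose[OF has_derivative_fst[OF has_derivative_ident] this]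
  have "((\<lambda>p. a (fst p)) has_derivative (\<lambda>v. 0)) (at (0::c3))" by simp
  then show ?thesis using \<open>a 0 = 0\<close> by (simp add: order2_def)
qed

text \<open>X conjugates the scalar field x + a(x) to its linear part. The equation is embedded into
  three dimensions with trivial second and third components, whose eigenvalues 0 meet no degree n
  \<ge> 2.\<close>

lemma linearising_parameter:
  assumes "a analytic_on {0}" "vanishes 2 a"
  obtains X where "X analytic_on {0}" "X 0 = 0" "deriv X 0 = 1" "\<forall>\<^sub>F s in nhds 0. s * deriv X s = X s + a (X s)"
proof -
  obtain r where r: "r > 0" "a holomorphic_on ball 0 r" using analytic_at_ball[OF assms(1)] .
  define U where "U = {p :: c3. fst p \<in> ball 0 r}"
  have h: "holo3 (\<lambda>p. a (fst p)) U" unfolding U_def by (rule analytic_fst_holo3[OF r(2)])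
  have U: "open U" "0 \<in> U" using holo3_open[OF h] r(1) by (auto simp: U_def)
  note z = h holo3_zero[OF U(1)] holo3_zero[OF U(1)] U(2) order2_fst[OF assms] order2_zero order2_zero
  let ?W = "diag_field 1 0 0 (\<lambda>p. a (fst p)) (\<lambda>_. 0) (\<lambda>_. 0)"
  have E: "curve_germ (\<lambda>s. cmult3 s (1, 0, 0))" "deriv3 (\<lambda>s. cmult3 s (1, 0, 0)) 0 = (1, 0, 0)"
    "vanishes 2 (euler_residual ?W (\<lambda>s. cmult3 s (1, 0, 0)))"
    by (rule eigenvector_residual[OF z]; simp)+
  have nr: "of_nat n \<noteq> (1::complex) \<and> of_nat n \<noteq> (0::complex) \<and> of_nat n \<noteq> (0::complex)" if "n \<ge> 2" for n
    using that by auto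
  obtain \<rho> \<Delta> where \<Delta>: "\<rho> > 0" "holo_curve \<Delta> (ball 0 \<rho>)" "\<Delta> 0 = 0" "\<Delta> ` ball 0 \<rho> \<subseteq> U"
    "\<forall>s\<in>ball 0 \<rho>. cmult3 s (deriv3 \<Delta> s) = ?W (\<Delta> s)" "vanishes 2 (\<lambda>s. \<Delta> s - cmult3 s (1, 0, 0))"
    by (rule exact_curve_of_jet[OF z E(1) one_le_numeral nr E(3)]) (assumption, rule that)
  have cg: "curve_germ \<Delta>" using \<Delta>(1-3) holo_curve_imp_curve_germ by blast
  have d: "deriv3 \<Delta> 0 = (1, 0, 0)" by (rule trans[OF deriv3_eq_of_vanishes_2[OF cg E(1) \<Delta>(6)] E(2)])
  show ?thesis
  proof (rule that[of "\<lambda>s. fst (\<Delta> s)"])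
    show "(\<lambda>s. fst (\<Delta> s)) analytic_on {0}" using cg by (simp add: curve_germ_def)
    show "fst (\<Delta> 0) = 0" using \<Delta>(3) by simp
    show "deriv (\<lambda>s. fst (\<Delta> s)) 0 = 1" using d by (simp add: deriv3_def)
    have "\<forall>\<^sub>F s in nhds 0. s \<in> ball (0::complex) \<rho>" using \<Delta>(1) by (intro eventually_nhds_in_open) auto
    then show "\<forall>\<^sub>F s in nhds 0. s * deriv (\<lambda>s. fst (\<Delta> s)) s = fst (\<Delta> s) + a (fst (\<Delta> s))"
    proof eventually_elim
      case (elim s)
      then have "cmult3 s (deriv3 \<Delta> s) = ?W (\<Delta> s)" using \<Delta>(5) by blast
      then show ?case by (simp add: deriv3_def diag_field_def)
    qed
  qed
qed

lemma analytic_compose_at_0: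
  assumes "a analytic_on {0}" "X analytic_on {0}" "X 0 = 0"
  shows "(\<lambda>s. a (X s)) analytic_on {0}"
  using analytic_on_compose[OF assms(2), of a] assms(1,3) by (simp add: o_def)

lemma eventually_deriv_compose:
  assumes "a analytic_on {0}" "X analytic_on {0}" "X 0 = 0"
  shows "\<forall>\<^sub>F s in nhds 0. deriv (\<lambda>s. a (X s)) s = deriv a (X s) * deriv X s"
proof -
  obtain r where r: "r > 0" "a holomorphic_on ball 0 r" using analytic_at_ball[OF assms(1)] .
  obtain \<rho> where \<rho>: "\<rho> > 0" "X holomorphic_on ball 0 \<rho>" using analytic_at_ball[OF assms(2)] .
  have "\<forall>\<^sub>F s in nhds 0. s \<in> ball (0::complex) r" using r(1) by (intro eventually_nhds_in_open) auto
  then have "\<forall>\<^sub>F s in nhds 0. X s \<in> ball 0 r"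
    using vanishes_tendsto_0[OF analytic_zero_vanishes_1[OF assms(2,3)]] by (rule eventually_compose_filterlim)
  moreover have "\<forall>\<^sub>F s in nhds 0. s \<in> ball (0::complex) \<rho>" using \<rho>(1) by (intro eventually_nhds_in_open) auto
  ultimately show ?thesis
    by eventually_elim (rule deriv_compose_holomorphic[OF r(2) open_ball \<rho>(2) open_ball])
qed

text \<open>Reparametrising an approximately invariant graph by the linearising parameter of the vector field
  induced on it gives an approximate solution of the parametrised equation, whose residual is the
  invariance defect of the graph.\<close>

lemma curve_of_graph_jet:
  fixes w1 w2 :: real and lam :: complex and f g h :: "c3 \<Rightarrow> complex"
  assumes hol: "holo3 f U" "0 \<in> U" "order2 f" and w1: "w1 \<noteq> 0"
  defines "V \<equiv> vfield w1 w2 lam f g h" and "\<mu> \<equiv> \<i> * complex_of_real w1"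
  assumes Y: "Y analytic_on {0}" "vanishes 2 Y" and Z: "Z analytic_on {0}" "vanishes 2 Z"
    and E1: "vanishes N (\<lambda>t. fst (snd (V (t, Y t, Z t))) - deriv Y t * fst (V (t, Y t, Z t)))"
    and E2: "vanishes N (\<lambda>t. snd (snd (V (t, Y t, Z t))) - deriv Z t * fst (V (t, Y t, Z t)))"
  obtains \<Gamma> where "curve_germ \<Gamma>" "deriv3 \<Gamma> 0 = (1, 0, 0)"
    "vanishes N (euler_residual (diag_field 1 (of_real w2 / of_real w1) (lam / \<mu>)
      (\<lambda>p. f p / \<mu>) (\<lambda>p. g p / \<mu>) (\<lambda>p. h p / \<mu>)) \<Gamma>)"
proof -
  have \<mu>: "\<mu> \<noteq> 0" using w1 by (simp add: \<mu>_def)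
  let ?W = "diag_field 1 (of_real w2 / of_real w1) (lam / \<mu>) (\<lambda>p. f p / \<mu>) (\<lambda>p. g p / \<mu>) (\<lambda>p. h p / \<mu>)"
  have YZ0: "Y 0 = 0" "Z 0 = 0"
    using Y(2) Z(2) vanishes_Suc_imp_zero[of 1] by (auto simp: numeral_2_eq_2)
  \<comment> \<open>The field induced on the graph has first component \<mu> (t + a t).\<close>
  define a where "a = (\<lambda>t. f (t, Y t, Z t) / \<mu>)"
  have "(\<lambda>t. f (t, Y t, Z t)) analytic_on {0}"
    by (rule holo3_compose_analytic[OF hol(1)]) (use hol(2) YZ0 Y Z in \<open>auto simp: zero_prod_def intro: analytic_intros\<close>)
  then have a: "a analytic_on {0}" unfolding a_def using \<mu> by (intro analytic_intros) auto
  have "vanishes 1 (\<lambda>t. (t, Y t, Z t))"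
    unfolding vanishes_pair using vanishes_ident vanishes_mono[OF Y(2), of 1] vanishes_mono[OF Z(2), of 1] by simp
  from order2_compose_vanishes[OF hol this] have "vanishes 2 (\<lambda>t. (1 / \<mu>) * f (t, Y t, Z t))" by (rule vanishes_cmult)
  then have a2: "vanishes 2 a" by (simp add: a_def)
  obtain X where X: "X analytic_on {0}" "X 0 = 0" "deriv X 0 = 1" "\<forall>\<^sub>F s in nhds 0. s * deriv X s = X s + a (X s)"
    using linearising_parameter[OF a a2] .
  have vX: "vanishes 1 X" using analytic_zero_vanishes_1 X by blast
  define \<Gamma> where "\<Gamma> = (\<lambda>s. (X s, Y (X s), Z (X s)))"
  show ?thesis
  proof (rule that[of \<Gamma>])
    show "curve_germ \<Gamma>"
      using analytic_compose_at_0[OF Y(1) X(1,2)] analytic_compose_at_0[OF Z(1) X(1,2)] X YZ0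
      by (simp add: curve_germ_def \<Gamma>_def zero_prod_def)
    have d0: "deriv (\<lambda>s. Y (X s)) 0 = 0" "deriv (\<lambda>s. Z (X s)) 0 = 0"
      using eventually_nhds_x_imp_x[OF eventually_deriv_compose[OF Y(1) X(1,2)]]
        eventually_nhds_x_imp_x[OF eventually_deriv_compose[OF Z(1) X(1,2)]]
        deriv_zero_of_vanishes_2[OF Y] deriv_zero_of_vanishes_2[OF Z] X(2) by auto
    show "deriv3 \<Gamma> 0 = (1, 0, 0)" using d0 X(3) by (simp add: deriv3_def \<Gamma>_def)
    let ?E1 = "\<lambda>t. fst (snd (V (t, Y t, Z t))) - deriv Y t * fst (V (t, Y t, Z t))"
    let ?E2 = "\<lambda>t. snd (snd (V (t, Y t, Z t))) - deriv Z t * fst (V (t, Y t, Z t))"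
    have "vanishes N (\<lambda>s. (0, (- 1 / \<mu>) * ?E1 (X s), (- 1 / \<mu>) * ?E2 (X s)))"
      unfolding vanishes_pair
      by (intro conjI vanishes_cmult vanishes_compose[OF E1 vX] vanishes_compose[OF E2 vX]) (rule vanishesI[of _ 0], simp)
    then show "vanishes N (euler_residual ?W \<Gamma>)"
    proof (rule vanishes_cong)
      show "\<forall>\<^sub>F s in nhds 0. euler_residual ?W \<Gamma> s = (0, (- 1 / \<mu>) * ?E1 (X s), (- 1 / \<mu>) * ?E2 (X s))"
        using X(4) eventually_deriv_compose[OF Y(1) X(1,2)] eventually_deriv_compose[OF Z(1) X(1,2)]
      proof eventually_elim
        case (elim s)
        have sX: "s * deriv X s = fst (V (X s, Y (X s), Z (X s))) / \<mu>"
          unfolding elim(1) using \<mu> by (simp add: V_def vfield_def a_def \<mu>_def add_divide_distrib)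
        have m: "of_real w2 / of_real w1 = \<i> * of_real w2 / \<mu>" using w1 by (simp add: \<mu>_def)
        have D: "deriv3 \<Gamma> s = (deriv X s, deriv Y (X s) * deriv X s, deriv Z (X s) * deriv X s)"
          by (simp add: deriv3_def \<Gamma>_def elim)
        have 1: "s * deriv X s - (1 * X s + f (\<Gamma> s) / \<mu>) = 0"
          unfolding elim(1) by (simp add: a_def \<Gamma>_def)
        \<comment> \<open>As s X' = P/\<mu> on the graph, each residual component is -1/\<mu> times
          the corresponding defect at X s.\<close>
        have c: "s * (y' * deriv X s) - q / \<mu> = - 1 / \<mu> * (q - y' * fst (V (X s, Y (X s), Z (X s))))" for y' q
        proof -
          have "s * (y' * deriv X s) = y' * (s * deriv X s)" by (simp add: mult_ac)
          then show ?thesis unfolding sX using \<mu> by (simp add: field_simps)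
        qed
        have 2: "s * (deriv Y (X s) * deriv X s) - (of_real w2 / of_real w1 * Y (X s) + g (\<Gamma> s) / \<mu>) = (- 1 / \<mu>) * ?E1 (X s)"
          using c[of "deriv Y (X s)" "fst (snd (V (X s, Y (X s), Z (X s))))"] unfolding m
          by (simp add: V_def vfield_def \<Gamma>_def add_divide_distrib)
        have 3: "s * (deriv Z (X s) * deriv X s) - (lam / \<mu> * Z (X s) + h (\<Gamma> s) / \<mu>) = (- 1 / \<mu>) * ?E2 (X s)"
          using c[of "deriv Z (X s)" "snd (snd (V (X s, Y (X s), Z (X s))))"]
          by (simp add: V_def vfield_def \<Gamma>_def add_divide_distrib)
        have "fst (\<Gamma> s) = X s" "fst (snd (\<Gamma> s)) = Y (X s)" "snd (snd (\<Gamma> s)) = Z (X s)" by (simp_all add: \<Gamma>_def)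
        then show ?case
          unfolding euler_residual_def D diag_field_def cmult3_Pair diff_Pair by (simp only: 1 2 3)
      qed
    qed
  qed
qed

text \<open>At degree k the factor k - w2/w1 is zero, so adding n s^k to the second component leaves
  the residual of order k + 1; above k nothing is resonant and each such jet extends to an exact
  curve. The number n is the free coefficient that separates the manifolds.\<close>

lemma x_manifolds_resonant:
  fixes w1 w2 :: real and lam :: complex
  assumes hol: "holo3 f U" "holo3 g U" "holo3 h U" "0 \<in> U" "order2 f" "order2 g" "order2 h"
    and w1: "w1 \<noteq> 0" and lam: "Re lam \<noteq> 0" and k: "k \<ge> 2" "w2 / w1 = real k"
  defines "V \<equiv> vfield w1 w2 lam f g h"
  assumes Y: "Y analytic_on {0}" "vanishes 2 Y" and Z: "Z analytic_on {0}" "vanishes 2 Z"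
    and E1: "vanishes (Suc k) (\<lambda>t. fst (snd (V (t, Y t, Z t))) - deriv Y t * fst (V (t, Y t, Z t)))"
    and E2: "vanishes (Suc k) (\<lambda>t. snd (snd (V (t, Y t, Z t))) - deriv Z t * fst (V (t, Y t, Z t)))"
  shows "\<exists>\<Phi> \<Psi> :: nat \<Rightarrow> complex \<Rightarrow> complex. \<exists>\<rho> :: nat \<Rightarrow> real.
      (\<forall>n. x_center_manifold U V (\<Phi> n) (\<Psi> n) (\<rho> n) \<and> iso_family U V (x_graph (\<Phi> n) (\<Psi> n) (\<rho> n)) (2 * pi / \<bar>w1\<bar>))
    \<and> (\<forall>i j. i \<noteq> j \<longrightarrow> \<not> (\<forall>\<^sub>F x in nhds 0. \<Phi> i x = \<Phi> j x \<and> \<Psi> i x = \<Psi> j x))"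
proof -
  define \<mu> where "\<mu> = \<i> * complex_of_real w1"
  define W where "W = diag_field 1 (of_real w2 / of_real w1) (lam / \<mu>) (\<lambda>p. f p / \<mu>) (\<lambda>p. g p / \<mu>) (\<lambda>p. h p / \<mu>)"
  note hol' = holo3_divide[OF hol(1), of \<mu>] holo3_divide[OF hol(2), of \<mu>] holo3_divide[OF hol(3), of \<mu>] hol(4)
        order2_divide[OF hol(5), of \<mu>] order2_divide[OF hol(6), of \<mu>] order2_divide[OF hol(7), of \<mu>]
  obtain \<Gamma> where \<Gamma>: "curve_germ \<Gamma>" "deriv3 \<Gamma> 0 = (1, 0, 0)" "vanishes (Suc k) (euler_residual W \<Gamma>)"
    using curve_of_graph_jet[OF hol(1,4,5) w1 Y Z E1[unfolded V_def] E2[unfolded V_def]]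
    unfolding W_def \<mu>_def by blast
  have k1: "k \<ge> 1" using k(1) by simp
  have km: "of_nat k = complex_of_real w2 / of_real w1" using k(2) by (simp add: of_nat_eq_of_real_divide)
  define G where "G = (\<lambda>n::nat. \<lambda>s. \<Gamma> s + cmult3 (s ^ k) (0, of_nat n, 0))"
  have "\<exists>\<phi> \<psi> \<delta> \<Delta>. x_center_manifold U V \<phi> \<psi> \<delta> \<and> iso_family U V (x_graph \<phi> \<psi> \<delta>) (2 * pi / \<bar>w1\<bar>) \<and>
    curve_germ \<Delta> \<and> vanishes (Suc k) (\<lambda>s. \<Delta> s - G n s) \<and> (\<forall>\<^sub>F s in nhds 0. \<phi> (fst (\<Delta> s)) = fst (snd (\<Delta> s)))" for n
  proof -
    have cg: "curve_germ (G n)" unfolding G_def by (rule curve_germ_add_power[OF \<Gamma>(1) k1])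
    have "vanishes k (\<lambda>s. G n s - \<Gamma> s)"
      using vanishes_cmult3_power[of k "(0, of_nat n, 0)"] by (simp only: G_def add_diff_cancel_left')
    then have v2: "vanishes 2 (\<lambda>s. G n s - \<Gamma> s)" using k(1) by (rule vanishes_mono)
    have d: "deriv3 (G n) 0 = (1, 0, 0)" by (rule trans[OF deriv3_eq_of_vanishes_2[OF cg \<Gamma>(1) v2] \<Gamma>(2)])
    have "vanishes (Suc k) (\<lambda>s. euler_residual W (G n) s - euler_residual W \<Gamma> s -
      cmult3 (s ^ k) ((of_nat k - 1) * 0, (of_nat k - of_real w2 / of_real w1) * of_nat n, (of_nat k - lam / \<mu>) * 0))"
      unfolding W_def G_def by (rule euler_residual_add_power[OF hol' \<Gamma>(1) k1])
    moreover have "cmult3 (s ^ k) ((of_nat k - 1) * 0, (of_nat k - of_real w2 / of_real w1) * of_nat n, (of_nat k - lam / \<mu>) * 0) = 0" for s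
      by (simp add: km zero_prod_def)
    ultimately have "vanishes (Suc k) (\<lambda>s. euler_residual W (G n) s - euler_residual W \<Gamma> s)"
      by (simp only: diff_zero)
    from vanishes_add[OF this \<Gamma>(3)] have res: "vanishes (Suc k) (euler_residual W (G n))" by simp
    have nr: "real m \<noteq> w2 / w1" if "m \<ge> Suc k" for m using that k(2) by simp
    have k2: "Suc k \<ge> 2" using k(1) by simp
    show ?thesis
      by (rule x_manifold_of_jet[OF hol w1 lam cg d k2 res[unfolded W_def \<mu>_def] nr, folded V_def]) (assumption, blast)
  qed
  then have "\<forall>n. \<exists>\<phi> \<psi> \<delta> \<Delta>. x_center_manifold U V \<phi> \<psi> \<delta> \<and> iso_family U V (x_graph \<phi> \<psi> \<delta>) (2 * pi / \<bar>w1\<bar>) \<and>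
    curve_germ \<Delta> \<and> vanishes (Suc k) (\<lambda>s. \<Delta> s - G n s) \<and> (\<forall>\<^sub>F s in nhds 0. \<phi> (fst (\<Delta> s)) = fst (snd (\<Delta> s)))" by (rule allI)
  then obtain \<Phi> \<Psi> \<rho> \<Delta> where T: "\<forall>n. x_center_manifold U V (\<Phi> n) (\<Psi> n) (\<rho> n) \<and>
    iso_family U V (x_graph (\<Phi> n) (\<Psi> n) (\<rho> n)) (2 * pi / \<bar>w1\<bar>) \<and> curve_germ (\<Delta> n) \<and>
    vanishes (Suc k) (\<lambda>s. \<Delta> n s - G n s) \<and> (\<forall>\<^sub>F s in nhds 0. \<Phi> n (fst (\<Delta> n s)) = fst (snd (\<Delta> n s)))"
    unfolding choice_iff by (elim exE) (rule that)
  have S: "x_center_manifold U V (\<Phi> n) (\<Psi> n) (\<rho> n)"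
    "iso_family U V (x_graph (\<Phi> n) (\<Psi> n) (\<rho> n)) (2 * pi / \<bar>w1\<bar>)" "curve_germ (\<Delta> n)"
    "vanishes (Suc k) (\<lambda>s. \<Delta> n s - G n s)" "\<forall>\<^sub>F s in nhds 0. \<Phi> n (fst (\<Delta> n s)) = fst (snd (\<Delta> n s))" for n
    using spec[OF T, of n] by blast+
  \<comment> \<open>The first components of \<Delta> i and \<Delta> j differ by O(|s|^(k+1)). If the
    graphs agreed near 0, so would the second components up to that order, whereas their difference
    starts with (i - j) s^k.\<close>
  have inj: "i = j" if ev: "\<forall>\<^sub>F x in nhds 0. \<Phi> i x = \<Phi> j x \<and> \<Psi> i x = \<Psi> j x" for i j
  proof -
    have "vanishes (Suc k) (\<lambda>s. (\<Delta> i s - G i s) - (\<Delta> j s - G j s))" by (intro vanishes_diff S)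
    moreover have "(\<Delta> i s - G i s) - (\<Delta> j s - G j s) = \<Delta> i s - \<Delta> j s - cmult3 (s ^ k) (0, of_nat i - of_nat j, 0)" for s
    proof -
      have "G i s - G j s = cmult3 (s ^ k) (0, of_nat i - of_nat j, 0)" by (simp add: G_def algebra_simps)
      then show ?thesis by (simp add: algebra_simps)
    qed
    ultimately have D: "vanishes (Suc k) (\<lambda>s. \<Delta> i s - \<Delta> j s - cmult3 (s ^ k) (0, of_nat i - of_nat j, 0))" by simp
    then have a: "vanishes (Suc k) (\<lambda>s. fst (\<Delta> i s) - fst (\<Delta> j s))"
      and b: "vanishes (Suc k) (\<lambda>s. fst (snd (\<Delta> i s)) - fst (snd (\<Delta> j s)) - s ^ k * (of_nat i - of_nat j))"
      unfolding vanishes_c3_iff by auto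
    have an: "\<Phi> i analytic_on {0}"
      using S(1)[of i] holomorphic_on_imp_analytic_at[OF _ open_ball] unfolding x_center_manifold_def by auto
    have v1: "vanishes 1 (\<lambda>s. fst (\<Delta> n s))" for n using curve_germ_vanishes[OF S(3)] by (auto simp: vanishes_c3_iff)
    have F: "vanishes (Suc k) (\<lambda>s. \<Phi> i (fst (\<Delta> i s)) - \<Phi> i (fst (\<Delta> j s)))"
      by (rule analytic_difference_vanishes[OF an v1 v1 a])
    have "\<forall>\<^sub>F s in nhds 0. \<Phi> i (fst (\<Delta> j s)) = \<Phi> j (fst (\<Delta> j s)) \<and> \<Psi> i (fst (\<Delta> j s)) = \<Psi> j (fst (\<Delta> j s))"
      using ev vanishes_tendsto_0[OF v1] by (rule eventually_compose_filterlim)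
    with S(5)[of i] S(5)[of j]
    have "\<forall>\<^sub>F s in nhds 0. fst (snd (\<Delta> i s)) - fst (snd (\<Delta> j s)) = \<Phi> i (fst (\<Delta> i s)) - \<Phi> i (fst (\<Delta> j s))"
      by eventually_elim simp
    from vanishes_cong[OF F this] have "vanishes (Suc k) (\<lambda>s. fst (snd (\<Delta> i s)) - fst (snd (\<Delta> j s)))" .
    from vanishes_diff[OF this b] have "vanishes (Suc k) (\<lambda>s. s ^ k * (of_nat i - of_nat j :: complex))" by simp
    then have "of_nat i - of_nat j = (0::complex)" by (rule vanishes_Suc_coeff_zero)
    then show "i = j" by simp
  qed
  show ?thesis
  proof (rule exI[of _ \<Phi>], rule exI[of _ \<Psi>], rule exI[of _ \<rho>], intro conjI allI impI notI)
    fix i j assume "i \<noteq> j" "\<forall>\<^sub>F x in nhds 0. \<Phi> i x = \<Phi> j x \<and> \<Psi> i x = \<Psi> j x"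
    then show False using inj by blast
  qed (rule S)+
qed

section \<open>Reduction steps and jets of invariant graphs\<close>

definition defect_y :: "(c3 \<Rightarrow> c3) \<Rightarrow> (complex \<Rightarrow> complex) \<Rightarrow> (complex \<Rightarrow> complex) \<Rightarrow> complex \<Rightarrow> complex" where
  "defect_y V Y Z t = fst (snd (V (t, Y t, Z t))) - deriv Y t * fst (V (t, Y t, Z t))"

definition defect_z :: "(c3 \<Rightarrow> c3) \<Rightarrow> (complex \<Rightarrow> complex) \<Rightarrow> (complex \<Rightarrow> complex) \<Rightarrow> complex \<Rightarrow> complex" where
  "defect_z V Y Z t = snd (snd (V (t, Y t, Z t))) - deriv Z t * fst (V (t, Y t, Z t))"

section \<open>Vectors and diagonal matrices of size two\<close>

definition vec2 :: "complex \<Rightarrow> complex \<Rightarrow> complex^2" where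
  "vec2 a b = (\<chi> i. if i = 1 then a else b)"

definition diag2 :: "complex \<Rightarrow> complex \<Rightarrow> complex^2^2" where
  "diag2 a b = (\<chi> i j. if i = j then vec2 a b $ i else 0)"

lemma vec2_nth [simp]: "vec2 a b $ 1 = a" "vec2 a b $ 2 = b"
  by (simp_all add: vec2_def)

lemma vec2_eq_iff: "(v :: complex^2) = w \<longleftrightarrow> v $ 1 = w $ 1 \<and> v $ 2 = w $ 2"
  by (simp add: vec_eq_iff forall_2)

lemma diag2_nth [simp]: "diag2 a b $ 1 $ 1 = a" "diag2 a b $ 2 $ 2 = b" "diag2 a b $ 1 $ 2 = 0" "diag2 a b $ 2 $ 1 = 0"
  by (simp_all add: diag2_def)

lemma mat2_eq_iff: "(A :: complex^2^2) = B \<longleftrightarrow> A $ 1 $ 1 = B $ 1 $ 1 \<and> A $ 1 $ 2 = B $ 1 $ 2 \<and> A $ 2 $ 1 = B $ 2 $ 1 \<and> A $ 2 $ 2 = B $ 2 $ 2"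
  by (simp only: vec_eq_iff[of A B] forall_2 vec2_eq_iff conj_assoc)

lemma diag2_mult_vec: "diag2 a b *v w = vec2 (a * w $ 1) (b * w $ 2)"
  by (simp add: vec2_eq_iff matrix_vector_mult_def sum_2)

lemma diag2_minus_mat: "diag2 a b - mat 1 = diag2 (a - 1) (b - 1)" "mat 1 - diag2 a b = diag2 (1 - a) (1 - b)"
  by (simp_all add: mat2_eq_iff mat_def)

lemma matrix_inv_diag2:
  assumes "a \<noteq> 0" "b \<noteq> 0"
  shows "matrix_inv (diag2 a b) *v w = vec2 (w $ 1 / a) (w $ 2 / b)"
proof -
  have "diag2 a b ** diag2 (1/a) (1/b) = mat 1" "diag2 (1/a) (1/b) ** diag2 a b = mat 1"
    using assms by (simp_all add: mat2_eq_iff matrix_matrix_mult_def sum_2 mat_def)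
  then have "invertible (diag2 a b)" unfolding invertible_def by blast
  \<comment> \<open>\<open>matrix_inv\<close> is a Hilbert choice, so its inverse property is drawn
    from the explicit inverse above.\<close>
  then have "diag2 a b ** matrix_inv (diag2 a b) = mat 1"
    unfolding invertible_def matrix_inv_def by (rule someI2_ex) blast
  then have "diag2 a b *v (matrix_inv (diag2 a b) *v w) = w"
    by (simp add: matrix_vector_mul_assoc)
  then show ?thesis using assms by (auto simp: diag2_mult_vec vec2_eq_iff field_simps)
qed

section \<open>Effect on the defect of perturbing a graph\<close>

lemma eventually_deriv_power_mult:
  assumes "D analytic_on {0}"
  shows "\<forall>\<^sub>F t in nhds 0. deriv (\<lambda>t. t ^ n * D t) t = of_nat n * t ^ (n - 1) * D t + t ^ n * deriv D t"
proof -
  obtain r where r: "r > 0" "D holomorphic_on ball 0 r" using analytic_at_ball[OF assms] .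
  have "\<forall>\<^sub>F s in nhds 0. s \<in> ball (0::complex) r" using r(1) by (intro eventually_nhds_in_open) auto
  then show ?thesis
  proof eventually_elim
    case (elim t)
    have "(D has_field_derivative deriv D t) (at t)" using holomorphic_derivI[OF r(2) open_ball elim] .
    then have "((\<lambda>t. t ^ n * D t) has_field_derivative of_nat n * t ^ (n - 1) * D t + t ^ n * deriv D t) (at t)"
      by (auto intro!: derivative_eq_intros)
    then show ?case by (rule DERIV_imp_deriv)
  qed
qed

lemma analytic_eventually_differentiable:
  assumes "a analytic_on {0}"
  shows "\<forall>\<^sub>F t in nhds 0. a field_differentiable at t"
proof -
  obtain r where r: "r > 0" "a holomorphic_on ball 0 r" using analytic_at_ball[OF assms] .
  have "\<forall>\<^sub>F s in nhds 0. s \<in> ball (0::complex) r" using r(1) by (intro eventually_nhds_in_open) auto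
  then show ?thesis
    by (rule eventually_mono) (use r(2) holomorphic_on_imp_differentiable_at open_ball in blast)
qed

text \<open>Only m t^n D and -\<mu> t (t^n D)' contribute at order n, together (m - n \<mu>) D 0.
  One scalar statement serves the y- and the z-defect. D is a function so that it covers both the
  constant coefficients of reduction steps and the difference between a jet and a true invariant
  graph.\<close>

lemma defect_perturb:
  fixes m \<mu> :: complex
  assumes "holo3 f U" "holo3 g U" "0 \<in> U" "order2 f" "order2 g"
    and \<gamma>: "vanishes 1 \<gamma>" "vanishes 1 \<gamma>'" "vanishes n (\<lambda>t. \<gamma>' t - \<gamma> t)"
    and Y: "Y analytic_on {0}" and D: "D analytic_on {0}" and n: "n \<ge> 1"
  shows "vanishes (Suc n) (\<lambda>t. (m * (Y t + t ^ n * D t) + g (\<gamma>' t) - deriv (\<lambda>t. Y t + t ^ n * D t) t * (\<mu> * t + f (\<gamma>' t)))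
    - (m * Y t + g (\<gamma> t) - deriv Y t * (\<mu> * t + f (\<gamma> t))) - t ^ n * ((m - of_nat n * \<mu>) * D 0))"
proof -
  let ?\<Delta> = "\<lambda>t. t ^ n * D t"
  have d0: "vanishes (n + 1) (\<lambda>t. t ^ n * (D t - D 0))"
    by (intro vanishes_mult vanishes_power analytic_zero_vanishes_1 analytic_intros D) simp
  have D': "deriv D analytic_on {0}" using D by (rule analytic_deriv)
  have \<Delta>: "?\<Delta> analytic_on {0}" by (intro analytic_intros D)
  have v\<Delta>: "vanishes (Suc (n - 1)) ?\<Delta>"
    using vanishes_mult[OF vanishes_power vanishes_0_analytic[OF D], of n] n by simp
  have T1: "vanishes (Suc n) (\<lambda>t. m * (t ^ n * (D t - D 0)))" using vanishes_cmult[OF d0] by simp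
  have T2: "vanishes (Suc n) (\<lambda>t. g (\<gamma>' t) - g (\<gamma> t))"
    by (rule order2_difference_vanishes[OF assms(2,3,5) \<gamma>(2,1,3)])
  have T3: "vanishes (Suc n) (\<lambda>t. deriv Y t * (f (\<gamma>' t) - f (\<gamma> t)))"
    using vanishes_mult[OF vanishes_0_analytic[OF analytic_deriv[OF Y]]
        order2_difference_vanishes[OF assms(1,3,4) \<gamma>(2,1,3)]] by simp
  \<comment> \<open>The derivative of t^n D loses one order and f supplies two.\<close>
  have T4: "vanishes (Suc n) (\<lambda>t. deriv ?\<Delta> t * f (\<gamma>' t))"
    using vanishes_mult[OF vanishes_deriv[OF \<Delta> v\<Delta>] order2_compose_vanishes[OF assms(1,3,4) \<gamma>(2)]] n by simp
  \<comment> \<open>This is \<mu> t (t^n D)' with its leading part n \<mu> t^n D 0 removed.\<close>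
  have T5: "vanishes (Suc n) (\<lambda>t. \<mu> * (of_nat n * (t ^ n * (D t - D 0)) + t ^ Suc n * deriv D t))"
    by (intro vanishes_cmult vanishes_add d0[simplified]
        vanishes_mult[OF vanishes_power[of "Suc n"] vanishes_0_analytic[OF D'], unfolded add_0_right])
  have "vanishes (Suc n) (\<lambda>t. m * (t ^ n * (D t - D 0)) + (g (\<gamma>' t) - g (\<gamma> t)) - deriv Y t * (f (\<gamma>' t) - f (\<gamma> t))
      - deriv ?\<Delta> t * f (\<gamma>' t) - \<mu> * (of_nat n * (t ^ n * (D t - D 0)) + t ^ Suc n * deriv D t))"
    by (intro vanishes_diff vanishes_add T1 T2 T3 T4 T5)
  then show ?thesis
  proof (rule vanishes_cong)
    show "\<forall>\<^sub>F t in nhds 0. (m * (Y t + t ^ n * D t) + g (\<gamma>' t) - deriv (\<lambda>t. Y t + t ^ n * D t) t * (\<mu> * t + f (\<gamma>' t)))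
    - (m * Y t + g (\<gamma> t) - deriv Y t * (\<mu> * t + f (\<gamma> t))) - t ^ n * ((m - of_nat n * \<mu>) * D 0)
      = m * (t ^ n * (D t - D 0)) + (g (\<gamma>' t) - g (\<gamma> t)) - deriv Y t * (f (\<gamma>' t) - f (\<gamma> t))
      - deriv ?\<Delta> t * f (\<gamma>' t) - \<mu> * (of_nat n * (t ^ n * (D t - D 0)) + t ^ Suc n * deriv D t)"
      using eventually_deriv_power_mult[OF D, of n] analytic_eventually_differentiable[OF Y]
        analytic_eventually_differentiable[OF \<Delta>]
    proof eventually_elim
      case (elim t)
      have s: "deriv (\<lambda>t. Y t + t ^ n * D t) t = deriv Y t + deriv ?\<Delta> t" using elim by (intro deriv_add)
      have "t * t ^ (n - 1) = t ^ n" using n by (cases n) auto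
      then have td: "deriv ?\<Delta> t * t = of_nat n * t ^ n * D t + t ^ Suc n * deriv D t"
        unfolding elim(1) by (simp add: algebra_simps)
      have "(m * (Y t + t ^ n * D t) + g (\<gamma>' t) - (deriv Y t + deriv ?\<Delta> t) * (\<mu> * t + f (\<gamma>' t)))
        - (m * Y t + g (\<gamma> t) - deriv Y t * (\<mu> * t + f (\<gamma> t))) - t ^ n * ((m - of_nat n * \<mu>) * D 0)
        = m * (t ^ n * D t) + (g (\<gamma>' t) - g (\<gamma> t)) - deriv Y t * (f (\<gamma>' t) - f (\<gamma> t))
        - deriv ?\<Delta> t * f (\<gamma>' t) - \<mu> * (deriv ?\<Delta> t * t) - t ^ n * ((m - of_nat n * \<mu>) * D 0)"
        by (simp add: algebra_simps)
      then show ?case unfolding s td by (simp add: algebra_simps)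
    qed
  qed
qed

lemma vanishes_graph:
  assumes "vanishes 2 Y" "vanishes 2 Z"
  shows "vanishes 1 (\<lambda>t. (t, Y t, Z t))"
  unfolding vanishes_pair using vanishes_ident vanishes_mono[OF assms(1), of 1] vanishes_mono[OF assms(2), of 1] by simp

text \<open>For w2/w1 = k and n = k the first factor is zero: the degree k coefficient of Y then
  leaves the y-defect unchanged at order k.\<close>

lemma defect_add_power:
  fixes w1 w2 :: real and lam :: complex
  assumes hol: "holo3 f U" "holo3 g U" "holo3 h U" "0 \<in> U" "order2 f" "order2 g" "order2 h"
  defines "V \<equiv> vfield w1 w2 lam f g h" and "\<mu> \<equiv> \<i> * complex_of_real w1"
  assumes Y: "Y analytic_on {0}" "vanishes 2 Y" and Z: "Z analytic_on {0}" "vanishes 2 Z"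
    and D: "D1 analytic_on {0}" "D2 analytic_on {0}" and n: "n \<ge> 2"
  defines "Y' \<equiv> \<lambda>t. Y t + t ^ n * D1 t" and "Z' \<equiv> \<lambda>t. Z t + t ^ n * D2 t"
  shows "vanishes (Suc n) (\<lambda>t. defect_y V Y' Z' t - defect_y V Y Z t - t ^ n * ((\<i> * of_real w2 - of_nat n * \<mu>) * D1 0))"
    "vanishes (Suc n) (\<lambda>t. defect_z V Y' Z' t - defect_z V Y Z t - t ^ n * ((lam - of_nat n * \<mu>) * D2 0))"
    "Y' analytic_on {0}" "vanishes 2 Y'" "Z' analytic_on {0}" "vanishes 2 Z'"
proof -
  have v: "vanishes n (\<lambda>t. t ^ n * D1 t)" "vanishes n (\<lambda>t. t ^ n * D2 t)"
    using vanishes_mult[OF vanishes_power vanishes_0_analytic[OF D(1)], of n]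
      vanishes_mult[OF vanishes_power vanishes_0_analytic[OF D(2)], of n] by simp_all
  show a: "Y' analytic_on {0}" "Z' analytic_on {0}"
    unfolding Y'_def Z'_def by (intro analytic_intros Y Z D)+
  show v2: "vanishes 2 Y'" "vanishes 2 Z'"
    unfolding Y'_def Z'_def by (intro vanishes_add Y Z vanishes_mono[OF v(1) n] vanishes_mono[OF v(2) n])+
  have d: "vanishes n (\<lambda>t. (t, Y' t, Z' t) - (t, Y t, Z t))"
    using v vanishesI[of "\<lambda>_. 0::complex" 0 n] by (simp add: vanishes_pair Y'_def Z'_def)
  have n1: "n \<ge> 1" using n by simp
  show "vanishes (Suc n) (\<lambda>t. defect_y V Y' Z' t - defect_y V Y Z t - t ^ n * ((\<i> * of_real w2 - of_nat n * \<mu>) * D1 0))"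
    using defect_perturb[OF hol(1,2,4,5,6) vanishes_graph[OF Y(2) Z(2)] vanishes_graph[OF v2] d Y(1) D(1) n1, of "\<i> * of_real w2" \<mu>]
    by (simp add: defect_y_def V_def vfield_def \<mu>_def Y'_def)
  show "vanishes (Suc n) (\<lambda>t. defect_z V Y' Z' t - defect_z V Y Z t - t ^ n * ((lam - of_nat n * \<mu>) * D2 0))"
    using defect_perturb[OF hol(1,3,4,5,7) vanishes_graph[OF Y(2) Z(2)] vanishes_graph[OF v2] d Z(1) D(2) n1, of lam \<mu>]
    by (simp add: defect_z_def V_def vfield_def \<mu>_def Z'_def)
qed

text \<open>The germ form of \<open>x_center_manifold\<close>: both defects vanish exactly when the
  field is a multiple of the tangent vector of the graph.\<close>

definition invariant_graph_germ :: "(c3 \<Rightarrow> c3) \<Rightarrow> (complex \<Rightarrow> complex) \<Rightarrow> (complex \<Rightarrow> complex) \<Rightarrow> bool" where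
  "invariant_graph_germ V \<phi> \<psi> \<longleftrightarrow> \<phi> analytic_on {0} \<and> vanishes 2 \<phi> \<and> \<psi> analytic_on {0} \<and> vanishes 2 \<psi> \<and>
     (\<forall>\<^sub>F t in nhds 0. defect_y V \<phi> \<psi> t = 0 \<and> defect_z V \<phi> \<psi> t = 0)"

text \<open>Here \<open>m2, m3\<close> are the last two eigenvalues divided by \<open>\<mu> = \<i> \<omega>\<^sub>1\<close>. The substitution accumulated by
  \<open>j\<close> reduction steps is \<open>(y, z) = x^(j+1) w + (Y(x), Z(x))\<close>; the equations quantified over \<open>w\<close> say that it turns
  the original system into \<open>B\<close>.\<close>

definition reduced_jet :: "(c3 \<Rightarrow> c3) \<Rightarrow> complex \<Rightarrow> complex \<Rightarrow> complex \<Rightarrow> nat \<Rightarrow> bbsys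
    \<Rightarrow> (complex \<Rightarrow> complex) \<Rightarrow> (complex \<Rightarrow> complex) \<Rightarrow> bool" where
  "reduced_jet V \<mu> m2 m3 j B Y Z \<longleftrightarrow>
     bb_matrix B = diag2 (m2 - 1 - of_nat j) (m3 - 1 - of_nat j) \<and>
     (\<forall>\<^sub>F x in at 0. \<forall>w.
        bb_x_rhs V x (x ^ j *s w + vec2 (Y x / x) (Z x / x)) $ 1 - (deriv Y x - Y x / x) - of_nat j * x ^ j * w $ 1
          = x ^ j * (x * bb_const B $ 1 + (m2 - 1 - of_nat j) * w $ 1 + bb_nonlin B x w $ 1) \<and>
        bb_x_rhs V x (x ^ j *s w + vec2 (Y x / x) (Z x / x)) $ 2 - (deriv Z x - Z x / x) - of_nat j * x ^ j * w $ 2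
          = x ^ j * (x * bb_const B $ 2 + (m3 - 1 - of_nat j) * w $ 2 + bb_nonlin B x w $ 2)) \<and>
     Y analytic_on {0} \<and> vanishes 2 Y \<and> Z analytic_on {0} \<and> vanishes 2 Z \<and>
     vanishes (j + 3) (\<lambda>t. defect_y V Y Z t - t ^ (j + 2) * (\<mu> * bb_const B $ 1)) \<and>
     vanishes (j + 3) (\<lambda>t. defect_z V Y Z t - t ^ (j + 2) * (\<mu> * bb_const B $ 2)) \<and>
     (\<forall>\<phi> \<psi>. invariant_graph_germ V \<phi> \<psi> \<longrightarrow> vanishes (j + 2) (\<lambda>t. \<phi> t - Y t) \<and> vanishes (j + 2) (\<lambda>t. \<psi> t - Z t))"

section \<open>Limits of the Briot-Bouquet quotients at x = 0\<close>

lemma bb_x_raw_nth: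
  "bb_x_raw V x w $ 1 = fst (snd (V (x, x * w $ 1, x * w $ 2))) / fst (V (x, x * w $ 1, x * w $ 2)) - w $ 1"
  "bb_x_raw V x w $ 2 = snd (snd (V (x, x * w $ 1, x * w $ 2))) / fst (V (x, x * w $ 1, x * w $ 2)) - w $ 2"
  by (simp_all add: bb_x_raw_def Let_def)

lemma tendsto_vec2:
  assumes "((\<lambda>t. F t $ 1) \<longlongrightarrow> a) net" "((\<lambda>t. F t $ 2) \<longlongrightarrow> b) net"
  shows "(F \<longlongrightarrow> vec2 a b) net"
  by (rule vec_tendstoI) (metis assms exhaust_2 vec2_nth)

lemma vfield_fst_quotient:
  fixes w1 w2 :: real
  assumes hol: "holo3 f U" "0 \<in> U" "order2 f" and Y: "vanishes 1 Y" and Z: "vanishes 1 Z"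
  shows "((\<lambda>t. fst (vfield w1 w2 lam f g h (t, Y t, Z t)) / t) \<longlongrightarrow> \<i> * of_real w1) (at 0)"
proof -
  have "vanishes 1 (\<lambda>t. (t, Y t, Z t))" unfolding vanishes_pair using vanishes_ident Y Z by simp
  from order2_compose_vanishes[OF hol this]
  have "vanishes (Suc 1) (\<lambda>t. fst (vfield w1 w2 lam f g h (t, Y t, Z t)) - t ^ 1 * (\<i> * of_real w1))"
    by (simp add: vfield_def numeral_2_eq_2 mult.commute)
  from tendsto_quotient_of_vanishes[OF this] show ?thesis by simp
qed

text \<open>The denominator P is \<i> w1 t to first order, which accounts for n = l + 1. The cases l
  = 0, l = 1 and l = j + 2 yield the value at x = 0, the initial constant vector and the quadratic
  part in a reduction step.\<close>

lemma defect_quotient_tendsto: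
  fixes w1 w2 :: real
  assumes hol: "holo3 f U" "0 \<in> U" "order2 f" and w1: "w1 \<noteq> 0" and YZ: "vanishes 1 Y" "vanishes 1 Z"
    and E: "vanishes (Suc n) (\<lambda>t. E t - t ^ n * e)"
    and R: "\<forall>\<^sub>F t in at 0. R t = E t / fst (vfield w1 w2 lam f g h (t, Y t, Z t)) / t ^ l" and n: "n = Suc l"
  shows "(R \<longlongrightarrow> e / (\<i> * of_real w1)) (at 0)"
proof -
  have "((\<lambda>t. (E t / t ^ n) / (fst (vfield w1 w2 lam f g h (t, Y t, Z t)) / t)) \<longlongrightarrow> e / (\<i> * of_real w1)) (at 0)"
    using w1 by (intro tendsto_divide tendsto_quotient_of_vanishes[OF E] vfield_fst_quotient[OF hol YZ]) simp
  moreover have "\<forall>\<^sub>F t in at 0. (E t / t ^ n) / (fst (vfield w1 w2 lam f g h (t, Y t, Z t)) / t) = R t"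
  proof -
    have "\<forall>\<^sub>F t in at (0::complex). t \<noteq> 0" by (simp add: eventually_at_filter)
    with R show ?thesis by eventually_elim (simp add: n mult.commute)
  qed
  ultimately show ?thesis by (rule Lim_transform_eventually)
qed

lemma vfield_fst_nonzero:
  fixes w1 w2 :: real
  assumes hol: "holo3 f U" "0 \<in> U" "order2 f" and w1: "w1 \<noteq> 0" and YZ: "vanishes 1 Y" "vanishes 1 Z"
  shows "\<forall>\<^sub>F t in at 0. fst (vfield w1 w2 lam f g h (t, Y t, Z t)) \<noteq> 0"
proof -
  have "\<forall>\<^sub>F t in at 0. fst (vfield w1 w2 lam f g h (t, Y t, Z t)) / t \<noteq> 0"
    by (rule tendsto_imp_eventually_ne[OF vfield_fst_quotient[OF hol YZ]]) (use w1 in simp)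
  then show ?thesis by (rule eventually_mono) auto
qed

text \<open>Along a line through 0 numerator and denominator are linear to first order, so the
  defining limit is a quotient of eigenvalues, lowered by 1 through the terms -u and -v.\<close>

lemma bb_x_rhs_at_0:
  fixes w1 w2 :: real
  assumes hol: "holo3 f U" "holo3 g U" "holo3 h U" "0 \<in> U" "order2 f" "order2 g" "order2 h" and w1: "w1 \<noteq> 0"
  shows "bb_x_rhs (vfield w1 w2 lam f g h) 0 w
    = vec2 ((of_real w2 / of_real w1 - 1) * w $ 1) ((lam / (\<i> * of_real w1) - 1) * w $ 2)"
proof -
  let ?V = "vfield w1 w2 lam f g h" and ?\<mu> = "\<i> * complex_of_real w1"
  have lin: "vanishes 1 (\<lambda>t. t * c)" for c :: complex
    using vanishes_mult[OF vanishes_ident vanishes_0_const[of c]] by simp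
  have v: "vanishes 1 (\<lambda>t. (t, t * w $ 1, t * w $ 2))" unfolding vanishes_pair using lin vanishes_ident by simp
  have q: "((\<lambda>t. k t / fst (?V (t, t * w $ 1, t * w $ 2))) \<longlongrightarrow> e / ?\<mu>) (at 0)"
    if "vanishes (Suc 1) (\<lambda>t. k t - t ^ 1 * e)" for k e
    by (rule defect_quotient_tendsto[OF hol(1,4,5) w1 lin[of "w $ 1"] lin[of "w $ 2"] that,
          where l = 0 and ?w2.0 = w2 and lam = lam and g = g and h = h]) simp_all
  have "((\<lambda>t. fst (snd (?V (t, t * w $ 1, t * w $ 2))) / fst (?V (t, t * w $ 1, t * w $ 2)) - w $ 1) \<longlongrightarrow>
      (\<i> * of_real w2 * w $ 1) / ?\<mu> - w $ 1) (at 0)"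
    using order2_compose_vanishes[OF hol(2,4,6) v]
    by (intro tendsto_diff q tendsto_const) (simp add: vfield_def numeral_2_eq_2 mult_ac)
  moreover have "(\<i> * of_real w2 * w $ 1) / ?\<mu> - w $ 1 = (of_real w2 / of_real w1 - 1) * w $ 1"
    using w1 by (simp add: field_simps)
  ultimately have 1: "((\<lambda>t. bb_x_raw ?V t w $ 1) \<longlongrightarrow> (of_real w2 / of_real w1 - 1) * w $ 1) (at 0)"
    unfolding bb_x_raw_nth by simp
  have "((\<lambda>t. snd (snd (?V (t, t * w $ 1, t * w $ 2))) / fst (?V (t, t * w $ 1, t * w $ 2)) - w $ 2) \<longlongrightarrow>
      (lam * w $ 2) / ?\<mu> - w $ 2) (at 0)"
    using order2_compose_vanishes[OF hol(3,4,7) v]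
    by (intro tendsto_diff q tendsto_const) (simp add: vfield_def numeral_2_eq_2 mult_ac)
  moreover have "(lam * w $ 2) / ?\<mu> - w $ 2 = (lam / ?\<mu> - 1) * w $ 2"
    using w1 by (simp add: field_simps)
  ultimately have 2: "((\<lambda>t. bb_x_raw ?V t w $ 2) \<longlongrightarrow> (lam / ?\<mu> - 1) * w $ 2) (at 0)"
    unfolding bb_x_raw_nth by simp
  have "((\<lambda>t. bb_x_raw ?V t w) \<longlongrightarrow> vec2 ((of_real w2 / of_real w1 - 1) * w $ 1) ((lam / ?\<mu> - 1) * w $ 2)) (at 0)"
    by (rule tendsto_vec2[OF 1 2])
  then show ?thesis unfolding bb_x_rhs_def by (simp add: tendsto_Lim)
qed

section \<open>Reduction steps follow the jet of an invariant graph\<close>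

lemma analytic_defect:
  fixes w1 w2 :: real
  assumes hol: "holo3 f U" "holo3 g U" "holo3 h U" "0 \<in> U"
    and Y: "Y analytic_on {0}" "vanishes 2 Y" and Z: "Z analytic_on {0}" "vanishes 2 Z"
  shows "defect_y (vfield w1 w2 lam f g h) Y Z analytic_on {0}" "defect_z (vfield w1 w2 lam f g h) Y Z analytic_on {0}"
proof -
  have "Y 0 = 0" "Z 0 = 0"
    using vanishes_Suc_imp_zero[of 1 Y] vanishes_Suc_imp_zero[of 1 Z] Y(2) Z(2) by (simp_all add: numeral_2_eq_2)
  then have YZ0: "(0, Y 0, Z 0) \<in> U" using hol(4) by (simp add: zero_prod_def)
  have k: "(\<lambda>t. k (t, Y t, Z t)) analytic_on {0}" if "holo3 k U" for k
    by (rule holo3_compose_analytic[OF that, of "\<lambda>t. t"]) (use YZ0 Y Z in \<open>auto intro: analytic_intros\<close>)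
  have d: "defect_y (vfield w1 w2 lam f g h) Y Z = (\<lambda>t. \<i> * of_real w2 * Y t + g (t, Y t, Z t) - deriv Y t * (\<i> * of_real w1 * t + f (t, Y t, Z t)))"
    "defect_z (vfield w1 w2 lam f g h) Y Z = (\<lambda>t. lam * Z t + h (t, Y t, Z t) - deriv Z t * (\<i> * of_real w1 * t + f (t, Y t, Z t)))"
    by (simp_all add: fun_eq_iff defect_y_def defect_z_def vfield_def)
  show "defect_y (vfield w1 w2 lam f g h) Y Z analytic_on {0}" "defect_z (vfield w1 w2 lam f g h) Y Z analytic_on {0}"
    unfolding d
    by (intro analytic_intros k[OF hol(1)] k[OF hol(2)] k[OF hol(3)] Y(1) Z(1))+
qed

text \<open>Zero steps correspond to the graph Y = Z = 0. The right-hand side at w = 0 is the defect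
  divided by P, so its derivative at x = 0 is the leading coefficient of the defect over \<mu>; the
  identity in w is the definition of the nonlinear part.\<close>

lemma reduced_jet_initial:
  fixes w1 w2 :: real and lam :: complex
  assumes hol: "holo3 f U" "holo3 g U" "holo3 h U" "0 \<in> U" "order2 f" "order2 g" "order2 h" and w1: "w1 \<noteq> 0"
  defines "V \<equiv> vfield w1 w2 lam f g h" and "\<mu> \<equiv> \<i> * complex_of_real w1"
  shows "reduced_jet V \<mu> (of_real w2 / of_real w1) (lam / \<mu>) 0 (bb_of_rhs (bb_x_rhs V)) (\<lambda>_. 0) (\<lambda>_. 0)"
proof -
  define m2 where "m2 = complex_of_real w2 / of_real w1"
  define m3 where "m3 = lam / \<mu>"
  define G where "G = bb_x_rhs V"
  define B where "B = bb_of_rhs G"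
  have G0: "G 0 w = vec2 ((m2 - 1) * w $ 1) ((m3 - 1) * w $ 2)" for w
    unfolding G_def V_def m2_def m3_def \<mu>_def by (rule bb_x_rhs_at_0[OF hol w1])
  have M: "bb_matrix B = diag2 (m2 - 1) (m3 - 1)"
    by (simp add: B_def bb_matrix_def bb_of_rhs_def Let_def mat2_eq_iff G0 axis_def)
  have zero: "vanishes n (\<lambda>_. 0 :: complex)" for n by (rule vanishesI[of _ 0]) simp
  have z0: "(\<lambda>_::complex. 0::complex) analytic_on {0}" by (intro analytic_intros)
  have nz: "\<forall>\<^sub>F t in at (0::complex). t \<noteq> 0" by (simp add: eventually_at_filter)
  have v1: "vanishes 2 (defect_y V (\<lambda>_. 0) (\<lambda>_. 0))" "vanishes 2 (defect_z V (\<lambda>_. 0) (\<lambda>_. 0))"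
    using order2_compose_vanishes[OF hol(2,4,6) vanishes_graph[OF zero zero]]
      order2_compose_vanishes[OF hol(3,4,7) vanishes_graph[OF zero zero]]
    by (simp_all add: defect_y_def[abs_def] defect_z_def[abs_def] V_def vfield_def)
  obtain e1 where e1: "vanishes (Suc 2) (\<lambda>t. defect_y V (\<lambda>_. 0) (\<lambda>_. 0) t - t ^ 2 * e1)"
    using analytic_vanishes_leading[OF analytic_defect(1)[OF hol(1-4) z0 zero z0 zero] v1(1)[unfolded V_def]]
    unfolding V_def by blast
  obtain e2 where e2: "vanishes (Suc 2) (\<lambda>t. defect_z V (\<lambda>_. 0) (\<lambda>_. 0) t - t ^ 2 * e2)"
    using analytic_vanishes_leading[OF analytic_defect(2)[OF hol(1-4) z0 zero z0 zero] v1(2)[unfolded V_def]]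
    unfolding V_def by blast
  have Gx: "G t 0 = bb_x_raw V t 0" if "t \<noteq> 0" for t using that by (simp add: G_def bb_x_rhs_def)
  have "((\<lambda>t. (G t 0 $ 1 - G 0 0 $ 1) / (t - 0)) \<longlongrightarrow> e1 / \<mu>) (at 0)"
    unfolding \<mu>_def
  proof (rule defect_quotient_tendsto[OF hol(1,4,5) w1 zero zero e1, where l = 1])
    show "\<forall>\<^sub>F t in at 0. (G t 0 $ 1 - G 0 0 $ 1) / (t - 0)
      = defect_y V (\<lambda>_. 0) (\<lambda>_. 0) t / fst (vfield w1 w2 lam f g h (t, 0, 0)) / t ^ 1"
      using nz by eventually_elim (simp add: G0 Gx bb_x_raw_nth defect_y_def V_def)
  qed simp
  then have a1: "bb_const B $ 1 = e1 / \<mu>"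
    by (simp add: B_def bb_const_def bb_of_rhs_def Let_def has_field_derivative_iff DERIV_imp_deriv)
  have "((\<lambda>t. (G t 0 $ 2 - G 0 0 $ 2) / (t - 0)) \<longlongrightarrow> e2 / \<mu>) (at 0)"
    unfolding \<mu>_def
  proof (rule defect_quotient_tendsto[OF hol(1,4,5) w1 zero zero e2, where l = 1])
    show "\<forall>\<^sub>F t in at 0. (G t 0 $ 2 - G 0 0 $ 2) / (t - 0)
      = defect_z V (\<lambda>_. 0) (\<lambda>_. 0) t / fst (vfield w1 w2 lam f g h (t, 0, 0)) / t ^ 1"
      using nz by eventually_elim (simp add: G0 Gx bb_x_raw_nth defect_z_def V_def)
  qed simp
  then have a2: "bb_const B $ 2 = e2 / \<mu>"
    by (simp add: B_def bb_const_def bb_of_rhs_def Let_def has_field_derivative_iff DERIV_imp_deriv)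
  have \<mu>: "\<mu> \<noteq> 0" using w1 by (simp add: \<mu>_def)
  have ex: "G x w = x *s bb_const B + bb_matrix B *v w + bb_nonlin B x w" for x w
    by (simp add: B_def bb_const_def bb_matrix_def bb_nonlin_def bb_of_rhs_def Let_def)
  have v0: "vec2 0 0 = 0" by (simp add: vec2_eq_iff)
  show ?thesis
    unfolding reduced_jet_def G_def[symmetric] B_def[symmetric] m2_def[symmetric] m3_def[symmetric]
  proof (intro conjI allI impI always_eventually)
    show "bb_matrix B = diag2 (m2 - 1 - of_nat 0) (m3 - 1 - of_nat 0)" using M by simp
    fix x w
    show "G x (x ^ 0 *s w + vec2 (0 / x) (0 / x)) $ 1 - (deriv (\<lambda>_. 0) x - 0 / x) - of_nat 0 * x ^ 0 * w $ 1 =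
        x ^ 0 * (x * bb_const B $ 1 + (m2 - 1 - of_nat 0) * w $ 1 + bb_nonlin B x w $ 1)"
      "G x (x ^ 0 *s w + vec2 (0 / x) (0 / x)) $ 2 - (deriv (\<lambda>_. 0) x - 0 / x) - of_nat 0 * x ^ 0 * w $ 2 =
        x ^ 0 * (x * bb_const B $ 2 + (m3 - 1 - of_nat 0) * w $ 2 + bb_nonlin B x w $ 2)"
      using ex[of x w] by (simp_all add: v0 M diag2_mult_vec)
  next
    show "vanishes (0 + 3) (\<lambda>t. defect_y V (\<lambda>_. 0) (\<lambda>_. 0) t - t ^ (0 + 2) * (\<mu> * bb_const B $ 1))"
      "vanishes (0 + 3) (\<lambda>t. defect_z V (\<lambda>_. 0) (\<lambda>_. 0) t - t ^ (0 + 2) * (\<mu> * bb_const B $ 2))"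
      using e1 e2 \<mu> by (simp_all add: a1 a2 numeral_3_eq_3 numeral_2_eq_2)
  next
    fix \<phi> \<psi> assume "invariant_graph_germ V \<phi> \<psi>"
    then show "vanishes (0 + 2) (\<lambda>t. \<phi> t - 0)" "vanishes (0 + 2) (\<lambda>t. \<psi> t - 0)"
      by (simp_all add: invariant_graph_germ_def numeral_2_eq_2)
  qed (rule z0 zero)+
qed

lemma defect_cong:
  assumes "\<forall>\<^sub>F t in nhds 0. Y t = Y' t" "\<forall>\<^sub>F t in nhds 0. Z t = Z' t"
  shows "\<forall>\<^sub>F t in nhds 0. defect_y V Y Z t = defect_y V Y' Z' t \<and> defect_z V Y Z t = defect_z V Y' Z' t"
proof -
  have "\<forall>\<^sub>F t in nhds 0. \<forall>\<^sub>F s in nhds t. Y s = Y' s" "\<forall>\<^sub>F t in nhds 0. \<forall>\<^sub>F s in nhds t. Z s = Z' s"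
    using assms by (simp_all add: eventually_eventually)
  then show ?thesis
  proof eventually_elim
    case (elim t)
    have "Y t = Y' t" "Z t = Z' t" using elim eventually_nhds_x_imp_x by blast+
    moreover have "deriv Y t = deriv Y' t" "deriv Z t = deriv Z' t"
      using elim by (auto intro: deriv_cong_ev)
    ultimately show ?case by (simp add: defect_y_def defect_z_def)
  qed
qed

text \<open>An invariant graph differs from the jet by t^(j+2) D with D analytic, and its defect is
  0, so comparing coefficients of t^(j+2) gives the two equations. If w2/w1 = j + 2, the first
  degenerates to \<open>bb_const B $ 1 = 0\<close>: this is the obstruction.\<close>

lemma solution_jet_coefficient:
  fixes w1 w2 :: real and lam :: complex
  assumes hol: "holo3 f U" "holo3 g U" "holo3 h U" "0 \<in> U" "order2 f" "order2 g" "order2 h" and w1: "w1 \<noteq> 0"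
  defines "V \<equiv> vfield w1 w2 lam f g h" and "\<mu> \<equiv> \<i> * complex_of_real w1"
  defines "m2 \<equiv> complex_of_real w2 / of_real w1" and "m3 \<equiv> lam / \<mu>"
  assumes J: "reduced_jet V \<mu> m2 m3 j B Y Z" and S: "invariant_graph_germ V \<phi> \<psi>"
  obtains d1 d2 where "bb_const B $ 1 + (m2 - of_nat (j + 2)) * d1 = 0" "bb_const B $ 2 + (m3 - of_nat (j + 2)) * d2 = 0"
    "vanishes (j + 3) (\<lambda>t. \<phi> t - (Y t + t ^ (j + 2) * d1))" "vanishes (j + 3) (\<lambda>t. \<psi> t - (Z t + t ^ (j + 2) * d2))"
proof -
  define n where "n = j + 2"
  have n: "j + 3 = Suc n" "n \<ge> 2" by (simp_all add: n_def)
  have \<mu>: "\<mu> \<noteq> 0" using w1 by (simp add: \<mu>_def)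
  note J' = J[unfolded reduced_jet_def n(1) n_def[symmetric]]
  have Y: "Y analytic_on {0}" "vanishes 2 Y" and Z: "Z analytic_on {0}" "vanishes 2 Z"
    and E: "vanishes (Suc n) (\<lambda>t. defect_y V Y Z t - t ^ n * (\<mu> * bb_const B $ 1))"
      "vanishes (Suc n) (\<lambda>t. defect_z V Y Z t - t ^ n * (\<mu> * bb_const B $ 2))"
    and s: "vanishes n (\<lambda>t. \<phi> t - Y t)" "vanishes n (\<lambda>t. \<psi> t - Z t)" using J' S by blast+
  have \<phi>: "\<phi> analytic_on {0}" "\<psi> analytic_on {0}" and inv: "\<forall>\<^sub>F t in nhds 0. defect_y V \<phi> \<psi> t = 0 \<and> defect_z V \<phi> \<psi> t = 0"
    using S unfolding invariant_graph_germ_def by blast+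
  have "(\<lambda>t. \<phi> t - Y t) analytic_on {0}" by (intro analytic_intros Y \<phi>)
  from analytic_vanishes_factor[OF this s(1)] obtain D1 where
    D1: "D1 analytic_on {0}" "\<forall>\<^sub>F t in nhds 0. \<phi> t - Y t = t ^ n * D1 t" by blast
  have "(\<lambda>t. \<psi> t - Z t) analytic_on {0}" by (intro analytic_intros Z \<phi>)
  from analytic_vanishes_factor[OF this s(2)] obtain D2 where
    D2: "D2 analytic_on {0}" "\<forall>\<^sub>F t in nhds 0. \<psi> t - Z t = t ^ n * D2 t" by blast
  let ?Y = "\<lambda>t. Y t + t ^ n * D1 t" and ?Z = "\<lambda>t. Z t + t ^ n * D2 t"
  have "\<forall>\<^sub>F t in nhds 0. ?Y t = \<phi> t" using D1(2) by (rule eventually_mono) (simp add: algebra_simps)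
  moreover have "\<forall>\<^sub>F t in nhds 0. ?Z t = \<psi> t" using D2(2) by (rule eventually_mono) (simp add: algebra_simps)
  ultimately have ev: "\<forall>\<^sub>F t in nhds 0. defect_y V ?Y ?Z t = defect_y V \<phi> \<psi> t \<and> defect_z V ?Y ?Z t = defect_z V \<phi> \<psi> t"
    by (rule defect_cong)
  note P = defect_add_power(1,2)[OF hol Y Z D1(1) D2(1) n(2), of w1 w2 lam, folded V_def \<mu>_def]
  have c: "\<mu> * a + (m - of_nat n * \<mu>) * d = 0"
    if "vanishes (Suc n) (\<lambda>t. e' t - e t - t ^ n * ((m - of_nat n * \<mu>) * d))" "vanishes (Suc n) (\<lambda>t. e t - t ^ n * (\<mu> * a))"
      "\<forall>\<^sub>F t in nhds 0. e' t = 0" for e e' m a d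
  proof -
    have v: "vanishes (Suc n) (\<lambda>t. (e' t - e t - t ^ n * ((m - of_nat n * \<mu>) * d)) + (e t - t ^ n * (\<mu> * a)))"
      by (intro vanishes_add that)
    have "\<forall>\<^sub>F t in nhds 0. t ^ n * - (\<mu> * a + (m - of_nat n * \<mu>) * d)
        = (e' t - e t - t ^ n * ((m - of_nat n * \<mu>) * d)) + (e t - t ^ n * (\<mu> * a))"
      using that(3) by eventually_elim (simp add: algebra_simps)
    from vanishes_Suc_coeff_zero[OF vanishes_cong[OF v this]] show ?thesis by (simp only: neg_equal_0_iff_equal)
  qed
  have "\<forall>\<^sub>F t in nhds 0. defect_y V ?Y ?Z t = 0" "\<forall>\<^sub>F t in nhds 0. defect_z V ?Y ?Z t = 0"
    using ev inv by (eventually_elim, simp)+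
  with c[OF P(1) E(1)] c[OF P(2) E(2)]
  have cc: "\<mu> * bb_const B $ 1 + (\<i> * of_real w2 - of_nat n * \<mu>) * D1 0 = 0"
    "\<mu> * bb_const B $ 2 + (lam - of_nat n * \<mu>) * D2 0 = 0" by blast+
  have w2: "\<i> * of_real w2 = \<mu> * m2" "lam = \<mu> * m3" using w1 by (simp_all add: \<mu>_def m2_def m3_def)
  have "\<mu> * (bb_const B $ 1 + (m2 - of_nat n) * D1 0) = 0" "\<mu> * (bb_const B $ 2 + (m3 - of_nat n) * D2 0) = 0"
    using cc unfolding w2 by (simp_all add: algebra_simps)
  then have r: "bb_const B $ 1 + (m2 - of_nat n) * D1 0 = 0" "bb_const B $ 2 + (m3 - of_nat n) * D2 0 = 0" using \<mu> by simp_all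
  have f: "vanishes (Suc n) (\<lambda>t. a t - (b t + t ^ n * D 0))"
    if D: "D analytic_on {0}" "\<forall>\<^sub>F t in nhds 0. a t - b t = t ^ n * D t" for a b D
  proof -
    have v: "vanishes (n + 1) (\<lambda>t. t ^ n * (D t - D 0))"
      by (intro vanishes_mult vanishes_power analytic_zero_vanishes_1 analytic_intros D) simp
    have "\<forall>\<^sub>F t in nhds 0. a t - (b t + t ^ n * D 0) = t ^ n * (D t - D 0)"
      using D(2) by (rule eventually_mono) (simp add: algebra_simps)
    from vanishes_cong[OF v this] show ?thesis by simp
  qed
  show ?thesis
    by (rule that[of "D1 0" "D2 0", unfolded n(1) n_def[symmetric]]) (rule r f[OF D1] f[OF D2])+
qed

text \<open>Substituting w = x (v + c) turns x^(j+1) w + Y into x^(j+2) v + (Y + c x^(j+2)): the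
  vector c of the reduction step is the next jet coefficient, and (1 - M) c = a says that it cancels
  the leading defect. The terms subtracted in the identity come from x u' = x^j (x w' + j w) + Y' -
  Y/x for u = x^j w + Y/x.\<close>

lemma reduced_jet_step:
  fixes w1 w2 :: real and lam :: complex
  assumes hol: "holo3 f U" "holo3 g U" "holo3 h U" "0 \<in> U" "order2 f" "order2 g" "order2 h" and w1: "w1 \<noteq> 0"
  defines "V \<equiv> vfield w1 w2 lam f g h" and "\<mu> \<equiv> \<i> * complex_of_real w1"
  defines "m2 \<equiv> complex_of_real w2 / of_real w1" and "m3 \<equiv> lam / \<mu>"
  assumes J: "reduced_jet V \<mu> m2 m3 j B Y Z" and nr: "of_nat (j + 2) \<noteq> m2" "of_nat (j + 2) \<noteq> m3"
  shows "\<exists>Y' Z'. reduced_jet V \<mu> m2 m3 (Suc j) (reduce_step B) Y' Z'"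
proof -
  define n where "n = j + 2"
  have n: "j + 3 = Suc n" "n \<ge> 2" by (simp_all add: n_def)
  have \<mu>: "\<mu> \<noteq> 0" using w1 by (simp add: \<mu>_def)
  note J' = J[unfolded reduced_jet_def n(1) n_def[symmetric]]
  have M: "bb_matrix B = diag2 (m2 - 1 - of_nat j) (m3 - 1 - of_nat j)"
    and Y: "Y analytic_on {0}" "vanishes 2 Y" and Z: "Z analytic_on {0}" "vanishes 2 Z"
    and E: "vanishes (Suc n) (\<lambda>t. defect_y V Y Z t - t ^ n * (\<mu> * bb_const B $ 1))"
      "vanishes (Suc n) (\<lambda>t. defect_z V Y Z t - t ^ n * (\<mu> * bb_const B $ 2))" using J' by blast+
  define a where "a = bb_const B"
  define F where "F = bb_nonlin B"
  define G where "G = bb_x_rhs V"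
  have ident: "\<forall>\<^sub>F x in at 0. \<forall>w.
        G x (x ^ j *s w + vec2 (Y x / x) (Z x / x)) $ 1 - (deriv Y x - Y x / x) - of_nat j * x ^ j * w $ 1
          = x ^ j * (x * a $ 1 + (m2 - 1 - of_nat j) * w $ 1 + F x w $ 1) \<and>
        G x (x ^ j *s w + vec2 (Y x / x) (Z x / x)) $ 2 - (deriv Z x - Z x / x) - of_nat j * x ^ j * w $ 2
          = x ^ j * (x * a $ 2 + (m3 - 1 - of_nat j) * w $ 2 + F x w $ 2)"
    using J' unfolding a_def F_def G_def by blast
  define c where "c = matrix_inv (mat 1 - bb_matrix B) *v a"
  \<comment> \<open>These are the eigenvalues of 1 - M, since M has the entries m2 - 1 - j and m3 -
    1 - j.\<close>
  have nz: "of_nat n - m2 \<noteq> 0" "of_nat n - m3 \<noteq> 0" using nr by (auto simp: n_def)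
  have e: "1 - (m2 - 1 - of_nat j) = of_nat n - m2" "1 - (m3 - 1 - of_nat j) = of_nat n - m3" by (simp_all add: n_def)
  have "c = vec2 (a $ 1 / (of_nat n - m2)) (a $ 2 / (of_nat n - m3))"
    unfolding c_def M diag2_minus_mat e by (rule matrix_inv_diag2[OF nz])
  then have c: "a $ 1 = (of_nat n - m2) * c $ 1" "a $ 2 = (of_nat n - m3) * c $ 2" using nz by auto
  define Y' where "Y' = (\<lambda>t. Y t + t ^ n * c $ 1)"
  define Z' where "Z' = (\<lambda>t. Z t + t ^ n * c $ 2)"
  have cn: "(\<lambda>_. c $ 1) analytic_on {0}" "(\<lambda>_. c $ 2) analytic_on {0}" by (intro analytic_intros)+
  note P = defect_add_power(1,2)[OF hol Y Z cn n(2), of w1 w2 lam, folded V_def \<mu>_def Y'_def Z'_def]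
    defect_add_power(3-6)[OF hol Y Z cn n(2), folded Y'_def Z'_def]
  have w2: "\<i> * of_real w2 = \<mu> * m2" "lam = \<mu> * m3" using w1 by (simp_all add: \<mu>_def m2_def m3_def)
  \<comment> \<open>The change (m - n) \<mu> c of the leading coefficient cancels \<mu> a, so one
    order is gained.\<close>
  have E': "vanishes (Suc n) (defect_y V Y' Z')" "vanishes (Suc n) (defect_z V Y' Z')"
  proof -
    have "(defect_y V Y' Z' t - defect_y V Y Z t - t ^ n * ((\<mu> * m2 - of_nat n * \<mu>) * c $ 1))
        + (defect_y V Y Z t - t ^ n * (\<mu> * a $ 1)) = defect_y V Y' Z' t" for t
      unfolding c by (simp add: algebra_simps)
    with vanishes_add[OF P(1)[unfolded w2] E(1)[folded a_def]] show "vanishes (Suc n) (defect_y V Y' Z')" by simp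
    have "(defect_z V Y' Z' t - defect_z V Y Z t - t ^ n * ((\<mu> * m3 - of_nat n * \<mu>) * c $ 2))
        + (defect_z V Y Z t - t ^ n * (\<mu> * a $ 2)) = defect_z V Y' Z' t" for t
      unfolding c by (simp add: algebra_simps)
    moreover have "vanishes (Suc n) (\<lambda>t. defect_z V Y' Z' t - defect_z V Y Z t - t ^ n * ((\<mu> * m3 - of_nat n * \<mu>) * c $ 2))"
      using P(2) w2(2) by simp
    note vanishes_add[OF this E(2)[folded a_def]]
    ultimately show "vanishes (Suc n) (defect_z V Y' Z')" by simp
  qed
  note an = analytic_defect[OF hol(1-4) P(3-6), of w1 w2 lam, folded V_def]
  obtain e1 where e1: "vanishes (Suc (Suc n)) (\<lambda>t. defect_y V Y' Z' t - t ^ Suc n * e1)"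
    using analytic_vanishes_leading[OF an(1) E'(1)] by blast
  obtain e2 where e2: "vanishes (Suc (Suc n)) (\<lambda>t. defect_z V Y' Z' t - t ^ Suc n * e2)"
    using analytic_vanishes_leading[OF an(2) E'(2)] by blast
  have dY: "\<forall>\<^sub>F x in at 0. x \<noteq> 0 \<and> deriv Y' x = deriv Y x + of_nat n * x ^ (n - 1) * c $ 1 \<and>
      deriv Z' x = deriv Z x + of_nat n * x ^ (n - 1) * c $ 2"
  proof -
    have "\<forall>\<^sub>F x in nhds 0. deriv Y' x = deriv Y x + of_nat n * x ^ (n - 1) * c $ 1 \<and>
      deriv Z' x = deriv Z x + of_nat n * x ^ (n - 1) * c $ 2"
      using analytic_eventually_differentiable[OF Y(1)] analytic_eventually_differentiable[OF Z(1)]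
    proof eventually_elim
      case (elim x)
      have "(Y' has_field_derivative deriv Y x + of_nat n * x ^ (n - 1) * c $ 1) (at x)"
        "(Z' has_field_derivative deriv Z x + of_nat n * x ^ (n - 1) * c $ 2) (at x)"
        using elim unfolding Y'_def Z'_def by (auto intro!: derivative_eq_intros field_differentiable_derivI)
      then show ?case using DERIV_imp_deriv by blast
    qed
    then show ?thesis by (auto simp: eventually_at_filter elim: eventually_mono)
  qed
  have xp: "x * x ^ j = x ^ (n - 1)" "x ^ n * k / x = x ^ (n - 1) * k" if "x \<noteq> 0" for x k :: complex
    using that by (simp_all add: n_def)
  have arg: "x ^ j *s (x *s (w + c)) + vec2 (Y x / x) (Z x / x) = x ^ Suc j *s w + vec2 (Y' x / x) (Z' x / x)"
    if "x \<noteq> 0" for x w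
    using that by (simp add: vec2_eq_iff Y'_def Z'_def n_def field_simps)
  have P0: "\<forall>\<^sub>F t in at 0. fst (V (t, Y' t, Z' t)) \<noteq> 0"
    unfolding V_def by (rule vfield_fst_nonzero[OF hol(1,4,5) w1 vanishes_mono[OF P(4)] vanishes_mono[OF P(6)]]) simp_all
  have lim: "((\<lambda>t. inverse (t ^ 2) *s F (t * 1) (t *s c)) \<longlongrightarrow> vec2 (e1 / \<mu>) (e2 / \<mu>)) (at 0)"
  proof (rule tendsto_vec2)
    have G: "G t (vec2 (Y' t / t) (Z' t / t)) $ 1 = fst (snd (V (t, Y' t, Z' t))) / fst (V (t, Y' t, Z' t)) - Y' t / t"
      "G t (vec2 (Y' t / t) (Z' t / t)) $ 2 = snd (snd (V (t, Y' t, Z' t))) / fst (V (t, Y' t, Z' t)) - Z' t / t"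
      if "t \<noteq> 0" for t
      using that by (simp_all add: G_def bb_x_rhs_def bb_x_raw_nth)
    \<comment> \<open>At w = t c the identity runs along the new graph (Y', Z'). As a + M c = c,
      constant and linear terms combine to t c, and what remains for F is the new defect divided by
      P t^j.\<close>
    have key: "\<forall>\<^sub>F t in at 0. t \<noteq> 0 \<and> F t (t *s c) $ 1 = defect_y V Y' Z' t / fst (V (t, Y' t, Z' t)) / t ^ j
      \<and> F t (t *s c) $ 2 = defect_z V Y' Z' t / fst (V (t, Y' t, Z' t)) / t ^ j"
      using ident dY P0
    proof eventually_elim
      case (elim t)
      have t: "t \<noteq> 0" using elim by blast
      note i = elim(1)[rule_format, of "t *s c"]
      have ar: "t ^ j *s (t *s c) + vec2 (Y t / t) (Z t / t) = vec2 (Y' t / t) (Z' t / t)"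
        using arg[OF t, of 0] by simp
      have yd: "defect_y V Y' Z' t / fst (V (t, Y' t, Z' t)) = fst (snd (V (t, Y' t, Z' t))) / fst (V (t, Y' t, Z' t)) - deriv Y' t"
        "defect_z V Y' Z' t / fst (V (t, Y' t, Z' t)) = snd (snd (V (t, Y' t, Z' t))) / fst (V (t, Y' t, Z' t)) - deriv Z' t"
        using elim(3) by (simp_all add: defect_y_def defect_z_def diff_divide_distrib)
      have y1: "Y' t / t = Y t / t + t ^ (n - 1) * c $ 1" "Z' t / t = Z t / t + t ^ (n - 1) * c $ 2"
        by (simp_all only: Y'_def Z'_def add_divide_distrib xp(2)[OF t])
      have nj: "of_nat n = (of_nat j + 2 :: complex)" by (simp add: n_def)
      have r1: "t ^ j * F t (t *s c) $ 1 = defect_y V Y' Z' t / fst (V (t, Y' t, Z' t))"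
        using i[THEN conjunct1] elim(2) unfolding ar G(1)[OF t] yd unfolding c y1 vector_smult_component xp(1)[OF t, symmetric] nj
        by (simp add: algebra_simps)
      have r2: "t ^ j * F t (t *s c) $ 2 = defect_z V Y' Z' t / fst (V (t, Y' t, Z' t))"
        using i[THEN conjunct2] elim(2) unfolding ar G(2)[OF t] yd unfolding c y1 vector_smult_component xp(1)[OF t, symmetric] nj
        by (simp add: algebra_simps)
      show ?case unfolding r1[symmetric] r2[symmetric] using t by simp
    qed
    show "((\<lambda>t. (inverse (t ^ 2) *s F (t * 1) (t *s c)) $ 1) \<longlongrightarrow> e1 / \<mu>) (at 0)"
      unfolding \<mu>_def
    proof (rule defect_quotient_tendsto[OF hol(1,4,5) w1 vanishes_mono[OF P(4)] vanishes_mono[OF P(6)] e1, where l = n])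
      show "\<forall>\<^sub>F t in at 0. (inverse (t ^ 2) *s F (t * 1) (t *s c)) $ 1
        = defect_y V Y' Z' t / fst (vfield w1 w2 lam f g h (t, Y' t, Z' t)) / t ^ n"
        using key by (rule eventually_mono) (simp add: n_def V_def divide_inverse power_add power2_eq_square mult_ac)
    qed simp_all
    show "((\<lambda>t. (inverse (t ^ 2) *s F (t * 1) (t *s c)) $ 2) \<longlongrightarrow> e2 / \<mu>) (at 0)"
      unfolding \<mu>_def
    proof (rule defect_quotient_tendsto[OF hol(1,4,5) w1 vanishes_mono[OF P(4)] vanishes_mono[OF P(6)] e2, where l = n])
      show "\<forall>\<^sub>F t in at 0. (inverse (t ^ 2) *s F (t * 1) (t *s c)) $ 2
        = defect_z V Y' Z' t / fst (vfield w1 w2 lam f g h (t, Y' t, Z' t)) / t ^ n"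
        using key by (rule eventually_mono) (simp add: n_def V_def divide_inverse power_add power2_eq_square mult_ac)
    qed simp_all
  qed
  define a' where "a' = quad_part F 1 c"
  have a': "a' = vec2 (e1 / \<mu>) (e2 / \<mu>)"
    unfolding a'_def quad_part_def using lim by (intro tendsto_Lim) auto
  define F' where "F' = (\<lambda>x w. inverse x *s F x (x *s (w + c)) - x *s a')"
  have R: "reduce_step B = (a', bb_matrix B - mat 1, F')"
    unfolding reduce_step_def Let_def a'_def F'_def c_def a_def F_def by simp
  have B': "bb_const (reduce_step B) = a'" "bb_matrix (reduce_step B) = diag2 (m2 - 1 - of_nat (Suc j)) (m3 - 1 - of_nat (Suc j))"
    "bb_nonlin (reduce_step B) = F'"
    by (simp_all add: R bb_const_def bb_matrix_def bb_nonlin_def M diag2_minus_mat algebra_simps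
        M[unfolded bb_matrix_def])
  have "\<forall>\<^sub>F x in at 0. \<forall>w.
        G x (x ^ Suc j *s w + vec2 (Y' x / x) (Z' x / x)) $ 1 - (deriv Y' x - Y' x / x) - of_nat (Suc j) * x ^ Suc j * w $ 1
          = x ^ Suc j * (x * a' $ 1 + (m2 - 1 - of_nat (Suc j)) * w $ 1 + F' x w $ 1) \<and>
        G x (x ^ Suc j *s w + vec2 (Y' x / x) (Z' x / x)) $ 2 - (deriv Z' x - Z' x / x) - of_nat (Suc j) * x ^ Suc j * w $ 2
          = x ^ Suc j * (x * a' $ 2 + (m3 - 1 - of_nat (Suc j)) * w $ 2 + F' x w $ 2)"
    using ident dY
  proof eventually_elim
    case (elim x)
    note I = elim(1) and d = elim(2)
    have x: "x \<noteq> 0" using d by blast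
    have y1: "Y' x / x = Y x / x + x * x ^ j * c $ 1" "Z' x / x = Z x / x + x * x ^ j * c $ 2"
      by (simp_all only: Y'_def Z'_def add_divide_distrib xp[OF x])
    have d': "deriv Y' x = deriv Y x + of_nat n * (x * x ^ j) * c $ 1" "deriv Z' x = deriv Z x + of_nat n * (x * x ^ j) * c $ 2"
      using d xp(1)[OF x] by simp_all
    \<comment> \<open>The x a' subtracted in F' cancels the constant term of the new system.\<close>
    have F: "x ^ Suc j * (x * a' $ l + s + F' x w $ l) = x ^ Suc j * s + x ^ j * F x (x *s (w + c)) $ l" for l s w
      using x by (simp add: F'_def algebra_simps)
    have nj: "of_nat n = (of_nat j + 2 :: complex)" by (simp add: n_def)
    \<comment> \<open>One scalar identity for both components: q stands for Y/x, k and v for the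
      entries of c and w, H for the right-hand side, and the entry of a is written (j + 2 - m)
      k.\<close>
    have alg: "H - (y' + (of_nat j + 2) * (x * x ^ j) * k - (q + x * x ^ j * k)) - of_nat (Suc j) * x ^ Suc j * v
        = x ^ Suc j * ((m - 1 - of_nat (Suc j)) * v) + x ^ j * r"
      if "H - (y' - q) - of_nat j * x ^ j * (x * (v + k)) = x ^ j * (x * ((of_nat j + 2 - m) * k) + (m - 1 - of_nat j) * (x * (v + k)) + r)"
      for H y' q k v m r
    proof -
      have "H = (y' - q) + of_nat j * x ^ j * (x * (v + k)) + x ^ j * (x * ((of_nat j + 2 - m) * k) + (m - 1 - of_nat j) * (x * (v + k)) + r)"
        using that by (simp add: algebra_simps)
      then show ?thesis by (simp add: algebra_simps)
    qed
    show ?case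
    proof
      fix w
      note i = I[rule_format, of "x *s (w + c)", unfolded arg[OF x]]
      show "G x (x ^ Suc j *s w + vec2 (Y' x / x) (Z' x / x)) $ 1 - (deriv Y' x - Y' x / x) - of_nat (Suc j) * x ^ Suc j * w $ 1
          = x ^ Suc j * (x * a' $ 1 + (m2 - 1 - of_nat (Suc j)) * w $ 1 + F' x w $ 1) \<and>
        G x (x ^ Suc j *s w + vec2 (Y' x / x) (Z' x / x)) $ 2 - (deriv Z' x - Z' x / x) - of_nat (Suc j) * x ^ Suc j * w $ 2
          = x ^ Suc j * (x * a' $ 2 + (m3 - 1 - of_nat (Suc j)) * w $ 2 + F' x w $ 2)"
        unfolding F d' y1 nj
        by (rule conjI; rule alg)
          (use i in \<open>simp_all only: c nj vector_smult_component vector_add_component y1\<close>)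
    qed
  qed
  moreover have "vanishes (Suc n) (\<lambda>t. \<phi> t - Y' t) \<and> vanishes (Suc n) (\<lambda>t. \<psi> t - Z' t)"
    if S: "invariant_graph_germ V \<phi> \<psi>" for \<phi> \<psi>
  proof -
    obtain d1 d2 where d: "a $ 1 + (m2 - of_nat n) * d1 = 0" "a $ 2 + (m3 - of_nat n) * d2 = 0"
      "vanishes (Suc n) (\<lambda>t. \<phi> t - (Y t + t ^ n * d1))" "vanishes (Suc n) (\<lambda>t. \<psi> t - (Z t + t ^ n * d2))"
      using solution_jet_coefficient[OF hol w1 J[unfolded V_def \<mu>_def m2_def m3_def] S[unfolded V_def]]
      unfolding a_def m2_def m3_def \<mu>_def n_def[symmetric] n(1) by blast
    \<comment> \<open>c and the coefficients of an invariant graph solve the same linear equations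
      with non-zero factors, hence coincide.\<close>
    have "(of_nat n - m2) * (c $ 1 - d1) = 0" "(of_nat n - m3) * (c $ 2 - d2) = 0"
      using d(1,2) unfolding c by (simp_all add: algebra_simps)
    then have "c $ 1 = d1" "c $ 2 = d2" using nz by auto
    then show ?thesis using d(3,4) by (simp add: Y'_def Z'_def)
  qed
  ultimately have "reduced_jet V \<mu> m2 m3 (Suc j) (reduce_step B) Y' Z'"
    unfolding reduced_jet_def B' G_def[symmetric]
    using P(3-6) e1 e2 \<mu> by (simp add: a' n_def numeral_3_eq_3)
  then show ?thesis by blast
qed

text \<open>Passing from i to i + 1 steps divides by i + 2 - w2/w1 and i + 2 - lam/(\<i> w1); the
  second is non-zero because Re lam \<noteq> 0.\<close>

lemma reduced_jet_iterate:
  fixes w1 w2 :: real and lam :: complex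
  assumes hol: "holo3 f U" "holo3 g U" "holo3 h U" "0 \<in> U" "order2 f" "order2 g" "order2 h"
    and w1: "w1 \<noteq> 0" and lam: "Re lam \<noteq> 0"
    and nr: "\<And>i. i < j \<Longrightarrow> real (i + 2) \<noteq> w2 / w1"
  shows "\<exists>Y Z. reduced_jet (vfield w1 w2 lam f g h) (\<i> * of_real w1) (of_real w2 / of_real w1) (lam / (\<i> * of_real w1)) j
    ((reduce_step ^^ j) (bb_of_rhs (bb_x_rhs (vfield w1 w2 lam f g h)))) Y Z"
  using nr
proof (induction j)
  case 0
  then show ?case using reduced_jet_initial[OF hol w1] by fastforce
next
  case (Suc j)
  then obtain Y Z where J: "reduced_jet (vfield w1 w2 lam f g h) (\<i> * of_real w1) (of_real w2 / of_real w1) (lam / (\<i> * of_real w1)) j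
    ((reduce_step ^^ j) (bb_of_rhs (bb_x_rhs (vfield w1 w2 lam f g h)))) Y Z" by fastforce
  have "of_nat (j + 2) \<noteq> complex_of_real w2 / of_real w1"
    using Suc.prems[of j] unfolding of_nat_eq_of_real_divide by simp
  from reduced_jet_step[OF hol w1 J this nat_neq_imaginary_quotient[OF lam w1]] show ?case by simp
qed

section \<open>Center manifolds and the full statement\<close>

lemma center_manifold_invariant_germ:
  assumes "x_center_manifold U V \<phi> \<psi> r"
  shows "invariant_graph_germ V \<phi> \<psi>"
proof -
  have r: "r > 0" "\<phi> holomorphic_on ball 0 r" "\<psi> holomorphic_on ball 0 r"
    "\<phi> 0 = 0" "\<psi> 0 = 0" "deriv \<phi> 0 = 0" "deriv \<psi> 0 = 0"
    and inv: "\<forall>x\<in>ball 0 r. \<exists>c. V (x, \<phi> x, \<psi> x) = (c, c * deriv \<phi> x, c * deriv \<psi> x)"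
    using assms unfolding x_center_manifold_def by blast+
  have a: "\<phi> analytic_on {0}" "\<psi> analytic_on {0}"
    using r by (auto intro!: holomorphic_on_imp_analytic_at[OF _ open_ball])
  have "\<forall>\<^sub>F s in nhds 0. s \<in> ball (0::complex) r" using r(1) by (intro eventually_nhds_in_open) auto
  then have "\<forall>\<^sub>F t in nhds 0. defect_y V \<phi> \<psi> t = 0 \<and> defect_z V \<phi> \<psi> t = 0"
  proof eventually_elim
    case (elim t)
    then obtain c where "V (t, \<phi> t, \<psi> t) = (c, c * deriv \<phi> t, c * deriv \<psi> t)" using inv by blast
    then show ?case by (simp add: defect_y_def defect_z_def)
  qed
  then show ?thesis
    unfolding invariant_graph_germ_def using a r vanishes_2_of_deriv by blast
qed

theorem theorem3p2:
  fixes w1 w2 :: real and lam :: complex and f g h :: "c3 \<Rightarrow> complex" and U :: "c3 set"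
  assumes "w1 \<noteq> 0" and "w2 \<noteq> 0" and "w1 \<noteq> w2" and "\<bar>w1\<bar> \<le> \<bar>w2\<bar>" and "Re lam \<noteq> 0"
    and "open U" and "0 \<in> U" and "holo3 f U" and "holo3 g U" and "holo3 h U"
    and "order2 f" and "order2 g" and "order2 h"
  defines "V \<equiv> vfield w1 w2 lam f g h"
  shows
    "(\<exists>\<phi> \<psi> r. y_center_manifold U V \<phi> \<psi> r \<and> iso_family U V (y_graph \<phi> \<psi> r) (2 * pi / \<bar>w2\<bar>))
   \<and> (w2 / w1 \<notin> {real n | n. n \<ge> 1} \<longrightarrow>
        (\<exists>\<phi> \<psi> r. x_center_manifold U V \<phi> \<psi> r \<and> iso_family U V (x_graph \<phi> \<psi> r) (2 * pi / \<bar>w1\<bar>)))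
   \<and> (\<forall>k::nat. k \<ge> 1 \<and> w2 / w1 = real k \<longrightarrow>
        (let B = (reduce_step ^^ (k - 2)) (bb_of_rhs (bb_x_rhs V)); pbar = bb_const B $ 1 in
          bb_matrix B $ 1 $ 1 = 1
        \<and> (pbar = 0 \<longrightarrow>
             (\<exists>\<Phi> \<Psi> :: nat \<Rightarrow> complex \<Rightarrow> complex. \<exists>\<rho> :: nat \<Rightarrow> real.
                (\<forall>n. x_center_manifold U V (\<Phi> n) (\<Psi> n) (\<rho> n)
                     \<and> iso_family U V (x_graph (\<Phi> n) (\<Psi> n) (\<rho> n)) (2 * pi / \<bar>w1\<bar>))
              \<and> (\<forall>i j. i \<noteq> j \<longrightarrow>
                   \<not> (\<forall>\<^sub>F x in nhds 0. \<Phi> i x = \<Phi> j x \<and> \<Psi> i x = \<Psi> j x))))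
        \<and> (pbar \<noteq> 0 \<longrightarrow> \<not> (\<exists>\<phi> \<psi> r. x_center_manifold U V \<phi> \<psi> r))))"
proof -
  note hol = assms(8-10,7,11-13)
  note w1 = assms(1) and w2 = assms(2) and lam = assms(5)
  have part1: "\<exists>\<phi> \<psi> r. y_center_manifold U V \<phi> \<psi> r \<and> iso_family U V (y_graph \<phi> \<psi> r) (2 * pi / \<bar>w2\<bar>)"
    unfolding V_def
  proof (rule y_manifold_nonresonant[OF hol w2 lam])
    fix n :: nat assume n: "n \<ge> 2"
    \<comment> \<open>|w1| \<le> |w2| keeps w1/w2 below every degree n \<ge> 2.\<close>
    have "\<bar>w1 / w2\<bar> \<le> 1" using assms(2,4) by (simp add: abs_divide)
    then have "w1 / w2 \<le> 1" by (rule abs_le_D1)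
    moreover have "real n \<ge> 2" using n by simp
    ultimately show "real n \<noteq> w1 / w2" by linarith
  qed
  have part2: "\<exists>\<phi> \<psi> r. x_center_manifold U V \<phi> \<psi> r \<and> iso_family U V (x_graph \<phi> \<psi> r) (2 * pi / \<bar>w1\<bar>)"
    if "w2 / w1 \<notin> {real n | n. n \<ge> 1}"
    unfolding V_def
  proof (rule x_manifold_nonresonant[OF hol w1 lam])
    fix n :: nat assume "n \<ge> 2"
    then have "real n \<in> {real n | n. n \<ge> 1}" by auto
    with that show "real n \<noteq> w2 / w1" by metis
  qed
  have part3: "bb_matrix B $ 1 $ 1 = 1
        \<and> (bb_const B $ 1 = 0 \<longrightarrow>
             (\<exists>\<Phi> \<Psi> :: nat \<Rightarrow> complex \<Rightarrow> complex. \<exists>\<rho> :: nat \<Rightarrow> real.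
                (\<forall>n. x_center_manifold U V (\<Phi> n) (\<Psi> n) (\<rho> n)
                     \<and> iso_family U V (x_graph (\<Phi> n) (\<Psi> n) (\<rho> n)) (2 * pi / \<bar>w1\<bar>))
              \<and> (\<forall>i j. i \<noteq> j \<longrightarrow>
                   \<not> (\<forall>\<^sub>F x in nhds 0. \<Phi> i x = \<Phi> j x \<and> \<Psi> i x = \<Psi> j x))))
        \<and> (bb_const B $ 1 \<noteq> 0 \<longrightarrow> \<not> (\<exists>\<phi> \<psi> r. x_center_manifold U V \<phi> \<psi> r))"
    if k: "k \<ge> 1" "w2 / w1 = real k" and B: "B = (reduce_step ^^ (k - 2)) (bb_of_rhs (bb_x_rhs V))" for k :: nat and B
  proof -
    \<comment> \<open>k = 1 would mean w1 = w2; with k \<ge> 2 the subtraction k - 2 on naturals is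
      exact.\<close>
    have "k \<noteq> 1" using k(2) w1 assms(3) by auto
    then have k2: "k \<ge> 2" using k(1) by simp
    define j where "j = k - 2"
    have j: "j + 2 = k" "j + 3 = Suc k" using k2 by (simp_all add: j_def)
    define \<mu> where "\<mu> = \<i> * complex_of_real w1"
    have m2: "complex_of_real w2 / of_real w1 = of_nat k" using k(2) by (metis of_nat_eq_of_real_divide)
    \<comment> \<open>The k - 2 steps involve only the degrees 2, ..., k - 1, below the
      resonance.\<close>
    have nr: "real (i + 2) \<noteq> w2 / w1" if "i < j" for i using that k(2) j(1) by simp
    obtain Y Z where J: "reduced_jet V \<mu> (of_real w2 / of_real w1) (lam / \<mu>) j B Y Z"
      using reduced_jet_iterate[OF hol w1 lam nr] unfolding B V_def \<mu>_def j_def by blast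
    have M: "bb_matrix B $ 1 $ 1 = 1" using J unfolding reduced_jet_def m2 by (simp add: j(1)[symmetric])
    have Y: "Y analytic_on {0}" "vanishes 2 Y" and Z: "Z analytic_on {0}" "vanishes 2 Z"
      and E: "vanishes (Suc k) (\<lambda>t. defect_y V Y Z t - t ^ k * (\<mu> * bb_const B $ 1))"
        "vanishes (Suc k) (\<lambda>t. defect_z V Y Z t - t ^ k * (\<mu> * bb_const B $ 2))"
      using J unfolding reduced_jet_def j by blast+
    have "\<exists>\<Phi> \<Psi> :: nat \<Rightarrow> complex \<Rightarrow> complex. \<exists>\<rho> :: nat \<Rightarrow> real.
                (\<forall>n. x_center_manifold U V (\<Phi> n) (\<Psi> n) (\<rho> n)
                     \<and> iso_family U V (x_graph (\<Phi> n) (\<Psi> n) (\<rho> n)) (2 * pi / \<bar>w1\<bar>))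
              \<and> (\<forall>i j. i \<noteq> j \<longrightarrow> \<not> (\<forall>\<^sub>F x in nhds 0. \<Phi> i x = \<Phi> j x \<and> \<Psi> i x = \<Psi> j x))"
      if p: "bb_const B $ 1 = 0"
    proof -
      \<comment> \<open>Degree k is not resonant for the third eigenvalue: the denominator has real
        part Re lam, and d cancels the z-defect at order k. The degree k coefficient of Y is left at
        0, as the y-defect at that order is \<mu> times pbar and hence already zero.\<close>
      define d where "d = - (\<mu> * bb_const B $ 2) / (lam - of_nat k * \<mu>)"
      have "Re (lam - of_nat k * \<mu>) \<noteq> 0" using lam by (simp add: \<mu>_def)
      then have d: "(lam - of_nat k * \<mu>) * d = - (\<mu> * bb_const B $ 2)" by (auto simp: d_def)
      define Y' Z' where "Y' = (\<lambda>t. Y t + t ^ k * 0)" and "Z' = (\<lambda>t. Z t + t ^ k * d)"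
      have c: "(\<lambda>_::complex. 0::complex) analytic_on {0}" "(\<lambda>_::complex. d) analytic_on {0}" by (intro analytic_intros)+
      note P = defect_add_power(1,2)[OF hol Y Z c k2, of w1 w2 lam, folded V_def \<mu>_def Y'_def Z'_def]
        defect_add_power(3-6)[OF hol Y Z c k2, folded Y'_def Z'_def]
      have "vanishes (Suc k) (defect_y V Y' Z')" using vanishes_add[OF P(1) E(1)] p by simp
      moreover have "vanishes (Suc k) (defect_z V Y' Z')" using vanishes_add[OF P(2) E(2)] unfolding d by simp
      ultimately show ?thesis
        unfolding V_def
        by (intro x_manifolds_resonant[OF hol w1 lam k2 k(2) P(3-6)]) (simp_all add: defect_y_def[abs_def] defect_z_def[abs_def] V_def)
    qed
    moreover have "bb_const B $ 1 = 0" if S: "x_center_manifold U V \<phi> \<psi> r" for \<phi> \<psi> r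
    proof -
      \<comment> \<open>At degree j + 2 = k the factor of d1 is zero, so any invariant graph forces
        pbar = 0.\<close>
      obtain d1 where "bb_const B $ 1 + (of_real w2 / of_real w1 - of_nat (j + 2)) * d1 = 0"
        using solution_jet_coefficient[OF hol w1 J[unfolded V_def \<mu>_def] center_manifold_invariant_germ[OF S[unfolded V_def]]]
        by blast
      then show ?thesis unfolding m2 j(1) by simp
    qed
    ultimately show ?thesis using M by blast
  qed
  show ?thesis
    unfolding Let_def by (intro conjI allI impI part1 part2 part3[OF _ _ refl, THEN conjunct1]
        part3[OF _ _ refl, THEN conjunct2, THEN conjunct1, THEN mp] part3[OF _ _ refl, THEN conjunct2, THEN conjunct2, THEN mp]) auto
qed

end
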